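(* Let $\varphi,\psi$ satisfy the standing hypotheses given in the context. For every $\nu>0$ there exist $\tau_\nu>0$ and $\sigma_\nu>2\tau_\nu$ such that, for every optimal trajectory $X(\cdot)=(x,y,\theta,\kappa)$ with final time $T>\sigma_\nu$ and final point $X_1=(x_1,y_1,\theta_1,0)$, and every associated adjoint vector $p=(p_1,p_2,p_3,p_4)$, setting $Z(t)=(\theta(t),\kappa(t),p_3(t),p_4(t))$ and writing $(x_1,y_1)=|(x_1,y_1)|(\cos\alpha,\sin\alpha)$ with $\alpha\in[0,2\pi)$, one has $$|Z(t)-(\alpha,0,0,0)|<\nu\qquad\text{for all }t\in[\tau_\nu,T-\tau_\nu].$$
   Context: Standing hypotheses on the cost: (1) $\varphi$ and $\psi$ are nonnegative, even, $C^2$ functions on $\mathbb{R}$, nondecreasing on $[0,\infty)$, with $\varphi(0)=\psi(0)=0$; (2) $\psi$ is strictly convex and $\psi''(0)>0$; (3) there exist $p>1$ and constants $C,R>0$ such that $\psi(r)\ge C|r|^p$ for all $|r|\ge R$. Control system: the state is $X=(x,y,\theta,\kappa)\in\mathbb{R}^2\times S^1\times\mathbb{R}$; a control is a measurable function $u:[0,T]\to\mathbb{R}$ with finite $L^p$ norm ($T>0$ depends on $u$), and its trajectory solves $\dot x=\cos\theta,\ \dot y=\sin\theta,\ \dot\theta=\kappa,\ \dot\kappa=u$. Optimal trajectory: fix $X_0=(0,0,\pi/2,0)$. An optimal trajectory is a trajectory on $[0,T]$ with $X(0)=X_0$ and $X(T)=X_1$, for some $X_1=(x_1,y_1,\theta_1,0)$,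 which minimizes $\int_0^T[1+\varphi(\kappa)+\psi(u)]\,dt$ among all trajectories from $X_0$ to $X_1$ with free final time $T$. Adjoint vector: an adjoint vector associated with an optimal trajectory is an absolutely continuous $p=(p_1,p_2,p_3,p_4):[0,T]\to\mathbb{R}^4$ with $\dot p_1=\dot p_2=0$, $\dot p_3=p_1\sin\theta-p_2\cos\theta$, $\dot p_4=-p_3+\varphi'(\kappa)$, $u(t)=(\psi')^{-1}(p_4(t))$ for a.e. $t$, and $p_1\cos\theta+p_2\sin\theta+p_3\kappa+p_4u-(1+\varphi(\kappa)+\psi(u))=0$ along the trajectory. (By the Pontryagin maximum principle, every optimal trajectory admits such a $p$; abnormal extremals do not occur.) Differences of angles (in particular the first component of $Z(t)-(\alpha,0,0,0)$) are taken modulo $2\pi$ with values in $[-\pi,\pi]$. *)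

theory Defs
  imports "HOL-Analysis.Analysis" "HOL-Library.Real_Mod"
begin

definition C2 :: "(real \<Rightarrow> real) \<Rightarrow> bool" where
  "C2 f \<longleftrightarrow> f differentiable_on UNIV \<and> deriv f differentiable_on UNIV \<and>
            continuous_on UNIV (deriv (deriv f))"

definition strictly_convex :: "(real \<Rightarrow> real) \<Rightarrow> bool" where
  "strictly_convex f \<longleftrightarrow>
     (\<forall>x y t. x \<noteq> y \<longrightarrow> 0 < t \<longrightarrow> t < 1 \<longrightarrow>
        f ((1 - t) * x + t * y) < (1 - t) * f x + t * f y)"

text \<open>
  The usual epsilon-delta definition of absolute continuity: the library relation
  \<open>division_of\<close> supplies the finite families of nonoverlapping compact intervals
  \<open>K = {Inf K..Sup K}\<close>.
\<close>
definition abs_continuous_on :: "real set \<Rightarrow> (real \<Rightarrow> 'a::real_normed_vector) \<Rightarrow> bool" where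
  "abs_continuous_on S f \<longleftrightarrow>
     (\<forall>\<epsilon>>0. \<exists>\<delta>>0. \<forall>D A. D division_of A \<longrightarrow> A \<subseteq> S \<longrightarrow> (\<Sum>K\<in>D. Sup K - Inf K) < \<delta> \<longrightarrow>
        (\<Sum>K\<in>D. norm (f (Sup K) - f (Inf K))) < \<epsilon>)"

text \<open>
  States are quadruples \<open>(x, y, \<theta>, \<kappa>)\<close>. The angle, an element of the circle, is represented by a
  real number, and states are compared modulo \<open>2\<pi>\<close> in that component. A curve on the circle
  that is absolutely continuous is the projection of a real-valued absolutely continuous one,
  so trajectories may be given by their lifts.
\<close>
type_synonym state = "real \<times> real \<times> real \<times> real"

definition same_state :: "state \<Rightarrow> state \<Rightarrow> bool" where
  "same_state = (\<lambda>(x, y, \<theta>, \<kappa>) (x', y', \<theta>', \<kappa>').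
     x = x' \<and> y = y' \<and> [\<theta> = \<theta>'] (rmod (2 * pi)) \<and> \<kappa> = \<kappa>')"

definition X_init :: state where
  "X_init = (0, 0, pi / 2, 0)"

text \<open>The representative of \<open>a - b\<close> modulo \<open>2\<pi>\<close> in \<open>]-\<pi>, \<pi>]\<close>.\<close>
definition angle_diff :: "real \<Rightarrow> real \<Rightarrow> real" where
  "angle_diff a b = Arg (cis (a - b))"

definition dynamics :: "state \<Rightarrow> real \<Rightarrow> state" where
  "dynamics = (\<lambda>(x, y, \<theta>, \<kappa>) v. (cos \<theta>, sin \<theta>, \<kappa>, v))"

definition control :: "real \<Rightarrow> real \<Rightarrow> (real \<Rightarrow> real) \<Rightarrow> bool" where
  "control p T u \<longleftrightarrow> T > 0 \<and> u \<in> borel_measurable (lebesgue_on {0..T}) \<and>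
     integrable (lebesgue_on {0..T}) (\<lambda>t. \<bar>u t\<bar> powr p)"

definition trajectory :: "real \<Rightarrow> real \<Rightarrow> (real \<Rightarrow> real) \<Rightarrow> (real \<Rightarrow> state) \<Rightarrow> bool" where
  "trajectory p T u X \<longleftrightarrow> control p T u \<and> abs_continuous_on {0..T} X \<and>
     (AE t in lebesgue_on {0..T}. (X has_vector_derivative dynamics (X t) (u t)) (at t))"

definition running_cost :: "(real \<Rightarrow> real) \<Rightarrow> (real \<Rightarrow> real) \<Rightarrow> state \<Rightarrow> real \<Rightarrow> real" where
  "running_cost \<phi> \<psi> = (\<lambda>(x, y, \<theta>, \<kappa>) v. 1 + \<phi> \<kappa> + \<psi> v)"

text \<open>
  The cost takes values in \<open>[0, \<infinity>]\<close>, since a finite \<open>L\<^sup>p\<close> norm of \<open>u\<close> does not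
  make \<open>\<psi> \<circ> u\<close> integrable.
\<close>
definition cost ::
  "(real \<Rightarrow> real) \<Rightarrow> (real \<Rightarrow> real) \<Rightarrow> real \<Rightarrow> (real \<Rightarrow> real) \<Rightarrow> (real \<Rightarrow> state) \<Rightarrow> ennreal" where
  "cost \<phi> \<psi> T u X = (\<integral>\<^sup>+ t. ennreal (running_cost \<phi> \<psi> (X t) (u t)) \<partial>lebesgue_on {0..T})"

definition optimal_trajectory ::
  "(real \<Rightarrow> real) \<Rightarrow> (real \<Rightarrow> real) \<Rightarrow> real \<Rightarrow> real \<Rightarrow> (real \<Rightarrow> real) \<Rightarrow> (real \<Rightarrow> state) \<Rightarrow> state \<Rightarrow> bool" where
  "optimal_trajectory \<phi> \<psi> p T u X X\<^sub>1 \<longleftrightarrow>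
     trajectory p T u X \<and> same_state (X 0) X_init \<and> same_state (X T) X\<^sub>1 \<and>
     (\<forall>T' u' X'. trajectory p T' u' X' \<longrightarrow> same_state (X' 0) X_init \<longrightarrow> same_state (X' T') X\<^sub>1 \<longrightarrow>
        cost \<phi> \<psi> T u X \<le> cost \<phi> \<psi> T' u' X')"

definition adjoint_field :: "(real \<Rightarrow> real) \<Rightarrow> state \<Rightarrow> state \<Rightarrow> state" where
  "adjoint_field \<phi> = (\<lambda>(x, y, \<theta>, \<kappa>) (p\<^sub>1, p\<^sub>2, p\<^sub>3, p\<^sub>4).
     (0, 0, p\<^sub>1 * sin \<theta> - p\<^sub>2 * cos \<theta>, - p\<^sub>3 + deriv \<phi> \<kappa>))"

definition adjoint_vector ::
  "(real \<Rightarrow> real) \<Rightarrow> (real \<Rightarrow> real) \<Rightarrow> real \<Rightarrow> (real \<Rightarrow> real) \<Rightarrow> (real \<Rightarrow> state) \<Rightarrow> (real \<Rightarrow> state) \<Rightarrow> bool" where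
  "adjoint_vector \<phi> \<psi> T u X P \<longleftrightarrow>
     abs_continuous_on {0..T} P \<and>
     (AE t in lebesgue_on {0..T}. (P has_vector_derivative adjoint_field \<phi> (X t) (P t)) (at t)) \<and>
     (AE t in lebesgue_on {0..T}. case P t of (p\<^sub>1, p\<^sub>2, p\<^sub>3, p\<^sub>4) \<Rightarrow> u t = inv (deriv \<psi>) p\<^sub>4) \<and>
     (AE t in lebesgue_on {0..T}. case (X t, P t) of ((x, y, \<theta>, \<kappa>), (p\<^sub>1, p\<^sub>2, p\<^sub>3, p\<^sub>4)) \<Rightarrow>
        p\<^sub>1 * cos \<theta> + p\<^sub>2 * sin \<theta> + p\<^sub>3 * \<kappa> + p\<^sub>4 * u t - (1 + \<phi> \<kappa> + \<psi> (u t)) = 0)"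

text \<open>The vector \<open>(\<theta>, \<kappa>, p\<^sub>3, p\<^sub>4) - (\<alpha>, 0, 0, 0)\<close>; its \<open>norm\<close> is the Euclidean one.\<close>
definition Z_deviation :: "real \<Rightarrow> state \<Rightarrow> state \<Rightarrow> real \<times> real \<times> real \<times> real" where
  "Z_deviation \<alpha> = (\<lambda>(x, y, \<theta>, \<kappa>) (p\<^sub>1, p\<^sub>2, p\<^sub>3, p\<^sub>4). (angle_diff \<theta> \<alpha>, \<kappa>, p\<^sub>3, p\<^sub>4))"

end

theory Submission
  imports Defs
begin

text \<open>
  The excess \<open>1 - cos (\<theta> - \<alpha>) + \<phi> \<kappa> + \<psi> u\<close> of the running cost over the velocity in the direction
  \<open>\<alpha>\<close> of the target integrates to the cost minus the distance of the target. Comparison with an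
  explicit trajectory (turn, go straight, turn) bounds the total excess independently of the
  target, so near either end of a long time interval there is a time at which \<open>\<theta>\<close> is close to \<open>\<alpha>\<close>
  and \<open>\<kappa>\<close> is close to \<open>0\<close>. Between two such times the trajectory is optimal as well; there the
  competitor turns by little and has little excess, hence so has the optimal trajectory. Small
  excess over a window of length one forces \<open>\<theta> - \<alpha>\<close> and \<open>\<kappa>\<close> to be uniformly small, and \<open>u\<close>,
  hence \<open>p\<^sub>4 = \<psi>' u\<close>, to be small at many times; the adjoint equations and the vanishing of the
  Hamiltonian then make \<open>p\<^sub>3\<close> and \<open>p\<^sub>4\<close> small on the whole window.
\<close>

section \<open>Absolutely continuous functions\<close>

text \<open>The bound on the total excess is uniform but not small: alone it yields some good
  windows and leaves room for a detour between them. The second comparison, on the middle part,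
  excludes detours. The ends of that part need not lie on a line of direction \<alpha>: the
  displacement across \<alpha> is bounded only by the time spent outside. The competitor therefore
  takes a heading off \<alpha> by at most g, at a cost of order g times that displacement, and the
  order of choices is forced: \<nu> fixes the allowed excess, this fixes how good the two end times
  must be, these fix the end length \<tau>, and only then can g be taken small and \<sigma> large
  enough for such a heading to exist. The adjoint vector has no a priori bound, so its errors are
  measured relative to its own size; the summand 1 of the running cost, through the Hamiltonian,
  turns them into absolute ones.\<close>

lemma division_of_real_interval:
  fixes D :: "real set set"
  assumes "D division_of A" "K \<in> D"
  obtains a b where "a \<le> b" "K = {a..b}"
  using division_ofD(3,4)[OF assms] by (metis atLeastatMost_empty box_real(2) not_le)

text \<open>Two cells meet in an interval with empty interior, which is negligible, so measures add.
  It converts the total length in \<open>abs_continuous_on\<close> into a Lebesgue measure that an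
  open cover of a null set can bound.\<close>

lemma measure_division_of:
  fixes D :: "real set set"
  assumes "D division_of A"
  shows "A \<in> lmeasurable" and "measure lebesgue A = (\<Sum>K\<in>D. Sup K - Inf K)"
proof -
  have A: "A = \<Union>D" using assms by auto
  have fin: "finite D" using assms by auto
  have cb: "\<exists>a b. a \<le> b \<and> K = {a..b}" if "K \<in> D" for K
    using division_of_real_interval[OF assms that] by metis
  have lm: "K \<in> lmeasurable" if "K \<in> D" for K using cb[OF that] by auto
  have ms: "measure lebesgue K = Sup K - Inf K" if "K \<in> D" for K using cb[OF that] by auto
  have neg: "negligible (K \<inter> L)" if "K \<in> D" "L \<in> D" "K \<noteq> L" for K L
  proof -
    obtain a b c d where k: "K = cbox a b" "L = cbox c d"
      using cb[OF \<open>K \<in> D\<close>] cb[OF \<open>L \<in> D\<close>] by (metis box_real(2))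
    have "interior (K \<inter> L) = {}" using division_ofD(5)[OF assms that] by simp
    moreover have "K \<inter> L = cbox (max a c) (min b d)" unfolding k by (auto)
    ultimately have "box (max a c) (min b d) = {}" by (metis interior_cbox)
    then show ?thesis using \<open>K \<inter> L = cbox (max a c) (min b d)\<close> negligible_interval(1) by metis
  qed
  show "A \<in> lmeasurable" unfolding A using fin lm by (intro fmeasurable.finite_Union) auto
  have "measure lebesgue A = sum (measure lebesgue) D"
    unfolding A by (rule measure_negligible_finite_Union) (use fin lm neg in \<open>auto simp: pairwise_def\<close>)
  then show "measure lebesgue A = (\<Sum>K\<in>D. Sup K - Inf K)" using ms by simp
qed

text \<open>Serves time shifts and the clamps \<open>min t T\<^sub>1\<close> and
  \<open>max (t - T\<^sub>1) 0\<close>. A nondecreasing 1-Lipschitz \<open>m\<close> carries a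
  division to a division of no greater total length, in which some cells may have collapsed to
  points.\<close>

lemma abs_continuous_on_compose_mono:
  fixes f :: "real \<Rightarrow> 'a::real_normed_vector" and m :: "real \<Rightarrow> real"
  assumes f: "abs_continuous_on S f"
    and mono: "\<And>s t. s \<le> t \<Longrightarrow> m s \<le> m t" and lip: "\<And>s t. s \<le> t \<Longrightarrow> m t - m s \<le> t - s"
    and into: "\<And>s t. \<lbrakk>s \<le> t; {s..t} \<subseteq> S'\<rbrakk> \<Longrightarrow> {m s..m t} \<subseteq> S"
  shows "abs_continuous_on S' (\<lambda>t. f (m t))"
  unfolding abs_continuous_on_def
proof (intro allI impI)
  fix e :: real assume "e > 0"
  then obtain d where "d > 0" and d: "\<And>D A. \<lbrakk>D division_of A; A \<subseteq> S; (\<Sum>K\<in>D. Sup K - Inf K) < d\<rbrakk>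
      \<Longrightarrow> (\<Sum>K\<in>D. norm (f (Sup K) - f (Inf K))) < e"
    using f unfolding abs_continuous_on_def by metis
  show "\<exists>\<delta>>0. \<forall>D A. D division_of A \<longrightarrow> A \<subseteq> S' \<longrightarrow> (\<Sum>K\<in>D. Sup K - Inf K) < \<delta> \<longrightarrow>
        (\<Sum>K\<in>D. norm (f (m (Sup K)) - f (m (Inf K)))) < e"
  proof (intro exI[of _ d] conjI allI impI, rule \<open>d > 0\<close>)
    fix D A assume D: "D division_of A" and AS: "A \<subseteq> S'" and less: "(\<Sum>K\<in>D. Sup K - Inf K) < d"
    define h where "h K = {m (Inf K)..m (Sup K)}" for K
    have fin: "finite D" using D by auto
    have cb: "\<exists>a b. a \<le> b \<and> K = {a..b}" if "K \<in> D" for K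
      using division_of_real_interval[OF D that] by metis
    have bnds: "Inf K \<le> Sup K \<and> {Inf K..Sup K} = K" if "K \<in> D" for K using cb[OF that] by auto
    have hb: "Inf (h K) = m (Inf K)" "Sup (h K) = m (Sup K)" if "K \<in> D" for K
      using bnds[OF that] mono by (auto simp: h_def)
    have disj: "interior (h K) \<inter> interior (h L) = {}" if "K \<in> D" "L \<in> D" "K \<noteq> L" for K L
    proof -
      obtain a b c d where k: "a \<le> b" "K = {a..b}" "c \<le> d" "L = {c..d}"
        using cb[OF \<open>K \<in> D\<close>] cb[OF \<open>L \<in> D\<close>] by metis
      have ie: "{a<..<b} \<inter> {c<..<d} = {}" using division_ofD(5)[OF D that] k by simp
      have "b \<le> c \<or> d \<le> a \<or> a = b \<or> c = d"
      proof (rule ccontr)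
        assume "\<not> ?thesis"
        then have "(max a c + min b d) / 2 \<in> {a<..<b} \<inter> {c<..<d}" using k by (auto simp: max_def min_def field_simps)
        then show False using ie by blast
      qed
      moreover have "{m a<..<m b} \<inter> {m c<..<m d} = {}" if "b \<le> c" using mono[OF that] by auto
      moreover have "{m a<..<m b} \<inter> {m c<..<m d} = {}" if "d \<le> a" using mono[OF that] by auto
      ultimately show ?thesis using k by (auto simp: h_def)
    qed
    \<comment> \<open>A clamp sends many cells to one point, so \<open>h\<close> need not be
      injective on \<open>D\<close>; cells with equal image are degenerate and contribute 0 to both
      sums, which is all that reindexing needs.\<close>
    have nontriv: "Sup (h K) = Inf (h K)" if "K \<in> D" "L \<in> D" "K \<noteq> L" "h K = h L" for K L
    proof -
      have "interior (h K) = {}" using disj[OF that(1-3)] that(4) by simp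
      then show ?thesis using hb[OF that(1)] bnds[OF that(1)] mono[of "Inf K" "Sup K"] by (simp add: h_def)
    qed
    have hD: "h ` D division_of \<Union>(h ` D)"
      unfolding division_of_def
    proof (intro conjI ballI impI)
      fix K assume "K \<in> h ` D"
      then obtain L where L: "L \<in> D" "K = h L" by auto
      then show "K \<noteq> {}" using bnds[of L] mono[of "Inf L" "Sup L"] by (simp add: h_def)
      show "\<exists>a b. K = cbox a b" using L by (auto simp: h_def)
      fix K' assume "K' \<in> h ` D" "K \<noteq> K'"
      then show "interior K \<inter> interior K' = {}" using L disj by auto
    qed (use fin in auto)
    have sub: "\<Union>(h ` D) \<subseteq> S"
    proof
      fix z assume "z \<in> \<Union>(h ` D)"
      then obtain K where K: "K \<in> D" "z \<in> h K" by auto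
      have "{Inf K..Sup K} \<subseteq> S'" using bnds[OF K(1)] division_ofD(2)[OF D K(1)] AS by auto
      from into[OF _ this] K bnds show "z \<in> S" by (auto simp: h_def)
    qed
    have "(\<Sum>K\<in>h ` D. Sup K - Inf K) = (\<Sum>K\<in>D. Sup (h K) - Inf (h K))"
      by (rule sum.reindex_nontrivial[OF fin, unfolded o_def]) (use nontriv in auto)
    also have "\<dots> \<le> (\<Sum>K\<in>D. Sup K - Inf K)"
      by (rule sum_mono) (use hb bnds lip in auto)
    finally have "(\<Sum>K\<in>h ` D. Sup K - Inf K) < d" using less by linarith
    note less = d[OF hD sub this]
    have "(\<Sum>K\<in>D. norm (f (m (Sup K)) - f (m (Inf K)))) = (\<Sum>K\<in>D. norm (f (Sup (h K)) - f (Inf (h K))))"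
      by (rule sum.cong) (use hb in auto)
    also have "\<dots> = (\<Sum>K\<in>h ` D. norm (f (Sup K) - f (Inf K)))"
      by (rule sum.reindex_nontrivial[OF fin, unfolded o_def, symmetric]) (use nontriv in fastforce)
    also have "\<dots> < e" by (rule less)
    finally show "(\<Sum>K\<in>D. norm (f (m (Sup K)) - f (m (Inf K)))) < e" .
  qed
qed

text \<open>Two dominating functions, because a concatenated curve is a sum of two clamped ones;
  with both equal to the identity this covers Lipschitz functions.\<close>

lemma abs_continuous_on_bound:
  fixes f :: "real \<Rightarrow> 'a::real_normed_vector"
    and g :: "real \<Rightarrow> 'b::real_normed_vector" and h :: "real \<Rightarrow> 'c::real_normed_vector"
  assumes g: "abs_continuous_on S g" and h: "abs_continuous_on S h" and B: "B > 0"
    and le: "\<And>s t. \<lbrakk>s \<in> S; t \<in> S\<rbrakk> \<Longrightarrow> norm (f t - f s) \<le> B * (norm (g t - g s) + norm (h t - h s))"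
  shows "abs_continuous_on S f"
  unfolding abs_continuous_on_def
proof (intro allI impI)
  fix e :: real assume "e > 0"
  then have e2: "e / (2 * B) > 0" using B by simp
  obtain d where "d > 0" and d: "\<And>D A. \<lbrakk>D division_of A; A \<subseteq> S; (\<Sum>K\<in>D. Sup K - Inf K) < d\<rbrakk>
      \<Longrightarrow> (\<Sum>K\<in>D. norm (g (Sup K) - g (Inf K))) < e / (2 * B)"
    using g e2 unfolding abs_continuous_on_def by metis
  obtain d' where "d' > 0" and d': "\<And>D A. \<lbrakk>D division_of A; A \<subseteq> S; (\<Sum>K\<in>D. Sup K - Inf K) < d'\<rbrakk>
      \<Longrightarrow> (\<Sum>K\<in>D. norm (h (Sup K) - h (Inf K))) < e / (2 * B)"
    using h e2 unfolding abs_continuous_on_def by metis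
  show "\<exists>\<delta>>0. \<forall>D A. D division_of A \<longrightarrow> A \<subseteq> S \<longrightarrow> (\<Sum>K\<in>D. Sup K - Inf K) < \<delta> \<longrightarrow>
        (\<Sum>K\<in>D. norm (f (Sup K) - f (Inf K))) < e"
  proof (intro exI[of _ "min d d'"] conjI allI impI)
    show "0 < min d d'" using \<open>d > 0\<close> \<open>d' > 0\<close> by simp
    fix D A assume D: "D division_of A" "A \<subseteq> S" and less: "(\<Sum>K\<in>D. Sup K - Inf K) < min d d'"
    have mem: "Sup K \<in> S \<and> Inf K \<in> S" if "K \<in> D" for K
    proof -
      obtain a b where "a \<le> b" "K = {a..b}"
        using division_of_real_interval[OF D(1) \<open>K \<in> D\<close>] .
      then show ?thesis using division_ofD(2)[OF D(1) that] D(2) by auto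
    qed
    have "(\<Sum>K\<in>D. norm (f (Sup K) - f (Inf K))) \<le>
        (\<Sum>K\<in>D. B * (norm (g (Sup K) - g (Inf K)) + norm (h (Sup K) - h (Inf K))))"
      by (rule sum_mono) (use mem le in auto)
    also have "\<dots> = B * ((\<Sum>K\<in>D. norm (g (Sup K) - g (Inf K))) + (\<Sum>K\<in>D. norm (h (Sup K) - h (Inf K))))"
      by (simp add: sum_distrib_left[symmetric] sum.distrib)
    also have "\<dots> < B * (e / (2 * B) + e / (2 * B))"
      using d[OF D] d'[OF D] less B by (intro mult_strict_left_mono add_strict_mono) auto
    also have "\<dots> = e" using B by simp
    finally show "(\<Sum>K\<in>D. norm (f (Sup K) - f (Inf K))) < e" .
  qed
qed

lemma abs_continuous_on_ident: "abs_continuous_on S (\<lambda>t::real. t)"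
  unfolding abs_continuous_on_def
proof (intro allI impI)
  fix e :: real assume "e > 0"
  show "\<exists>\<delta>>0. \<forall>D A. D division_of A \<longrightarrow> A \<subseteq> S \<longrightarrow> (\<Sum>K\<in>D. Sup K - Inf K) < \<delta> \<longrightarrow>
        (\<Sum>K\<in>D. norm (Sup K - Inf K)) < e"
  proof (intro exI[of _ e] conjI allI impI, rule \<open>e > 0\<close>)
    fix D A assume D: "D division_of A" and less: "(\<Sum>K\<in>D. Sup K - Inf K) < e"
    have "norm (Sup K - Inf K) = Sup K - Inf K" if "K \<in> D" for K
    proof -
      obtain a b where "a \<le> b" "K = {a..b}"
        using division_of_real_interval[OF D(1) \<open>K \<in> D\<close>] .
      then show ?thesis by auto
    qed
    then show "(\<Sum>K\<in>D. norm (Sup K - Inf K)) < e" using less by simp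
  qed
qed

lemma abs_continuous_on_lipschitz:
  fixes f :: "real \<Rightarrow> 'a::real_normed_vector"
  assumes "\<And>s t. \<lbrakk>s \<in> S; t \<in> S\<rbrakk> \<Longrightarrow> norm (f t - f s) \<le> B * \<bar>t - s\<bar>"
  shows "abs_continuous_on S f"
proof (rule abs_continuous_on_bound[OF abs_continuous_on_ident abs_continuous_on_ident])
  show "\<bar>B\<bar> + 1 > 0" by simp
  fix s t assume "s \<in> S" "t \<in> S"
  then have "norm (f t - f s) \<le> B * \<bar>t - s\<bar>" by (rule assms)
  also have "\<dots> \<le> (\<bar>B\<bar> + 1) * (\<bar>t - s\<bar> + \<bar>t - s\<bar>)" by (intro mult_mono) auto
  finally show "norm (f t - f s) \<le> (\<bar>B\<bar> + 1) * (norm (t - s) + norm (t - s))" by simp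
qed

lemma abs_continuous_on_imp_continuous_on:
  fixes f :: "real \<Rightarrow> 'a::real_normed_vector"
  assumes "abs_continuous_on {a..b} f"
  shows "continuous_on {a..b} f"
  unfolding continuous_on_iff
proof (intro ballI allI impI)
  fix x e :: real assume x: "x \<in> {a..b}" and "e > 0"
  then obtain d where "d > 0" and d: "\<And>D A. \<lbrakk>D division_of A; A \<subseteq> {a..b}; (\<Sum>K\<in>D. Sup K - Inf K) < d\<rbrakk>
      \<Longrightarrow> (\<Sum>K\<in>D. norm (f (Sup K) - f (Inf K))) < e"
    using assms unfolding abs_continuous_on_def by metis
  have *: "norm (f t - f s) < e" if "s \<le> t" "t - s < d" "s \<in> {a..b}" "t \<in> {a..b}" for s t
  proof -
    have "{cbox s t} division_of cbox s t" using that by (intro division_of_self) auto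
    then have "{{s..t}} division_of {s..t}" by simp
    from d[OF this] that show ?thesis by auto
  qed
  show "\<exists>d>0. \<forall>x'\<in>{a..b}. dist x' x < d \<longrightarrow> dist (f x') (f x) < e"
  proof (intro exI[of _ d] conjI ballI impI, fact)
    fix y assume "y \<in> {a..b}" "dist y x < d"
    then show "dist (f y) (f x) < e"
      using *[of x y] *[of y x] x by (cases "x \<le> y") (auto simp: dist_norm norm_minus_commute)
  qed
qed

text \<open>
  Cousin's lemma: the exceptional null set is covered by an open set so small that absolute
  continuity controls the increments over the intervals tagged there.
\<close>
lemma abs_continuous_fundamental_theorem:
  fixes f :: "real \<Rightarrow> 'a::banach"
  assumes ab: "a \<le> b" and ac: "abs_continuous_on {a..b} f" and N: "negligible N"
    and der: "\<And>x. x \<in> {a..b} - N \<Longrightarrow> (f has_vector_derivative f' x) (at x)"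
  shows "(f' has_integral (f b - f a)) {a..b}"
proof -
  \<comment> \<open>Setting the integrand to 0 on \<open>N\<close> leaves only the increments of
    \<open>f\<close> in the terms tagged in \<open>N\<close>; the spike lemma puts \<open>f'\<close>
    back at the end.\<close>
  define g where "g x = (if x \<in> N then 0 else f' x)" for x
  have "(g has_integral (f b - f a)) (cbox a b)"
    unfolding has_integral_factor_content
  proof (intro allI impI)
    fix e0 :: real assume "e0 > 0"
    show "\<exists>d. gauge d \<and> (\<forall>p. p tagged_division_of cbox a b \<and> d fine p \<longrightarrow>
      norm ((\<Sum>(x, k)\<in>p. measure lborel k *\<^sub>R g x) - (f b - f a)) \<le> e0 * measure lborel (cbox a b))"
    proof (cases "a = b")
      case True
      have "gauge (\<lambda>x::real. ball x 1)" by auto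
      moreover have "(\<Sum>(x, k)\<in>p. measure lborel k *\<^sub>R g x) = 0" if "p tagged_division_of cbox a b" for p
        by (rule sum_content_null[OF _ that]) (simp add: True)
      ultimately show ?thesis using True by (intro exI[of _ "\<lambda>x. ball x 1"]) simp
    next
      case False
      \<comment> \<open>One half of \<open>e0\<close> pays for the intervals tagged in
        \<open>N\<close>, the other for the differentiability errors.\<close>
      define e where "e = e0 / 2"
      have "e > 0" using \<open>e0 > 0\<close> by (simp add: e_def)
      have eb: "e * (b - a) > 0" using \<open>e > 0\<close> False ab by simp
      then obtain \<delta> where "\<delta> > 0" and \<delta>: "\<And>D A. \<lbrakk>D division_of A; A \<subseteq> {a..b}; (\<Sum>K\<in>D. Sup K - Inf K) < \<delta>\<rbrakk>
          \<Longrightarrow> (\<Sum>K\<in>D. norm (f (Sup K) - f (Inf K))) < e * (b - a)"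
        using ac unfolding abs_continuous_on_def by metis
      have Nl: "N \<in> sets lebesgue" and N0: "N \<in> null_sets lebesgue"
        using N negligible_iff_null_sets by (auto simp: negligible_imp_sets)
      obtain U where U: "open U" "N \<subseteq> U" "U - N \<in> lmeasurable" "emeasure lebesgue (U - N) < ennreal \<delta>"
        using sets_lebesgue_outer_open[OF Nl \<open>\<delta> > 0\<close>] by auto
      have Um: "U \<in> lmeasurable" "measure lebesgue U < \<delta>"
      proof -
        have Us: "U \<in> sets lebesgue" using U(1) by auto
        have "emeasure lebesgue U = emeasure lebesgue (U - N)"
          using emeasure_Diff_null_set[OF N0 Us] by simp
        then have lt: "emeasure lebesgue U < ennreal \<delta>" using U by simp
        then show um: "U \<in> lmeasurable" using Us by (auto simp: fmeasurable_def less_top[symmetric])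
        show "measure lebesgue U < \<delta>"
          using lt emeasure_eq_measure2[OF um] \<open>\<delta> > 0\<close> by (simp add: ennreal_less_iff)
      qed
      have "\<exists>d>0. (x \<in> N \<longrightarrow> ball x d \<subseteq> U) \<and> (x \<in> {a..b} - N \<longrightarrow>
         (\<forall>y. norm (y-x) < d \<longrightarrow> norm (f y - f x - (y-x) *\<^sub>R f' x) \<le> e * norm (y-x)))" for x
      proof (cases "x \<in> N")
        case True then show ?thesis using U open_contains_ball by (metis Diff_iff subsetD)
      next
        case False
        have "\<exists>d>0. \<forall>y\<in>UNIV. norm (y-x) < d \<longrightarrow> norm (f y - f x - (y-x) *\<^sub>R f' x) \<le> e * norm (y-x)" if "x \<in> {a..b} - N"
          using der[OF that, unfolded has_vector_derivative_def has_derivative_within_alt] \<open>e > 0\<close> by blast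
        then show ?thesis using False by (cases "x \<in> {a..b} - N") (auto intro: exI[of _ 1])
      qed
      then obtain d where d0: "\<And>x. d x > 0" and dU: "\<And>x. x \<in> N \<Longrightarrow> ball x (d x) \<subseteq> U"
        and dd: "\<And>x y. \<lbrakk>x \<in> {a..b} - N; norm (y-x) < d x\<rbrakk> \<Longrightarrow> norm (f y - f x - (y-x) *\<^sub>R f' x) \<le> e * norm (y-x)"
        by metis
      show ?thesis
      proof (rule exI, safe)
        show "gauge (\<lambda>x. ball x (d x))" using d0 gauge_ball_dependent by blast
        fix p assume ptag: "p tagged_division_of cbox a b" and finep: "(\<lambda>x. ball x (d x)) fine p"
        have fin: "finite p" using ptag by auto
        have ba: "b - a = (\<Sum>(x,K)\<in>p. Sup K - Inf K)" "f b - f a = (\<Sum>(x,K)\<in>p. f(Sup K) - f(Inf K))"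
          using additive_tagged_division_1[where f= "\<lambda>x. x"] additive_tagged_division_1[where f= f]
            ab ptag by auto
        define q where "q = {z\<in>p. fst z \<in> N}"
        have qp: "q tagged_partial_division_of cbox a b"
          using ptag tagged_partial_division_subset[of p "cbox a b" q] by (auto simp: q_def tagged_division_of_def)
        have qd: "snd ` q division_of \<Union>(snd ` q)"
          using division_of_tagged_division[OF tagged_partial_division_of_Union_self[OF qp]] .
        have qab: "\<Union>(snd ` q) \<subseteq> {a..b}" using tagged_partial_division_ofD(3)[OF qp] by fastforce
        have "\<Union>(snd ` q) \<subseteq> U"
        proof
          fix z assume "z \<in> \<Union>(snd ` q)"
          then obtain x K where "(x, K) \<in> p" "x \<in> N" "z \<in> K" by (auto simp: q_def)
          then show "z \<in> U" using fineD[OF finep] dU by blast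
        qed
        then have "measure lebesgue (\<Union>(snd ` q)) \<le> measure lebesgue U"
          using measure_division_of(1)[OF qd] Um(1) by (intro measure_mono_fmeasurable) auto
        then have sl: "(\<Sum>K\<in>snd ` q. Sup K - Inf K) < \<delta>" using measure_division_of(2)[OF qd] Um(2) by simp
        have "(\<Sum>(x,K)\<in>q. norm (f (Sup K) - f (Inf K))) = (\<Sum>K\<in>snd ` q. norm (f (Sup K) - f (Inf K)))"
        proof -
          \<comment> \<open>Several tags may share a degenerate cell, so passing from pairs to cells
            needs a summand that vanishes whenever the interior is empty. The empty cell gets 0 by
            hand, since its \<open>Sup\<close> and \<open>Inf\<close> are unspecified.\<close>
          let ?d = "\<lambda>K. if K = {} then 0 else norm (f (Sup K) - f (Inf K))"
          have ne: "K \<noteq> {}" if "(x, K) \<in> q" for x K using tagged_partial_division_ofD(2)[OF qp that] by auto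
          have "(\<Sum>(x,K)\<in>q. ?d K) = (\<Sum>K\<in>snd ` q. ?d K)"
            by (rule sum.over_tagged_division_lemma[OF tagged_partial_division_of_Union_self[OF qp]])
              (auto simp: not_less intro!: arg_cong[where f = f])
          moreover have "(\<Sum>(x,K)\<in>q. ?d K) = (\<Sum>(x,K)\<in>q. norm (f (Sup K) - f (Inf K)))"
            using ne by (intro sum.cong) auto
          moreover have "(\<Sum>K\<in>snd ` q. ?d K) = (\<Sum>K\<in>snd ` q. norm (f (Sup K) - f (Inf K)))"
            using ne by (intro sum.cong) auto
          ultimately show ?thesis by simp
        qed
        then have sq: "(\<Sum>(x,K)\<in>q. norm (f (Sup K) - f (Inf K))) \<le> e * (b - a)"
          using \<delta>[OF qd qab sl] by simp
        have each: "norm (measure lborel K *\<^sub>R g x - (f (Sup K) - f (Inf K)))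
           \<le> e * (Sup K - Inf K) + (if (x,K) \<in> q then norm (f (Sup K) - f (Inf K)) else 0)" if xK: "(x, K) \<in> p" for x K
        proof -
          have "x \<in> K" and kab: "K \<subseteq> cbox a b" using ptag xK by blast+
          then obtain u v where k: "K = cbox u v" using ptag xK by auto
          have "u \<le> v" using \<open>x \<in> K\<close> unfolding k by auto
          have uv: "Sup K = v" "Inf K = u" "measure lborel K = v - u" using \<open>u \<le> v\<close> k by auto
          have ball: "norm (u - x) < d x" "norm (v - x) < d x"
            using finep xK \<open>u \<le> v\<close> k fineD[OF finep xK] by (auto simp: subset_iff dist_real_def)
          show ?thesis
          proof (cases "x \<in> N")
            case True
            then have "(x, K) \<in> q" using xK by (simp add: q_def)
            then show ?thesis using True \<open>e > 0\<close> \<open>u \<le> v\<close> by (simp add: g_def uv norm_minus_commute)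
          next
            case False
            then have xn: "x \<in> {a..b} - N" and "(x, K) \<notin> q" using \<open>x \<in> K\<close> kab by (auto simp: q_def)
            \<comment> \<open>Straddle estimate: the tag lies between \<open>u\<close> and
              \<open>v\<close>, so the errors at both ends add up to at most
              \<open>e * (v - u)\<close>.\<close>
            have "norm ((v - u) *\<^sub>R f' x - (f v - f u)) = norm (f u - f x - (u - x) *\<^sub>R f' x - (f v - f x - (v - x) *\<^sub>R f' x))"
              by (auto simp: algebra_simps)
            also have "\<dots> \<le> norm (f u - f x - (u - x) *\<^sub>R f' x) + norm (f v - f x - (v - x) *\<^sub>R f' x)"
              by (rule norm_triangle_ineq4)
            also have "\<dots> \<le> e * norm (u - x) + e * norm (v - x)"
              by (intro add_mono dd[OF xn] ball)
            also have "\<dots> = e * (v - u)" using \<open>x \<in> K\<close> k by (auto simp: field_simps)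
            finally show ?thesis using False \<open>(x, K) \<notin> q\<close> by (simp add: g_def uv)
          qed
        qed
        have "norm ((\<Sum>(x, k)\<in>p. measure lborel k *\<^sub>R g x) - (f b - f a))
            = norm (\<Sum>(x,K)\<in>p. measure lborel K *\<^sub>R g x - (f (Sup K) - f (Inf K)))"
          unfolding ba(2) by (simp add: split_def sum_subtractf)
        also have "\<dots> \<le> (\<Sum>(x,K)\<in>p. e * (Sup K - Inf K) + (if (x,K) \<in> q then norm (f (Sup K) - f (Inf K)) else 0))"
          by (rule sum_norm_le) (use each in auto)
        also have "\<dots> = e * (b - a) + (\<Sum>(x,K)\<in>q. norm (f (Sup K) - f (Inf K)))"
        proof -
          have "(\<Sum>z\<in>p. if z \<in> q then norm (f (Sup (snd z)) - f (Inf (snd z))) else 0) = (\<Sum>z\<in>q. norm (f (Sup (snd z)) - f (Inf (snd z))))"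
            using fin by (subst sum.inter_restrict[symmetric]) (auto intro!: sum.cong simp: q_def)
          then show ?thesis unfolding ba(1) by (simp add: split_def sum.distrib sum_distrib_left)
        qed
        also have "\<dots> \<le> e * (b - a) + e * (b - a)" using sq by simp
        also have "\<dots> = e0 * measure lborel (cbox a b)" using ab by (simp add: e_def)
        finally show "norm ((\<Sum>(x, k)\<in>p. measure lborel k *\<^sub>R g x) - (f b - f a)) \<le> e0 * measure lborel (cbox a b)" .
      qed
    qed
  qed
  then have "(g has_integral (f b - f a)) {a..b}" by simp
  then show ?thesis by (rule has_integral_spike[OF N, rotated]) (simp add: g_def)
qed

section \<open>Concatenation of trajectories\<close>

lemma AE_lebesgue_on_iff_negligible:
  assumes "S \<in> sets lebesgue"
  shows "(AE t in lebesgue_on S. Q t) \<longleftrightarrow> negligible {t \<in> S. \<not> Q t}"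
  using assms by (simp add: AE_restrict_space_iff completion.AE_iff_null_sets negligible_iff_null_sets)

lemma nonneg_integrable_lebesgue_on:
  fixes f :: "real \<Rightarrow> real"
  assumes "f integrable_on S" "\<And>t. t \<in> S \<Longrightarrow> f t \<ge> 0" "S \<in> sets lebesgue"
  shows "integrable (lebesgue_on S) f"
  using nonnegative_absolutely_integrable_1[OF assms(1,2)] assms(3)
  by (simp add: set_integrable_def integrable_restrict_space)

lemma integrable_on_borel_measurable_lebesgue_on:
  fixes f :: "real \<Rightarrow> real"
  assumes "f integrable_on S" "S \<in> sets lebesgue"
  shows "f \<in> borel_measurable (lebesgue_on S)"
proof -
  obtain y where "(f has_integral y) S" using assms(1) by blast
  from has_integral_implies_lebesgue_measurable[OF this] assms(2) show ?thesis
    by (simp add: borel_measurable_restrict_space_iff mult.commute)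
qed

text \<open>
  Equivalent to \<open>trajectory\<close>, but stated with gauge integrals, which restrict to segments and
  concatenate without measurability side conditions.
\<close>

definition admissible :: "real \<Rightarrow> real \<Rightarrow> (real \<Rightarrow> real) \<Rightarrow> (real \<Rightarrow> state) \<Rightarrow> bool" where
  "admissible p T u X \<longleftrightarrow> T > 0 \<and> u integrable_on {0..T} \<and> (\<lambda>t. \<bar>u t\<bar> powr p) integrable_on {0..T} \<and>
     abs_continuous_on {0..T} X \<and>
     negligible {t \<in> {0..T}. \<not> (X has_vector_derivative dynamics (X t) (u t)) (at t)}"

lemma abs_continuous_on_subset:
  fixes f :: "real \<Rightarrow> 'a::real_normed_vector"
  assumes "abs_continuous_on S f" "S' \<subseteq> S"
  shows "abs_continuous_on S' f"
  using assms unfolding abs_continuous_on_def by (meson subset_trans)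

lemma trajectory_has_integral:
  assumes ac: "abs_continuous_on {0..T} X"
    and neg: "negligible {t \<in> {0..T}. \<not> (X has_vector_derivative dynamics (X t) (u t)) (at t)}"
    and ab: "0 \<le> a" "a \<le> b" "b \<le> T"
  shows "((\<lambda>t. dynamics (X t) (u t)) has_integral X b - X a) {a..b}"
  by (rule abs_continuous_fundamental_theorem[OF ab(2) _ neg])
    (use ab in \<open>auto intro: abs_continuous_on_subset[OF ac]\<close>)

text \<open>Integrability of \<open>u\<close> is read off from \<open>X\<close>: \<open>u\<close> is
  almost everywhere the derivative of the last component, which is absolutely continuous.\<close>

lemma trajectory_imp_admissible:
  assumes "trajectory p T u X"
  shows "admissible p T u X"
proof -
  have T: "T > 0" and ac: "abs_continuous_on {0..T} X"
    and i: "integrable (lebesgue_on {0..T}) (\<lambda>t. \<bar>u t\<bar> powr p)"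
    and neg: "negligible {t \<in> {0..T}. \<not> (X has_vector_derivative dynamics (X t) (u t)) (at t)}"
    using assms by (auto simp: trajectory_def control_def AE_lebesgue_on_iff_negligible)
  have "((\<lambda>t. dynamics (X t) (u t)) has_integral X T - X 0) {0..T}"
    by (rule trajectory_has_integral[OF ac neg]) (use T in auto)
  from has_integral_linear[OF this, of "\<lambda>z. snd (snd (snd z))"]
  have "((\<lambda>t. snd (snd (snd (dynamics (X t) (u t))))) has_integral snd (snd (snd (X T - X 0)))) {0..T}"
    by (simp add: o_def bounded_linear_snd_comp bounded_linear_snd)
  then have "(\<lambda>t. snd (snd (snd (dynamics (X t) (u t))))) integrable_on {0..T}" by blast
  moreover have "(\<lambda>t. snd (snd (snd (dynamics (X t) (u t))))) = u"
    by (auto simp: dynamics_def split: prod.splits)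
  ultimately have "u integrable_on {0..T}" by simp
  moreover have "(\<lambda>t. \<bar>u t\<bar> powr p) integrable_on {0..T}"
    by (rule integrable_on_lebesgue_on[OF i]) auto
  ultimately show ?thesis using T ac neg by (simp add: admissible_def)
qed

text \<open>Competitors are built as admissible curves; this makes them eligible in the definition
  of optimality.\<close>

lemma admissible_imp_trajectory:
  assumes "admissible p T u X"
  shows "trajectory p T u X"
proof -
  have "integrable (lebesgue_on {0..T}) (\<lambda>t. \<bar>u t\<bar> powr p)"
    by (rule nonneg_integrable_lebesgue_on) (use assms in \<open>auto simp: admissible_def\<close>)
  moreover have "u \<in> borel_measurable (lebesgue_on {0..T})"
    by (rule integrable_on_borel_measurable_lebesgue_on) (use assms in \<open>auto simp: admissible_def\<close>)
  ultimately show ?thesis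
    using assms by (auto simp: trajectory_def control_def admissible_def AE_lebesgue_on_iff_negligible)
qed

lemma admissible_segment:
  assumes adm: "admissible p T u X" and ab: "0 \<le> a" "a < b" "b \<le> T"
  shows "admissible p (b - a) (\<lambda>t. u (a + t)) (\<lambda>t. X (a + t))"
proof -
  have "u integrable_on {a..b}" "(\<lambda>t. \<bar>u t\<bar> powr p) integrable_on {a..b}"
    using adm ab by (auto simp: admissible_def intro: integrable_on_subinterval)
  then have "(u \<circ> (+) a) integrable_on {0..b - a}" "((\<lambda>t. \<bar>u t\<bar> powr p) \<circ> (+) a) integrable_on {0..b - a}"
    unfolding integrable_on_shift_Icc_real by simp_all
  moreover have "abs_continuous_on {0..b - a} (\<lambda>t. X (a + t))"
    by (rule abs_continuous_on_compose_mono[where S = "{0..T}"]) (use adm ab in \<open>auto simp: admissible_def\<close>)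
  moreover have "negligible {t \<in> {0..b - a}. \<not> ((\<lambda>t. X (a + t)) has_vector_derivative dynamics (X (a + t)) (u (a + t))) (at t)}"
  proof (rule negligible_subset)
    let ?N = "{t \<in> {0..T}. \<not> (X has_vector_derivative dynamics (X t) (u t)) (at t)}"
    show "negligible ((+) (- a) ` ?N)"
      using adm by (intro negligible_translation) (auto simp: admissible_def)
    show "{t \<in> {0..b - a}. \<not> ((\<lambda>t. X (a + t)) has_vector_derivative dynamics (X (a + t)) (u (a + t))) (at t)} \<subseteq> (+) (- a) ` ?N"
    proof
      fix t assume t: "t \<in> {t \<in> {0..b - a}. \<not> ((\<lambda>t. X (a + t)) has_vector_derivative dynamics (X (a + t)) (u (a + t))) (at t)}"
      have "((X \<circ> (+) a) has_vector_derivative 1 *\<^sub>R dynamics (X (a + t)) (u (a + t))) (at t)"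
        if "(X has_vector_derivative dynamics (X (a + t)) (u (a + t))) (at (a + t))"
        by (rule vector_diff_chain_at) (use that in \<open>auto intro!: derivative_eq_intros\<close>)
      then have "a + t \<in> ?N" using t ab by (auto simp: o_def)
      then show "t \<in> (+) (- a) ` ?N" by force
    qed
  qed
  ultimately show ?thesis using ab by (simp add: admissible_def o_def)
qed

lemma has_integral_combine_shift:
  fixes f :: "real \<Rightarrow> 'a::banach"
  assumes f: "(f has_integral i) {0..a}" and g: "(g has_integral j) {0..b}" and "0 \<le> a" "0 \<le> b"
  shows "((\<lambda>t. if t \<le> a then f t else g (t - a)) has_integral i + j) {0..a + b}"
proof (rule has_integral_combine)
  show "((\<lambda>t. if t \<le> a then f t else g (t - a)) has_integral i) {0..a}"
    using f by (rule has_integral_eq[rotated]) auto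
  have "((\<lambda>t. g (t - a)) \<circ> (+) a has_integral j) {0..b}" using g by (simp add: o_def)
  then have "((\<lambda>t. g (t - a)) has_integral j) {a..a + b}"
    unfolding has_integral_shift_Icc_real by (simp add: add.commute)
  then show "((\<lambda>t. if t \<le> a then f t else g (t - a)) has_integral j) {a..a + b}"
    by (rule has_integral_spike_finite[of "{a}", rotated 2]) auto
qed (use assms in auto)

lemma admissible_concat:
  assumes 1: "admissible p T\<^sub>1 u\<^sub>1 X\<^sub>1" and 2: "admissible p T\<^sub>2 u\<^sub>2 X\<^sub>2" and glue: "X\<^sub>1 T\<^sub>1 = X\<^sub>2 0"
  shows "admissible p (T\<^sub>1 + T\<^sub>2) (\<lambda>t. if t \<le> T\<^sub>1 then u\<^sub>1 t else u\<^sub>2 (t - T\<^sub>1))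
     (\<lambda>t. if t \<le> T\<^sub>1 then X\<^sub>1 t else X\<^sub>2 (t - T\<^sub>1))" (is "admissible p ?T ?u ?X")
proof -
  have T: "T\<^sub>1 > 0" "T\<^sub>2 > 0" using 1 2 by (auto simp: admissible_def)
  have int: "?u integrable_on {0..?T}"
    using 1 2 T has_integral_combine_shift[of u\<^sub>1 _ T\<^sub>1 u\<^sub>2 _ T\<^sub>2] unfolding admissible_def integrable_on_def by fastforce
  have "(\<lambda>t. if t \<le> T\<^sub>1 then \<bar>u\<^sub>1 t\<bar> powr p else \<bar>u\<^sub>2 (t - T\<^sub>1)\<bar> powr p) integrable_on {0..?T}"
    using 1 2 T has_integral_combine_shift[of "\<lambda>t. \<bar>u\<^sub>1 t\<bar> powr p" _ T\<^sub>1 "\<lambda>t. \<bar>u\<^sub>2 t\<bar> powr p" _ T\<^sub>2]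
    unfolding admissible_def integrable_on_def by fastforce
  then have intp: "(\<lambda>t. \<bar>?u t\<bar> powr p) integrable_on {0..?T}"
    by (rule integrable_eq) auto
  have ac1: "abs_continuous_on {0..?T} (\<lambda>t. X\<^sub>1 (min t T\<^sub>1))"
    by (rule abs_continuous_on_compose_mono[where S = "{0..T\<^sub>1}"]) (use 1 T in \<open>auto simp: admissible_def min_def\<close>)
  have ac2: "abs_continuous_on {0..?T} (\<lambda>t. X\<^sub>2 (max (t - T\<^sub>1) 0))"
    by (rule abs_continuous_on_compose_mono[where S = "{0..T\<^sub>2}"]) (use 2 T in \<open>auto simp: admissible_def max_def\<close>)
  \<comment> \<open>As a sum of two clamped curves, the concatenation inherits absolute continuity
    without splitting divisions at \<open>T\<^sub>1\<close>.\<close>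
  have Xe: "?X = (\<lambda>t. X\<^sub>1 (min t T\<^sub>1) + X\<^sub>2 (max (t - T\<^sub>1) 0) - X\<^sub>2 0)"
    using glue by (auto simp: fun_eq_iff min_def max_def)
  have "abs_continuous_on {0..?T} ?X"
    unfolding Xe
  proof (rule abs_continuous_on_bound[OF ac1 ac2, of 1])
    fix s t
    show "norm (X\<^sub>1 (min t T\<^sub>1) + X\<^sub>2 (max (t - T\<^sub>1) 0) - X\<^sub>2 0 - (X\<^sub>1 (min s T\<^sub>1) + X\<^sub>2 (max (s - T\<^sub>1) 0) - X\<^sub>2 0))
      \<le> 1 * (norm (X\<^sub>1 (min t T\<^sub>1) - X\<^sub>1 (min s T\<^sub>1)) + norm (X\<^sub>2 (max (t - T\<^sub>1) 0) - X\<^sub>2 (max (s - T\<^sub>1) 0)))"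
      using norm_triangle_ineq[of "X\<^sub>1 (min t T\<^sub>1) - X\<^sub>1 (min s T\<^sub>1)" "X\<^sub>2 (max (t - T\<^sub>1) 0) - X\<^sub>2 (max (s - T\<^sub>1) 0)"]
      by (simp add: algebra_simps)
  qed simp
  moreover have "negligible {t \<in> {0..?T}. \<not> (?X has_vector_derivative dynamics (?X t) (?u t)) (at t)}"
  proof (rule negligible_subset)
    let ?N1 = "{t \<in> {0..T\<^sub>1}. \<not> (X\<^sub>1 has_vector_derivative dynamics (X\<^sub>1 t) (u\<^sub>1 t)) (at t)}"
    let ?N2 = "{t \<in> {0..T\<^sub>2}. \<not> (X\<^sub>2 has_vector_derivative dynamics (X\<^sub>2 t) (u\<^sub>2 t)) (at t)}"
    \<comment> \<open>At the junction time the two one-sided derivatives need not agree, so it joins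
      the exceptional set.\<close>
    show "negligible (?N1 \<union> (+) T\<^sub>1 ` ?N2 \<union> {T\<^sub>1})"
      using 1 2 by (intro negligible_Un negligible_translation) (auto simp: admissible_def)
    show "{t \<in> {0..?T}. \<not> (?X has_vector_derivative dynamics (?X t) (?u t)) (at t)} \<subseteq> ?N1 \<union> (+) T\<^sub>1 ` ?N2 \<union> {T\<^sub>1}"
    proof
      fix t assume "t \<in> {t \<in> {0..?T}. \<not> (?X has_vector_derivative dynamics (?X t) (?u t)) (at t)}"
      then have t: "0 \<le> t" "t \<le> ?T" and nd: "\<not> (?X has_vector_derivative dynamics (?X t) (?u t)) (at t)" by auto
      consider "t < T\<^sub>1" | "t = T\<^sub>1" | "t > T\<^sub>1" by linarith
      then show "t \<in> ?N1 \<union> (+) T\<^sub>1 ` ?N2 \<union> {T\<^sub>1}"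
      proof cases
        case 1
        have "(?X has_vector_derivative dynamics (X\<^sub>1 t) (u\<^sub>1 t)) (at t)"
          if "(X\<^sub>1 has_vector_derivative dynamics (X\<^sub>1 t) (u\<^sub>1 t)) (at t)"
          by (rule has_vector_derivative_transform_within_open[OF that, of "{..<T\<^sub>1}"]) (use 1 in auto)
        then show ?thesis using 1 t nd by auto
      next
        case 3
        have "(?X has_vector_derivative dynamics (X\<^sub>2 (t - T\<^sub>1)) (u\<^sub>2 (t - T\<^sub>1))) (at t)"
          if d: "(X\<^sub>2 has_vector_derivative dynamics (X\<^sub>2 (t - T\<^sub>1)) (u\<^sub>2 (t - T\<^sub>1))) (at (t - T\<^sub>1))"
        proof -
          have "((X\<^sub>2 \<circ> (\<lambda>s. s - T\<^sub>1)) has_vector_derivative 1 *\<^sub>R dynamics (X\<^sub>2 (t - T\<^sub>1)) (u\<^sub>2 (t - T\<^sub>1))) (at t)"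
            by (rule vector_diff_chain_at) (use d in \<open>auto intro!: derivative_eq_intros\<close>)
          then have d': "((\<lambda>s. X\<^sub>2 (s - T\<^sub>1)) has_vector_derivative dynamics (X\<^sub>2 (t - T\<^sub>1)) (u\<^sub>2 (t - T\<^sub>1))) (at t)"
            by (simp add: o_def)
          show ?thesis
            by (rule has_vector_derivative_transform_within_open[OF d', of "{T\<^sub>1<..}"]) (use 3 in auto)
        qed
        then have "t - T\<^sub>1 \<in> ?N2" using 3 t nd by auto
        then have "t \<in> (+) T\<^sub>1 ` ?N2" by (rule image_eqI[rotated]) simp
        then show ?thesis by blast
      qed simp
    qed
  qed
  ultimately show ?thesis using T int intp by (simp add: admissible_def)
qed

section \<open>Symmetries of the system and reachability at bounded cost\<close>

lemma admissible_translate: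
  assumes adm: "admissible p T u X" and sh: "\<And>z v. dynamics (z + d) v = dynamics z v"
  shows "admissible p T u (\<lambda>t. X t + d)"
proof -
  have "abs_continuous_on {0..T} (\<lambda>t. X t + d)"
    using adm by (simp add: admissible_def abs_continuous_on_def)
  moreover have "((\<lambda>t. X t + d) has_vector_derivative dynamics (X t) (u t)) (at t)"
    if "(X has_vector_derivative dynamics (X t) (u t)) (at t)" for t
    using has_vector_derivative_add[OF that has_vector_derivative_const[of d]] by simp
  then have "negligible {t \<in> {0..T}. \<not> ((\<lambda>t. X t + d) has_vector_derivative dynamics (X t + d) (u t)) (at t)}"
    using adm by (auto simp: admissible_def sh elim!: negligible_subset)
  ultimately show ?thesis using adm by (simp add: admissible_def)
qed

text \<open>Translations of the plane and full turns of the angle are the symmetries used to glue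
  lifts that agree only modulo \<open>2 * pi\<close>.\<close>

lemma dynamics_translate:
  "dynamics (z + (dx, dy, 2 * pi * of_int k, 0)) v = dynamics z v"
proof -
  have "cos (\<theta> + 2 * pi * of_int k) = cos \<theta>" "sin (\<theta> + 2 * pi * of_int k) = sin \<theta>" for \<theta> :: real
    using cos.plus_of_int[of \<theta> k] sin.plus_of_int[of \<theta> k] by (simp_all add: mult_ac)
  then show ?thesis by (auto simp: dynamics_def split: prod.splits)
qed

lemma running_cost_translate:
  "running_cost \<phi> \<psi> (z + (dx, dy, d\<theta>, 0)) v = running_cost \<phi> \<psi> z v"
  by (auto simp: running_cost_def split: prod.splits)

text \<open>Equality of the ends is exact, not modulo full turns, so that pieces can be
  concatenated; \<open>c\<close> is only an upper bound, so that estimates on pieces add up. The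
  cost is a gauge integral and hence finite.\<close>

definition reach :: "(real \<Rightarrow> real) \<Rightarrow> (real \<Rightarrow> real) \<Rightarrow> real \<Rightarrow> state \<Rightarrow> state \<Rightarrow> real \<Rightarrow> bool" where
  "reach \<phi> \<psi> p A B c \<longleftrightarrow> (\<exists>T u X c'. admissible p T u X \<and> X 0 = A \<and> X T = B \<and> c' \<le> c \<and>
     ((\<lambda>t. running_cost \<phi> \<psi> (X t) (u t)) has_integral c') {0..T})"

lemma reachI:
  assumes "admissible p T u X" "X 0 = A" "X T = B"
    "((\<lambda>t. running_cost \<phi> \<psi> (X t) (u t)) has_integral c') {0..T}" "c' \<le> c"
  shows "reach \<phi> \<psi> p A B c"
  using assms unfolding reach_def by blast

lemma reachE:
  assumes "reach \<phi> \<psi> p A B c"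
  obtains T u X c' where "admissible p T u X" "X 0 = A" "X T = B"
    "((\<lambda>t. running_cost \<phi> \<psi> (X t) (u t)) has_integral c') {0..T}" "c' \<le> c"
  using assms unfolding reach_def by blast

lemma reach_mono: "reach \<phi> \<psi> p A B c \<Longrightarrow> c \<le> d \<Longrightarrow> reach \<phi> \<psi> p A B d"
  by (elim reachE) (rule reachI, assumption+, linarith)

lemma reach_trans:
  assumes "reach \<phi> \<psi> p A B c" "reach \<phi> \<psi> p B C d"
  shows "reach \<phi> \<psi> p A C (c + d)"
proof -
  obtain T\<^sub>1 u\<^sub>1 X\<^sub>1 c' where 1: "admissible p T\<^sub>1 u\<^sub>1 X\<^sub>1" "X\<^sub>1 0 = A" "X\<^sub>1 T\<^sub>1 = B"
    "((\<lambda>t. running_cost \<phi> \<psi> (X\<^sub>1 t) (u\<^sub>1 t)) has_integral c') {0..T\<^sub>1}" "c' \<le> c"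
    using assms(1) by (rule reachE)
  obtain T\<^sub>2 u\<^sub>2 X\<^sub>2 d' where 2: "admissible p T\<^sub>2 u\<^sub>2 X\<^sub>2" "X\<^sub>2 0 = B" "X\<^sub>2 T\<^sub>2 = C"
    "((\<lambda>t. running_cost \<phi> \<psi> (X\<^sub>2 t) (u\<^sub>2 t)) has_integral d') {0..T\<^sub>2}" "d' \<le> d"
    using assms(2) by (rule reachE)
  have T: "T\<^sub>1 > 0" "T\<^sub>2 > 0" using 1 2 by (auto simp: admissible_def)
  have adm: "admissible p (T\<^sub>1 + T\<^sub>2) (\<lambda>t. if t \<le> T\<^sub>1 then u\<^sub>1 t else u\<^sub>2 (t - T\<^sub>1))
     (\<lambda>t. if t \<le> T\<^sub>1 then X\<^sub>1 t else X\<^sub>2 (t - T\<^sub>1))"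
    by (rule admissible_concat) (use 1 2 in auto)
  have "((\<lambda>t. if t \<le> T\<^sub>1 then running_cost \<phi> \<psi> (X\<^sub>1 t) (u\<^sub>1 t) else running_cost \<phi> \<psi> (X\<^sub>2 (t - T\<^sub>1)) (u\<^sub>2 (t - T\<^sub>1)))
     has_integral c' + d') {0..T\<^sub>1 + T\<^sub>2}"
    using has_integral_combine_shift[OF 1(4) 2(4)] T by simp
  then have int: "((\<lambda>t. running_cost \<phi> \<psi> (if t \<le> T\<^sub>1 then X\<^sub>1 t else X\<^sub>2 (t - T\<^sub>1)) (if t \<le> T\<^sub>1 then u\<^sub>1 t else u\<^sub>2 (t - T\<^sub>1)))
     has_integral c' + d') {0..T\<^sub>1 + T\<^sub>2}"
    by (rule has_integral_eq[rotated]) simp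
  show ?thesis by (rule reachI[OF adm _ _ int]) (use 1 2 T in auto)
qed

lemma reach_translate:
  assumes "reach \<phi> \<psi> p A B c"
  shows "reach \<phi> \<psi> p (A + (dx, dy, 2 * pi * of_int k, 0)) (B + (dx, dy, 2 * pi * of_int k, 0)) c"
  using assms
proof (rule reachE)
  fix T u X c' assume 1: "admissible p T u X" "X 0 = A" "X T = B" "c' \<le> c"
    "((\<lambda>t. running_cost \<phi> \<psi> (X t) (u t)) has_integral c') {0..T}"
  have "admissible p T u (\<lambda>t. X t + (dx, dy, 2 * pi * of_int k, 0))"
    using 1(1) by (rule admissible_translate) (rule dynamics_translate)
  then show ?thesis by (rule reachI) (use 1 in \<open>auto simp: running_cost_translate\<close>)
qed

lemma reach_segment:
  assumes adm: "admissible p T u X" and ab: "0 \<le> a" "a < b" "b \<le> T"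
    and int: "((\<lambda>t. running_cost \<phi> \<psi> (X t) (u t)) has_integral c) {a..b}"
  shows "reach \<phi> \<psi> p (X a) (X b) c"
proof -
  have int': "((\<lambda>t. running_cost \<phi> \<psi> (X t) (u t)) \<circ> (+) a has_integral c) {0..b - a}"
    using int unfolding has_integral_shift_Icc_real by simp
  show ?thesis
    by (rule reachI[OF admissible_segment[OF adm ab]]) (use int' in \<open>auto simp: o_def\<close>)
qed

section \<open>Explicit competitors\<close>

locale standing_cost =
  fixes \<phi> \<psi> :: "real \<Rightarrow> real" and p :: real
  assumes phi_nonneg: "\<phi> r \<ge> 0" and psi_nonneg: "\<psi> r \<ge> 0"
    and phi_even: "\<phi> (- r) = \<phi> r" and psi_even: "\<psi> (- r) = \<psi> r"
    and phi_C2: "C2 \<phi>" and psi_C2: "C2 \<psi>"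
    and phi_mono: "mono_on {0..} \<phi>" and psi_mono: "mono_on {0..} \<psi>"
    and phi_0: "\<phi> 0 = 0" and psi_0: "\<psi> 0 = 0"
    and psi_convex: "strictly_convex \<psi>"
    and p_gt_1: "p > 1"
    and psi_growth: "\<exists>C>0. \<exists>R>0. \<forall>r. \<bar>r\<bar> \<ge> R \<longrightarrow> \<psi> r \<ge> C * \<bar>r\<bar> powr p"

lemma C2_DERIV:
  assumes "C2 f"
  shows "(f has_real_derivative deriv f x) (at x)" and "continuous_on UNIV f" and "continuous_on UNIV (deriv f)"
proof -
  show "(f has_real_derivative deriv f x) (at x)"
    using assms by (auto simp: C2_def differentiable_on_def DERIV_deriv_iff_real_differentiable)
  show "continuous_on UNIV f" "continuous_on UNIV (deriv f)"
    using assms by (auto simp: C2_def intro: differentiable_imp_continuous_on)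
qed

lemma deriv_even:
  assumes "C2 f" "\<And>r. f (- r) = f r"
  shows "deriv f (- x) = - deriv f (x::real)"
proof -
  have "((\<lambda>r. f (- r)) has_real_derivative deriv f (- x) * (- 1)) (at x)"
    by (rule DERIV_chain2[OF C2_DERIV(1)[OF assms(1)]]) (auto intro!: derivative_eq_intros)
  then have "(f has_real_derivative - deriv f (- x)) (at x)" using assms(2) by simp
  from DERIV_unique[OF this C2_DERIV(1)[OF assms(1)]] show ?thesis by simp
qed

lemma deriv_even_0: "C2 f \<Longrightarrow> (\<And>r. f (- r) = f r) \<Longrightarrow> deriv f (0::real) = 0"
  using deriv_even[of f 0] by simp

context standing_cost
begin

lemma phi_le: "\<bar>r\<bar> \<le> s \<Longrightarrow> \<phi> r \<le> \<phi> s"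
  using mono_onD[OF phi_mono, of "\<bar>r\<bar>" s] phi_even[of r] by (simp add: abs_if split: if_splits)

lemma psi_le: "\<bar>r\<bar> \<le> s \<Longrightarrow> \<psi> r \<le> \<psi> s"
  using mono_onD[OF psi_mono, of "\<bar>r\<bar>" s] psi_even[of r] by (simp add: abs_if split: if_splits)

text \<open>Strict convexity at 0, the midpoint of \<open>r\<close> and \<open>- r\<close>.\<close>

lemma psi_pos: "r \<noteq> 0 \<Longrightarrow> \<psi> r > 0"
  using psi_convex[unfolded strictly_convex_def, rule_format, of r "- r" "1/2"] psi_even[of r] psi_0 by simp

text \<open>By convexity and \<open>\<psi> 0 = 0\<close>, the slope
  \<open>\<psi> v / \<bar>v\<bar>\<close> is at least \<open>\<psi> \<delta> / \<delta>\<close> once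
  \<open>\<bar>v\<bar> \<ge> \<delta>\<close>. It lets a small integral of
  \<open>\<psi> (u t)\<close> bound that of \<open>\<bar>u t\<bar>\<close> although
  \<open>\<psi>\<close> is flat at 0.\<close>

lemma abs_le_psi:
  assumes "\<delta> > 0"
  shows "\<bar>v\<bar> \<le> \<delta> + \<delta> / \<psi> \<delta> * \<psi> v"
proof (cases "\<bar>v\<bar> \<le> \<delta>")
  case True
  then show ?thesis using assms psi_nonneg[of v] psi_nonneg[of \<delta>] by (smt (verit) divide_nonneg_nonneg mult_nonneg_nonneg)
next
  case False
  have "\<psi> ((1 - \<delta> / \<bar>v\<bar>) * 0 + \<delta> / \<bar>v\<bar> * \<bar>v\<bar>) < (1 - \<delta> / \<bar>v\<bar>) * \<psi> 0 + \<delta> / \<bar>v\<bar> * \<psi> \<bar>v\<bar>"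
    by (rule psi_convex[unfolded strictly_convex_def, rule_format]) (use False assms in auto)
  then have "\<psi> \<delta> * \<bar>v\<bar> < \<delta> * \<psi> v"
    using False assms psi_even[of v] by (auto simp: psi_0 field_simps abs_if split: if_splits)
  then have "\<bar>v\<bar> < \<delta> / \<psi> \<delta> * \<psi> v" using psi_pos[of \<delta>] assms by (simp add: field_simps)
  then show ?thesis using assms by linarith
qed

text \<open>Superlinear growth makes \<open>\<psi>'\<close> unbounded, by the mean value theorem.\<close>
lemma surj_deriv_psi: "surj (deriv \<psi>)"
proof -
  have pos: "\<exists>r. deriv \<psi> r = v" if "v > 0" for v
  proof -
    obtain C R where C: "C > 0" "R > 0" and gr: "\<And>r. \<bar>r\<bar> \<ge> R \<Longrightarrow> \<psi> r \<ge> C * \<bar>r\<bar> powr p"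
      using psi_growth by metis
    \<comment> \<open>Chosen so that \<open>C * r powr (p - 1) \<ge> v\<close>, which makes the mean
      slope \<open>\<psi> r / r\<close> at least \<open>v\<close>.\<close>
    define r where "r = max R ((v / C) powr (1 / (p - 1)))"
    have r: "r \<ge> R" "r > 0" using C by (auto simp: r_def)
    have "v / C = ((v / C) powr (1 / (p - 1))) powr (p - 1)" using that C p_gt_1 by (simp add: powr_powr)
    also have "\<dots> \<le> r powr (p - 1)" using p_gt_1 by (intro powr_mono2) (auto simp: r_def)
    finally have vr: "v \<le> C * r powr (p - 1)" using C by (simp add: field_simps)
    have "v * r \<le> C * r powr (p - 1) * r" using vr r by (intro mult_right_mono) auto
    also have "\<dots> = C * r powr p" using r by (simp add: powr_diff)
    also have "\<dots> \<le> \<psi> r" using gr[of r] r by simp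
    finally have vp: "v * r \<le> \<psi> r" .
    obtain z where z: "0 < z" "z < r" "\<psi> r - \<psi> 0 = (r - 0) * deriv \<psi> z"
      using MVT2[of 0 r \<psi> "deriv \<psi>"] r C2_DERIV(1)[OF psi_C2] by auto
    then have "v \<le> deriv \<psi> z" using vp r psi_0 by (simp add: mult.commute)
    then have "\<exists>x. 0 \<le> x \<and> x \<le> z \<and> deriv \<psi> x = v"
      using IVT'[of "deriv \<psi>" 0 v z] z that deriv_even_0[OF psi_C2 psi_even]
        continuous_on_subset[OF C2_DERIV(3)[OF psi_C2]] by auto
    then show ?thesis by blast
  qed
  have "\<exists>r. deriv \<psi> r = v" for v
  proof -
    consider "v > 0" | "v = 0" | "- v > 0" by linarith
    then show ?thesis
    proof cases
      case 3
      then obtain r where "deriv \<psi> r = - v" using pos by blast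
      then show ?thesis using deriv_even[OF psi_C2 psi_even, of r] by (metis minus_minus)
    qed (use pos deriv_even_0[OF psi_C2 psi_even] in auto)
  qed
  then show ?thesis by (metis surjI)
qed

text \<open>Only the angle profile is prescribed; its derivatives are curvature and control, and the
  position is recovered by integration. The profile is differentiable on the whole line, so
  one-sided derivatives occur only for the position, at the two end times.\<close>

lemma reach_smooth:
  assumes \<theta>: "\<And>t. (\<theta> has_real_derivative \<kappa> t) (at t)" and \<kappa>: "\<And>t. (\<kappa> has_real_derivative u t) (at t)"
    and u: "continuous_on UNIV u" and T: "T > 0"
    and K: "\<And>t. t \<in> {0..T} \<Longrightarrow> \<bar>\<kappa> t\<bar> \<le> K" and V: "\<And>t. t \<in> {0..T} \<Longrightarrow> \<bar>u t\<bar> \<le> V"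
  shows "reach \<phi> \<psi> p (x, y, \<theta> 0, \<kappa> 0)
    (x + integral {0..T} (\<lambda>t. cos (\<theta> t)), y + integral {0..T} (\<lambda>t. sin (\<theta> t)), \<theta> T, \<kappa> T) (T * (1 + \<phi> K + \<psi> V))"
proof -
  define X where "X t = (x + integral {0..t} (\<lambda>t. cos (\<theta> t)), y + integral {0..t} (\<lambda>t. sin (\<theta> t)), \<theta> t, \<kappa> t)" for t
  have c\<theta>: "continuous_on S \<theta>" and c\<kappa>: "continuous_on S \<kappa>" and cu: "continuous_on S u" for S
    using \<theta> \<kappa> continuous_on_subset[OF u] by (auto intro!: continuous_at_imp_continuous_on DERIV_isCont)
  have der: "(X has_vector_derivative dynamics (X t) (u t)) (at t within {0..T})" if t: "t \<in> {0..T}" for t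
  proof -
    have 1: "((\<lambda>t. integral {0..t} (\<lambda>t. cos (\<theta> t))) has_vector_derivative cos (\<theta> t)) (at t within {0..T})"
      and 2: "((\<lambda>t. integral {0..t} (\<lambda>t. sin (\<theta> t))) has_vector_derivative sin (\<theta> t)) (at t within {0..T})"
      by (auto intro!: integral_has_vector_derivative continuous_intros c\<theta> t)
    have 3: "(\<theta> has_vector_derivative \<kappa> t) (at t within {0..T})" "(\<kappa> has_vector_derivative u t) (at t within {0..T})"
      using \<theta>[of t] \<kappa>[of t] by (auto simp: has_real_derivative_iff_has_vector_derivative intro: has_vector_derivative_at_within)
    have "(X has_vector_derivative (0 + cos (\<theta> t), 0 + sin (\<theta> t), \<kappa> t, u t)) (at t within {0..T})"
      unfolding X_def
      by (intro has_vector_derivative_Pair has_vector_derivative_add has_vector_derivative_const 1 2 3)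
    then show ?thesis by (simp add: X_def dynamics_def)
  qed
  have cD: "continuous_on {0..T} (\<lambda>t. dynamics (X t) (u t))"
    unfolding X_def dynamics_def by (auto intro!: continuous_intros c\<theta> c\<kappa> cu)
  obtain B where "\<forall>z\<in>(\<lambda>t. dynamics (X t) (u t)) ` {0..T}. norm z \<le> B"
    using compact_imp_bounded[OF compact_continuous_image[OF cD compact_Icc]] unfolding bounded_iff by blast
  then have B: "\<And>t. t \<in> {0..T} \<Longrightarrow> norm (dynamics (X t) (u t)) \<le> B" by blast
  have lip: "norm (X t - X s) \<le> B * \<bar>t - s\<bar>" if "s \<in> {0..T}" "t \<in> {0..T}" "s \<le> t" for s t
  proof -
    have "((\<lambda>t. dynamics (X t) (u t)) has_integral X t - X s) {s..t}"
      using that by (intro fundamental_theorem_of_calculus)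
        (auto intro!: has_vector_derivative_within_subset[OF der])
    moreover have "0 \<le> B" using B[OF that(1)] norm_ge_zero order_trans by blast
    moreover have "norm (dynamics (X r) (u r)) \<le> B" if "r \<in> {s..t} - {}" for r
      using B[of r] that \<open>s \<in> {0..T}\<close> \<open>t \<in> {0..T}\<close> by simp
    ultimately have "norm (X t - X s) \<le> B * measure lborel {s..t}"
      by (intro has_integral_bound_real[of B "{}"]) auto
    then show ?thesis using that(3) by simp
  qed
  have ac: "abs_continuous_on {0..T} X"
  proof (rule abs_continuous_on_lipschitz)
    fix s t assume "s \<in> {0..T}" "t \<in> {0..T}"
    then show "norm (X t - X s) \<le> B * \<bar>t - s\<bar>"
      using lip[of s t] lip[of t s] by (cases "s \<le> t") (auto simp: norm_minus_commute abs_minus_commute)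
  qed
  have neg: "negligible {t \<in> {0..T}. \<not> (X has_vector_derivative dynamics (X t) (u t)) (at t)}"
  proof (rule negligible_subset)
    show "negligible {0, T}" by simp
    show "{t \<in> {0..T}. \<not> (X has_vector_derivative dynamics (X t) (u t)) (at t)} \<subseteq> {0, T}"
    proof
      fix t assume t: "t \<in> {t \<in> {0..T}. \<not> (X has_vector_derivative dynamics (X t) (u t)) (at t)}"
      show "t \<in> {0, T}"
      proof (rule ccontr)
        assume "t \<notin> {0, T}"
        then have "at t within {0..T} = at t" using t by (intro at_within_interior) auto
        then show False using der[of t] t by auto
      qed
    qed
  qed
  have "continuous_on {0..T} (\<lambda>t. \<bar>u t\<bar> powr p)"
    by (rule continuous_on_powr') (use cu p_gt_1 in \<open>auto intro!: continuous_intros\<close>)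
  then have adm: "admissible p T u X"
    unfolding admissible_def using T ac neg by (auto intro!: integrable_continuous_real cu)
  have crc: "(\<lambda>t. running_cost \<phi> \<psi> (X t) (u t)) integrable_on {0..T}"
    unfolding running_cost_def X_def
    by (auto intro!: integrable_continuous_real continuous_intros
        continuous_on_compose2[OF C2_DERIV(2)[OF phi_C2]] continuous_on_compose2[OF C2_DERIV(2)[OF psi_C2]] c\<kappa> cu)
  have "integral {0..T} (\<lambda>t. running_cost \<phi> \<psi> (X t) (u t)) \<le> integral {0..T} (\<lambda>t. 1 + \<phi> K + \<psi> V)"
    by (rule integral_le[OF crc]) (use phi_le K psi_le V in \<open>auto simp: running_cost_def X_def intro!: add_mono\<close>)
  then have le: "integral {0..T} (\<lambda>t. running_cost \<phi> \<psi> (X t) (u t)) \<le> T * (1 + \<phi> K + \<psi> V)" using T by simp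
  show ?thesis
    by (rule reachI[OF adm _ _ integrable_integral[OF crc] le]) (auto simp: X_def)
qed

text \<open>With curvature and control 0 the running cost is 1, so unit speed makes the cost equal
  to the length.\<close>

lemma reach_straight:
  assumes "l > 0"
  shows "reach \<phi> \<psi> p (x, y, \<gamma>, 0) (x + l * cos \<gamma>, y + l * sin \<gamma>, \<gamma>, 0) l"
  using reach_smooth[of "\<lambda>_. \<gamma>" "\<lambda>_. 0" "\<lambda>_. 0" l 0 0 x y] assms by (simp add: phi_0 psi_0)

end

text \<open>Cubic Hermite interpolant on \<open>{0..1}\<close>: values \<open>a\<close>,
  \<open>b\<close> and slopes \<open>k\<close>, \<open>m\<close> at the two ends. As an angle
  profile it matches heading and curvature at both ends, and being linear in the data it has small
  curvature and control when the data are small.\<close>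

definition hermite :: "real \<Rightarrow> real \<Rightarrow> real \<Rightarrow> real \<Rightarrow> real \<Rightarrow> real" where
  "hermite a k b m t = a * ((1 - t)\<^sup>2 * (1 + 2 * t)) + k * (t * (1 - t)\<^sup>2) + b * (t\<^sup>2 * (3 - 2 * t)) + m * (t\<^sup>2 * (t - 1))"

definition hermite' :: "real \<Rightarrow> real \<Rightarrow> real \<Rightarrow> real \<Rightarrow> real \<Rightarrow> real" where
  "hermite' a k b m t = a * (6 * t\<^sup>2 - 6 * t) + k * ((1 - t) * (1 - 3 * t)) + b * (6 * t - 6 * t\<^sup>2) + m * (3 * t\<^sup>2 - 2 * t)"

definition hermite'' :: "real \<Rightarrow> real \<Rightarrow> real \<Rightarrow> real \<Rightarrow> real \<Rightarrow> real" where
  "hermite'' a k b m t = a * (12 * t - 6) + k * (6 * t - 4) + b * (6 - 12 * t) + m * (6 * t - 2)"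

lemma hermite_DERIV:
  "(hermite a k b m has_real_derivative hermite' a k b m t) (at t)"
  "(hermite' a k b m has_real_derivative hermite'' a k b m t) (at t)"
  unfolding hermite_def[abs_def] hermite'_def[abs_def] hermite''_def
  by (auto intro!: derivative_eq_intros simp: algebra_simps power2_eq_square)

lemma hermite_ends:
  "hermite a k b m 0 = a" "hermite' a k b m 0 = k" "hermite a k b m 1 = b" "hermite' a k b m 1 = m"
  by (simp_all add: hermite_def hermite'_def)

lemma abs_lincomb4_le:
  fixes a k b m :: real
  assumes "\<bar>c1\<bar> \<le> B" "\<bar>c2\<bar> \<le> B" "\<bar>c3\<bar> \<le> B" "\<bar>c4\<bar> \<le> B"
  shows "\<bar>a * c1 + k * c2 + b * c3 + m * c4\<bar> \<le> B * (\<bar>a\<bar> + \<bar>k\<bar> + \<bar>b\<bar> + \<bar>m\<bar>)"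
proof -
  have le: "\<bar>x * c\<bar> \<le> B * \<bar>x\<bar>" if "\<bar>c\<bar> \<le> B" for x c
    using mult_right_mono[OF that, of "\<bar>x\<bar>"] by (simp add: abs_mult mult.commute)
  have "\<bar>w + x + y + z\<bar> \<le> \<bar>w\<bar> + \<bar>x\<bar> + \<bar>y\<bar> + \<bar>z\<bar>" for w x y z :: real by simp
  also have "\<bar>a * c1\<bar> + \<bar>k * c2\<bar> + \<bar>b * c3\<bar> + \<bar>m * c4\<bar> \<le> B * \<bar>a\<bar> + B * \<bar>k\<bar> + B * \<bar>b\<bar> + B * \<bar>m\<bar>"
    by (intro add_mono le assms)
  finally show ?thesis unfolding distrib_left .
qed

lemma hermite_bounds:
  assumes t: "t \<in> {0..1}"
  shows "\<bar>hermite a k b m t\<bar> \<le> \<bar>a\<bar> + \<bar>k\<bar> + \<bar>b\<bar> + \<bar>m\<bar>"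
    and "\<bar>hermite' a k b m t\<bar> \<le> 6 * (\<bar>a\<bar> + \<bar>k\<bar> + \<bar>b\<bar> + \<bar>m\<bar>)"
    and "\<bar>hermite'' a k b m t\<bar> \<le> 6 * (\<bar>a\<bar> + \<bar>k\<bar> + \<bar>b\<bar> + \<bar>m\<bar>)"
proof -
  have t01: "0 \<le> t" "t \<le> 1" using t by auto
  have t2: "0 \<le> t\<^sup>2" "t\<^sup>2 \<le> t" "0 \<le> (1 - t)\<^sup>2" "(1 - t)\<^sup>2 \<le> 1 - t"
    using t mult_left_le[of t t] mult_left_le[of "1 - t" "1 - t"] by (auto simp: power2_eq_square)
  \<comment> \<open>The two basis polynomials for the values sum to 1, so nonnegativity bounds
    both.\<close>
  have s: "(1 - t)\<^sup>2 * (1 + 2 * t) = 1 - t\<^sup>2 * (3 - 2 * t)" by (simp add: power2_eq_square algebra_simps)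
  have "0 \<le> (1 - t)\<^sup>2 * (1 + 2 * t)" "0 \<le> t\<^sup>2 * (3 - 2 * t)" using t by auto
  then have 1: "\<bar>(1 - t)\<^sup>2 * (1 + 2 * t)\<bar> \<le> 1" "\<bar>t\<^sup>2 * (3 - 2 * t)\<bar> \<le> 1" using s by auto
  have 2: "\<bar>t * (1 - t)\<^sup>2\<bar> \<le> 1" "\<bar>t\<^sup>2 * (t - 1)\<bar> \<le> 1"
  proof -
    have "\<bar>t\<bar> \<le> 1" "\<bar>(1 - t)\<^sup>2\<bar> \<le> 1" "\<bar>t\<^sup>2\<bar> \<le> 1" "\<bar>t - 1\<bar> \<le> 1" using t01 t2 unfolding abs_le_iff by linarith+
    then show "\<bar>t * (1 - t)\<^sup>2\<bar> \<le> 1" "\<bar>t\<^sup>2 * (t - 1)\<bar> \<le> 1" unfolding abs_mult by (auto intro!: mult_le_one)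
  qed
  show "\<bar>hermite a k b m t\<bar> \<le> \<bar>a\<bar> + \<bar>k\<bar> + \<bar>b\<bar> + \<bar>m\<bar>"
    unfolding hermite_def using abs_lincomb4_le[OF 1(1) 2(1) 1(2) 2(2)] by simp
  have 3: "(1 - t) * (1 - 3 * t) = 1 - 4 * t + 3 * t\<^sup>2" by (simp add: power2_eq_square algebra_simps)
  have "\<bar>6 * t\<^sup>2 - 6 * t\<bar> \<le> 6" "\<bar>(1 - t) * (1 - 3 * t)\<bar> \<le> 6" "\<bar>6 * t - 6 * t\<^sup>2\<bar> \<le> 6" "\<bar>3 * t\<^sup>2 - 2 * t\<bar> \<le> 6"
    unfolding abs_le_iff 3 using t01 t2 by linarith+
  then show "\<bar>hermite' a k b m t\<bar> \<le> 6 * (\<bar>a\<bar> + \<bar>k\<bar> + \<bar>b\<bar> + \<bar>m\<bar>)"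
    unfolding hermite'_def by (rule abs_lincomb4_le)
  show "\<bar>hermite'' a k b m t\<bar> \<le> 6 * (\<bar>a\<bar> + \<bar>k\<bar> + \<bar>b\<bar> + \<bar>m\<bar>)"
    unfolding hermite''_def by (intro abs_lincomb4_le) (use t in \<open>auto simp: abs_le_iff\<close>)
qed

lemma cos_ge_1_minus_abs: "cos x \<ge> 1 - \<bar>x::real\<bar>"
proof -
  have "\<bar>cos x - cos 0\<bar> \<le> \<bar>x - 0\<bar>"
    using field_differentiable_bound[of UNIV cos "\<lambda>x. - sin x" 1 x 0] by (auto intro!: derivative_eq_intros)
  then show ?thesis by simp
qed

context standing_cost
begin

lemma reach_hermite:
  assumes "6 * (\<bar>a\<bar> + \<bar>k\<bar> + \<bar>b\<bar> + \<bar>m\<bar>) \<le> h"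
  shows "reach \<phi> \<psi> p (x, y, \<gamma> + a, k)
    (x + integral {0..1} (\<lambda>t. cos (\<gamma> + hermite a k b m t)), y + integral {0..1} (\<lambda>t. sin (\<gamma> + hermite a k b m t)), \<gamma> + b, m)
    (1 + \<phi> h + \<psi> h)"
proof -
  have "reach \<phi> \<psi> p (x, y, \<gamma> + hermite a k b m 0, hermite' a k b m 0)
    (x + integral {0..1} (\<lambda>t. cos (\<gamma> + hermite a k b m t)), y + integral {0..1} (\<lambda>t. sin (\<gamma> + hermite a k b m t)),
     \<gamma> + hermite a k b m 1, hermite' a k b m 1) (1 * (1 + \<phi> h + \<psi> h))"
  proof (rule reach_smooth)
    show "((\<lambda>t. \<gamma> + hermite a k b m t) has_real_derivative hermite' a k b m t) (at t)"
      and "(hermite' a k b m has_real_derivative hermite'' a k b m t) (at t)" for t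
      using DERIV_add[OF DERIV_const hermite_DERIV(1)[of a k b m t]] hermite_DERIV(2) by auto
    show "continuous_on UNIV (hermite'' a k b m)"
      unfolding hermite''_def[abs_def] by (intro continuous_intros)
    show "\<bar>hermite' a k b m t\<bar> \<le> h" "\<bar>hermite'' a k b m t\<bar> \<le> h" if "t \<in> {0..1}" for t
      using hermite_bounds[OF that, of a k b m] assms by linarith+
  qed simp
  then show ?thesis by (simp add: hermite_ends)
qed

text \<open>
  A cubic turn to a heading \<open>\<gamma>\<close> near \<open>\<alpha>\<close>, a straight line and a cubic turn; \<open>\<gamma>\<close> comes from
  the intermediate value theorem, applied to the component across \<open>\<gamma>\<close> of the displacement
  left for the straight line.
\<close>
lemma reach_connect:
  assumes \<theta>: "\<bar>\<theta>a - \<alpha>\<bar> \<le> \<delta>" "\<bar>\<theta>b - \<alpha>\<bar> \<le> \<delta>" and \<kappa>: "\<bar>\<kappa>a\<bar> \<le> \<delta>" "\<bar>\<kappa>b\<bar> \<le> \<delta>"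
    and g: "0 < g" "g \<le> pi / 4"
    and D: "D = (xb - xa) * cos \<alpha> + (yb - ya) * sin \<alpha>" and E: "E = (yb - ya) * cos \<alpha> - (xb - xa) * sin \<alpha>"
    and large: "D * sin g > \<bar>E\<bar> + 2" and h: "h = 6 * (2 * \<delta> + g)"
  shows "reach \<phi> \<psi> p (xa, ya, \<theta>a, \<kappa>a) (xb, yb, \<theta>b, \<kappa>b) (D + \<bar>E\<bar> * g + 2 * h + 2 * \<phi> h + 2 * \<psi> h)"
proof -
  \<comment> \<open>\<open>A \<gamma>\<close> and \<open>B \<gamma>\<close> are the angle profiles
    of the first and the last turn, and \<open>(P \<gamma>, Q \<gamma>)\<close> is the displacement
    of both together.\<close>
  define A where "A \<gamma> t = \<gamma> + hermite (\<theta>a - \<gamma>) \<kappa>a 0 0 t" for \<gamma> t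
  define B where "B \<gamma> t = \<gamma> + hermite 0 0 (\<theta>b - \<gamma>) \<kappa>b t" for \<gamma> t
  define P where "P \<gamma> = integral {0..1} (\<lambda>t. cos (A \<gamma> t)) + integral {0..1} (\<lambda>t. cos (B \<gamma> t))" for \<gamma>
  define Q where "Q \<gamma> = integral {0..1} (\<lambda>t. sin (A \<gamma> t)) + integral {0..1} (\<lambda>t. sin (B \<gamma> t))" for \<gamma>
  have contA: "continuous_on S (\<lambda>z. A (fst z) (snd z))" and contB: "continuous_on S (\<lambda>z. B (fst z) (snd z))" for S
    unfolding A_def B_def hermite_def by (auto intro!: continuous_intros)
  have cA: "continuous_on S (A \<gamma>)" and cB: "continuous_on S (B \<gamma>)" for S \<gamma>
    unfolding A_def B_def hermite_def by (auto intro!: continuous_intros)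
  note ints = integrable_continuous_real[OF continuous_on_cos[OF cA]] integrable_continuous_real[OF continuous_on_cos[OF cB]]
    integrable_continuous_real[OF continuous_on_sin[OF cA]] integrable_continuous_real[OF continuous_on_sin[OF cB]]
  have cont_param: "continuous_on UNIV (\<lambda>\<gamma>. integral {0..1} (\<lambda>t. f \<gamma> t))"
    if "continuous_on (UNIV \<times> cbox 0 1) (\<lambda>z. f (fst z) (snd z))" for f :: "real \<Rightarrow> real \<Rightarrow> real"
    using integral_continuous_on_param[of UNIV 0 1 f] that by (simp add: case_prod_beta')
  have contP: "continuous_on UNIV P" and contQ: "continuous_on UNIV Q"
    unfolding P_def[abs_def] Q_def[abs_def]
    by (intro continuous_on_add cont_param continuous_on_cos continuous_on_sin contA contB)+
  \<comment> \<open>Zero exactly when the displacement left after the turns is parallel to the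
    heading \<open>\<gamma>\<close>.\<close>
  define G where "G \<gamma> = (xb - xa - P \<gamma>) * sin \<gamma> - (yb - ya - Q \<gamma>) * cos \<gamma>" for \<gamma>
  have contG: "continuous_on UNIV G" unfolding G_def[abs_def] by (intro continuous_intros contP contQ)
  have sc: "cos z * cos z + sin z * sin z = 1" for z :: real by simp
  have xE: "xb - xa = D * cos \<alpha> - E * sin \<alpha>" and yE: "yb - ya = D * sin \<alpha> + E * cos \<alpha>"
    using D E sc[of \<alpha>] by algebra+
  have across: "P \<gamma> * sin \<gamma> - Q \<gamma> * cos \<gamma> = integral {0..1} (\<lambda>t. sin (\<gamma> - A \<gamma> t)) + integral {0..1} (\<lambda>t. sin (\<gamma> - B \<gamma> t))" for \<gamma>
  proof -
    have "((\<lambda>t. sin \<gamma> * cos (A \<gamma> t) - cos \<gamma> * sin (A \<gamma> t)) has_integral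
        sin \<gamma> * integral {0..1} (\<lambda>t. cos (A \<gamma> t)) - cos \<gamma> * integral {0..1} (\<lambda>t. sin (A \<gamma> t))) {0..1}"
      by (intro has_integral_diff has_integral_mult_right integrable_integral ints)
    moreover have "((\<lambda>t. sin \<gamma> * cos (B \<gamma> t) - cos \<gamma> * sin (B \<gamma> t)) has_integral
        sin \<gamma> * integral {0..1} (\<lambda>t. cos (B \<gamma> t)) - cos \<gamma> * integral {0..1} (\<lambda>t. sin (B \<gamma> t))) {0..1}"
      by (intro has_integral_diff has_integral_mult_right integrable_integral ints)
    ultimately show ?thesis
      by (simp add: sin_diff integral_unique P_def Q_def algebra_simps)
  qed
  have along: "P \<gamma> * cos \<gamma> + Q \<gamma> * sin \<gamma> = integral {0..1} (\<lambda>t. cos (\<gamma> - A \<gamma> t)) + integral {0..1} (\<lambda>t. cos (\<gamma> - B \<gamma> t))" for \<gamma>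
  proof -
    have "((\<lambda>t. cos \<gamma> * cos (A \<gamma> t) + sin \<gamma> * sin (A \<gamma> t)) has_integral
        cos \<gamma> * integral {0..1} (\<lambda>t. cos (A \<gamma> t)) + sin \<gamma> * integral {0..1} (\<lambda>t. sin (A \<gamma> t))) {0..1}"
      by (intro has_integral_add has_integral_mult_right integrable_integral ints)
    moreover have "((\<lambda>t. cos \<gamma> * cos (B \<gamma> t) + sin \<gamma> * sin (B \<gamma> t)) has_integral
        cos \<gamma> * integral {0..1} (\<lambda>t. cos (B \<gamma> t)) + sin \<gamma> * integral {0..1} (\<lambda>t. sin (B \<gamma> t))) {0..1}"
      by (intro has_integral_add has_integral_mult_right integrable_integral ints)
    ultimately show ?thesis
      by (simp add: cos_diff integral_unique P_def Q_def algebra_simps)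
  qed
  have unit: "\<bar>integral {0..1} f\<bar> \<le> 1" if "continuous_on {0..1} f" "\<And>t. \<bar>f t\<bar> \<le> 1" for f :: "real \<Rightarrow> real"
    using integral_bound[of 0 1 f 1] that by simp
  have cd: "continuous_on S (\<lambda>t. \<gamma> - A \<gamma> t)" "continuous_on S (\<lambda>t. \<gamma> - B \<gamma> t)" for S \<gamma>
    by (intro continuous_intros cA cB)+
  have un: "\<bar>integral {0..1} (\<lambda>t. sin (\<gamma> - A \<gamma> t))\<bar> \<le> 1" "\<bar>integral {0..1} (\<lambda>t. sin (\<gamma> - B \<gamma> t))\<bar> \<le> 1"
     "\<bar>integral {0..1} (\<lambda>t. cos (\<gamma> - A \<gamma> t))\<bar> \<le> 1" "\<bar>integral {0..1} (\<lambda>t. cos (\<gamma> - B \<gamma> t))\<bar> \<le> 1" for \<gamma>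
    by (intro unit continuous_on_sin continuous_on_cos cd abs_sin_le_one abs_cos_le_one)+
  \<comment> \<open>Each turn takes unit time at unit speed, so both together move at most 2 in any
    direction: the origin of the 2 in \<open>large\<close>.\<close>
  have ac2: "\<bar>P \<gamma> * sin \<gamma> - Q \<gamma> * cos \<gamma>\<bar> \<le> 2" for \<gamma> unfolding across using un(1,2)[of \<gamma>] by linarith
  have al2: "P \<gamma> * cos \<gamma> + Q \<gamma> * sin \<gamma> \<le> 2" for \<gamma> unfolding along using un(3,4)[of \<gamma>] by linarith
  have Gs: "G (\<alpha> + s) = D * sin s - E * cos s - (P (\<alpha> + s) * sin (\<alpha> + s) - Q (\<alpha> + s) * cos (\<alpha> + s))" for s
  proof -
    have "(xb - xa) * sin (\<alpha> + s) - (yb - ya) * cos (\<alpha> + s) = D * sin s - E * cos s"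
      unfolding sin_add cos_add using xE yE sc[of \<alpha>] by algebra
    then show ?thesis by (simp add: G_def algebra_simps)
  qed
  have Ec: "\<bar>E * cos s\<bar> \<le> \<bar>E\<bar>" for s using abs_cos_le_one[of s] by (simp add: abs_mult mult_left_le)
  have Es: "\<bar>E * sin s\<bar> \<le> \<bar>E\<bar>" for s using abs_sin_le_one[of s] by (simp add: abs_mult mult_left_le)
  \<comment> \<open>At \<open>\<alpha> + g\<close> and \<open>\<alpha> - g\<close> the term
    \<open>D * sin s\<close> of \<open>Gs\<close> outweighs all others, with opposite signs.\<close>
  have "G (\<alpha> + g) \<ge> 0" using Gs[of g] large Ec[of g] ac2[of "\<alpha> + g"] by linarith
  moreover have "G (\<alpha> - g) \<le> 0" using Gs[of "- g"] large Ec[of g] ac2[of "\<alpha> + - g"] by simp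
  ultimately obtain \<gamma> where \<gamma>: "\<alpha> - g \<le> \<gamma>" "\<gamma> \<le> \<alpha> + g" "G \<gamma> = 0"
    using IVT'[of G "\<alpha> - g" 0 "\<alpha> + g"] g continuous_on_subset[OF contG] by auto
  define s where "s = \<gamma> - \<alpha>"
  have s: "\<bar>s\<bar> \<le> g" "\<gamma> = \<alpha> + s" using \<gamma> by (auto simp: s_def)
  define l where "l = (xb - xa - P \<gamma>) * cos \<gamma> + (yb - ya - Q \<gamma>) * sin \<gamma>"
  have lx: "l * cos \<gamma> = xb - xa - P \<gamma>" and ly: "l * sin \<gamma> = yb - ya - Q \<gamma>"
    using \<gamma>(3) sc[of \<gamma>] unfolding l_def G_def by algebra+
  have ls: "l = D * cos s + E * sin s - (P \<gamma> * cos \<gamma> + Q \<gamma> * sin \<gamma>)"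
  proof -
    have "(xb - xa) * cos (\<alpha> + s) + (yb - ya) * sin (\<alpha> + s) = D * cos s + E * sin s"
      unfolding sin_add cos_add using xE yE sc[of \<alpha>] by algebra
    then show ?thesis unfolding l_def s(2) by (simp add: algebra_simps)
  qed
  have sg: "0 < sin g" using g pi_gt_zero by (intro sin_gt_zero) linarith+
  have Dpos: "D > 0"
    using large sg by (smt (verit) mult_nonneg_nonneg mult_nonpos_nonneg)
  \<comment> \<open>Here \<open>g \<le> pi / 4\<close> enters, through
    \<open>\<bar>s\<bar> \<le> g \<le> pi / 2 - g\<close>. With it \<open>large\<close> also gives a
    positive length \<open>l\<close>.\<close>
  have cs: "sin g \<le> cos s"
  proof -
    have "sin g = cos (pi / 2 - g)" by (simp add: cos_diff)
    also have "\<dots> \<le> cos \<bar>s\<bar>" using s g by (intro cos_monotone_0_pi_le) auto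
    finally show ?thesis by simp
  qed
  have lpos: "l > 0"
    using ls mult_left_mono[OF cs, of D] Dpos large Es[of s] al2[of \<gamma>] by linarith
  \<comment> \<open>Each turn changes the angle by at most \<open>\<delta> + g\<close> and has end
    curvature at most \<open>\<delta>\<close>; the factor 6 is that of
    \<open>hermite_bounds\<close>.\<close>
  have M: "6 * (\<bar>\<theta>a - \<gamma>\<bar> + \<bar>\<kappa>a\<bar>) \<le> h" "6 * (\<bar>\<theta>b - \<gamma>\<bar> + \<bar>\<kappa>b\<bar>) \<le> h"
  proof -
    have "\<bar>\<theta>a - \<gamma>\<bar> \<le> \<bar>\<theta>a - \<alpha>\<bar> + \<bar>s\<bar>" "\<bar>\<theta>b - \<gamma>\<bar> \<le> \<bar>\<theta>b - \<alpha>\<bar> + \<bar>s\<bar>" using s(2) by linarith+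
    then have "\<bar>\<theta>a - \<gamma>\<bar> + \<bar>\<kappa>a\<bar> \<le> 2 * \<delta> + g" "\<bar>\<theta>b - \<gamma>\<bar> + \<bar>\<kappa>b\<bar> \<le> 2 * \<delta> + g" using \<theta> \<kappa> s(1) by simp_all
    then show "6 * (\<bar>\<theta>a - \<gamma>\<bar> + \<bar>\<kappa>a\<bar>) \<le> h" "6 * (\<bar>\<theta>b - \<gamma>\<bar> + \<bar>\<kappa>b\<bar>) \<le> h" unfolding h by simp_all
  qed
  have M': "\<bar>\<theta>a - \<gamma>\<bar> + \<bar>\<kappa>a\<bar> \<le> h" "\<bar>\<theta>b - \<gamma>\<bar> + \<bar>\<kappa>b\<bar> \<le> h"
  proof -
    have le: "v + w \<le> h" if "6 * (v + w) \<le> h" "0 \<le> v" "0 \<le> w" for v w :: real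
    proof -
      have "v + w \<le> 6 * (v + w)" using that(2,3) by simp
      then show ?thesis using that(1) by (rule order_trans)
    qed
    show "\<bar>\<theta>a - \<gamma>\<bar> + \<bar>\<kappa>a\<bar> \<le> h" by (rule le[OF M(1)]) auto
    show "\<bar>\<theta>b - \<gamma>\<bar> + \<bar>\<kappa>b\<bar> \<le> h" by (rule le[OF M(2)]) auto
  qed
  have hA: "\<bar>\<gamma> - A \<gamma> t\<bar> \<le> h" "\<bar>\<gamma> - B \<gamma> t\<bar> \<le> h" if "t \<in> {0..1}" for t
    using hermite_bounds(1)[OF that, of "\<theta>a - \<gamma>" \<kappa>a 0 0] hermite_bounds(1)[OF that, of 0 0 "\<theta>b - \<gamma>" \<kappa>b] M'
    unfolding A_def B_def by simp_all
  have ge: "1 - h \<le> integral {0..1} (\<lambda>t. cos (f t))"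
    if "continuous_on {0..1} f" and f: "\<And>t. t \<in> {0..1} \<Longrightarrow> \<bar>f t\<bar> \<le> h" for f :: "real \<Rightarrow> real"
  proof -
    have "integral {0..1::real} (\<lambda>t. 1 - h) \<le> integral {0..1} (\<lambda>t. cos (f t))"
    proof (rule integral_le)
      show "1 - h \<le> cos (f t)" if "t \<in> {0..1}" for t using f[OF that] cos_ge_1_minus_abs[of "f t"] by linarith
    qed (use that in \<open>auto intro!: integrable_continuous_real continuous_on_cos\<close>)
    then show ?thesis by simp
  qed
  have "1 - h \<le> integral {0..1} (\<lambda>t. cos (\<gamma> - A \<gamma> t))" "1 - h \<le> integral {0..1} (\<lambda>t. cos (\<gamma> - B \<gamma> t))"
    by (rule ge; use cd hA in blast)+
  \<comment> \<open>The turns advance by nearly 2 along \<open>\<gamma>\<close>, which offsets the 2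
    units of time they take, so what they add to the bound vanishes with \<open>h\<close>.\<close>
  then have PQ: "P \<gamma> * cos \<gamma> + Q \<gamma> * sin \<gamma> \<ge> 2 - 2 * h" unfolding along by simp
  have "E * sin s \<le> \<bar>E\<bar> * g"
  proof -
    have "E * sin s \<le> \<bar>E\<bar> * \<bar>sin s\<bar>" by (simp add: abs_mult[symmetric])
    also have "\<dots> \<le> \<bar>E\<bar> * g" using abs_sin_x_le_abs_x[of s] s by (intro mult_left_mono) auto
    finally show ?thesis .
  qed
  moreover have "D * cos s \<le> D" using Dpos by (simp add: mult_left_le)
  ultimately have lle: "l \<le> D + \<bar>E\<bar> * g - 2 + 2 * h" using ls PQ by linarith
  have r1: "reach \<phi> \<psi> p (xa, ya, \<theta>a, \<kappa>a) (xa + integral {0..1} (\<lambda>t. cos (A \<gamma> t)), ya + integral {0..1} (\<lambda>t. sin (A \<gamma> t)), \<gamma>, 0)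
     (1 + \<phi> h + \<psi> h)"
    using reach_hermite[of "\<theta>a - \<gamma>" \<kappa>a 0 0 h xa ya \<gamma>] M unfolding A_def by simp
  define xc where "xc = xa + integral {0..1} (\<lambda>t. cos (A \<gamma> t)) + l * cos \<gamma>"
  define yc where "yc = ya + integral {0..1} (\<lambda>t. sin (A \<gamma> t)) + l * sin \<gamma>"
  have r2: "reach \<phi> \<psi> p (xc, yc, \<gamma>, 0)
     (xc + integral {0..1} (\<lambda>t. cos (B \<gamma> t)), yc + integral {0..1} (\<lambda>t. sin (B \<gamma> t)), \<theta>b, \<kappa>b) (1 + \<phi> h + \<psi> h)"
    using reach_hermite[of 0 0 "\<theta>b - \<gamma>" \<kappa>b h xc yc \<gamma>] M unfolding B_def by simp
  have ends: "xc + integral {0..1} (\<lambda>t. cos (B \<gamma> t)) = xb" "yc + integral {0..1} (\<lambda>t. sin (B \<gamma> t)) = yb"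
    using lx ly by (auto simp: xc_def yc_def P_def Q_def)
  have "reach \<phi> \<psi> p (xa, ya, \<theta>a, \<kappa>a) (xb, yb, \<theta>b, \<kappa>b) (1 + \<phi> h + \<psi> h + (l + (1 + \<phi> h + \<psi> h)))"
    using reach_trans[OF r1 reach_trans[OF reach_straight[OF lpos] r2[unfolded xc_def yc_def]]] ends
    unfolding xc_def yc_def by simp
  then show ?thesis by (rule reach_mono) (use lle in simp)
qed

end

section \<open>Windows of small excess\<close>

text \<open>Averaging: otherwise \<open>f \<ge> c\<close> almost everywhere on the interval.
  Avoiding \<open>N\<close> matters for relations known only almost everywhere.\<close>

lemma exists_point_below:
  fixes f :: "real \<Rightarrow> real"
  assumes int: "(f has_integral I) {a..b}" and "a \<le> b" and I: "I < c * (b - a)" and N: "negligible N"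
  obtains t where "t \<in> {a..b}" "t \<notin> N" "f t < c"
proof -
  have "\<exists>t. t \<in> {a..b} \<and> t \<notin> N \<and> f t < c"
  proof (rule ccontr)
    assume neg: "\<not> ?thesis"
    have f': "((\<lambda>t. if t \<in> N then c else f t) has_integral I) {a..b}"
      by (rule has_integral_spike[OF N _ int]) auto
    have c: "((\<lambda>t. c) has_integral c * (b - a)) {a..b}"
      using has_integral_const_real[of c a b] \<open>a \<le> b\<close> by (simp add: mult.commute)
    have "c * (b - a) \<le> I" by (rule has_integral_le[OF c f']) (use neg in force)
    then show False using I by simp
  qed
  then show thesis using that by blast
qed

text \<open>Pigeonhole over \<open>n\<close> consecutive unit windows.\<close>

lemma exists_unit_interval_below:
  fixes f :: "real \<Rightarrow> real"
  assumes "f integrable_on {c..c + real n}" "integral {c..c + real n} f < real n * \<epsilon>"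
  obtains j where "j < n" "integral {c + real j..c + real j + 1} f < \<epsilon>"
proof -
  have "\<exists>j<n. integral {c + real j..c + real j + 1} f < \<epsilon>"
    using assms
  proof (induction n)
    case (Suc n)
    have sub: "f integrable_on {c..c + real n}" by (rule integrable_on_subinterval[OF Suc.prems(1)]) auto
    have "integral {c..c + real n} f + integral {c + real n..c + real n + 1} f = integral {c..c + real (Suc n)} f"
      using Henstock_Kurzweil_Integration.integral_combine[OF _ _ Suc.prems(1), of "c + real n"] by (simp add: algebra_simps)
    then have "integral {c..c + real n} f < real n * \<epsilon> \<or> integral {c + real n..c + real n + 1} f < \<epsilon>"
      using Suc.prems(2) by (auto simp: algebra_simps)
    then show ?case using Suc.IH[OF sub] less_Suc_eq by blast
  qed simp
  then show thesis using that by blast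
qed

text \<open>Cosine is strictly decreasing on \<open>{0..pi}\<close>, so smallness of an angle modulo
  full turns can be read from its cosine, which is what the excess controls.\<close>

lemma abs_angle_diff_le:
  assumes "0 \<le> \<eta>" "\<eta> \<le> pi" "cos \<eta> \<le> cos (a - b)"
  shows "\<bar>angle_diff a b\<bar> \<le> \<eta>"
proof (rule ccontr)
  assume "\<not> ?thesis"
  moreover have bd: "- pi < angle_diff a b" "angle_diff a b \<le> pi"
    using Arg_bounded[of "cis (a - b)"] by (auto simp: angle_diff_def)
  moreover have "cos (angle_diff a b) = cos (a - b)"
    using cis_Arg[of "cis (a - b)"] by (metis angle_diff_def cis.simps(1) cis_neq_zero sgn_cis)
  ultimately have "cos \<bar>angle_diff a b\<bar> < cos \<eta>" using assms by (intro cos_monotone_0_pi) auto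
  then show False using \<open>cos (angle_diff a b) = cos (a - b)\<close> assms by simp
qed

lemma angle_diff_shift: "\<exists>k. a - b = angle_diff a b + 2 * pi * of_int k"
proof -
  have c: "cis (angle_diff a b) = cis (a - b)"
    using cis_Arg[of "cis (a - b)"] by (simp add: angle_diff_def sgn_cis)
  then have "cos (angle_diff a b) = cos (a - b)" "sin (angle_diff a b) = sin (a - b)"
    by (metis cis.simps(1), metis cis.simps(2))
  then have "sin (angle_diff a b) = sin (a - b) \<and> cos (angle_diff a b) = cos (a - b)" by simp
  then obtain n where "a - b = angle_diff a b + 2 * of_int n * pi"
    using sin_cos_eq_iff[of "a - b" "angle_diff a b"] by auto
  then show ?thesis by (intro exI[of _ n]) (simp add: mult_ac)
qed

lemma sin_squared_le: "(sin x)\<^sup>2 \<le> 2 - 2 * cos (x::real)"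
proof -
  have "(sin x)\<^sup>2 = (1 - cos x) * (1 + cos x)" by (simp add: sin_squared_eq power2_eq_square algebra_simps)
  also have "\<dots> \<le> (1 - cos x) * 2" by (intro mult_left_mono) auto
  finally show ?thesis by simp
qed

context standing_cost
begin

text \<open>
  Over a window of length one, a small excess makes the curvature nearly constant, because
  \<open>\<psi>\<close> controls \<open>\<bar>u\<bar>\<close>, and the constant is small because \<open>\<integral> \<kappa> cos (\<theta> - \<alpha>)\<close> is an
  increment of \<open>sin (\<theta> - \<alpha>)\<close>.
\<close>
lemma window_bounds:
  fixes \<theta> \<kappa> u :: "real \<Rightarrow> real"
  assumes c\<kappa>: "continuous_on {s..s + 1} \<kappa>"
    and i\<theta>: "\<And>a b. \<lbrakk>s \<le> a; a \<le> b; b \<le> s + 1\<rbrakk> \<Longrightarrow> (\<kappa> has_integral \<theta> b - \<theta> a) {a..b}"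
    and i\<kappa>: "\<And>a b. \<lbrakk>s \<le> a; a \<le> b; b \<le> s + 1\<rbrakk> \<Longrightarrow> (u has_integral \<kappa> b - \<kappa> a) {a..b}"
    and i\<psi>: "(\<lambda>t. \<psi> (u t)) integrable_on {s..s + 1}"
    and small: "integral {s..s + 1} (\<lambda>t. 1 - cos (\<theta> t - \<alpha>)) + integral {s..s + 1} (\<lambda>t. \<psi> (u t)) < \<epsilon>"
    and \<delta>: "0 < \<delta>" "\<delta> \<le> 1" and \<epsilon>: "\<epsilon> \<le> \<psi> \<delta>" "8 * \<epsilon> \<le> \<delta>\<^sup>2" "\<epsilon> \<le> 1 / 4"
    and t: "t \<in> {s..s + 1}"
  shows "\<bar>\<kappa> t\<bar> \<le> 18 * \<delta>" and "1 - 19 * \<delta> \<le> cos (\<theta> t - \<alpha>)"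
proof -
  have d\<theta>: "(\<theta> has_vector_derivative \<kappa> t) (at t within {s..s + 1})" if "t \<in> {s..s + 1}" for t
  proof -
    have "((\<lambda>t. \<theta> s + integral {s..t} \<kappa>) has_vector_derivative 0 + \<kappa> t) (at t within {s..s + 1})"
      by (intro has_vector_derivative_add has_vector_derivative_const integral_has_vector_derivative c\<kappa> that)
    moreover have "\<theta> s + integral {s..t} \<kappa> = \<theta> t" if "t \<in> {s..s + 1}" for t
      using integral_unique[OF i\<theta>[of s t]] that by simp
    ultimately show ?thesis using that by (auto intro: has_vector_derivative_transform[rotated -1])
  qed
  have c\<theta>: "continuous_on {s..s + 1} \<theta>"
    unfolding continuous_on_eq_continuous_within by (intro ballI has_vector_derivative_continuous[OF d\<theta>])
  have "continuous_on {s..s + 1} (\<lambda>t. cos (\<theta> t - \<alpha>))" by (intro continuous_intros c\<theta>)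
  then have sub: "continuous_on {a..b} (\<lambda>t. cos (\<theta> t - \<alpha>))" if "s \<le> a" "b \<le> s + 1" for a b
    by (rule continuous_on_subset) (use that in auto)
  let ?c = "\<lambda>t. 1 - cos (\<theta> t - \<alpha>)"
  have ci: "?c integrable_on {a..b}" if "s \<le> a" "b \<le> s + 1" for a b
    by (intro integrable_continuous_real continuous_on_diff continuous_on_const sub that)
  have I1: "integral {a..b} ?c \<le> integral {s..s + 1} ?c" if "s \<le> a" "b \<le> s + 1" for a b
    by (rule integral_subset_le) (use that ci in auto)
  have \<psi>i: "(\<lambda>t. \<psi> (u t)) integrable_on {a..b}" if "s \<le> a" "b \<le> s + 1" for a b
    by (rule integrable_on_subinterval[OF i\<psi>]) (use that in auto)
  have I2: "integral {a..b} (\<lambda>t. \<psi> (u t)) \<le> integral {s..s + 1} (\<lambda>t. \<psi> (u t))" if "s \<le> a" "b \<le> s + 1" for a b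
    by (rule integral_subset_le) (use that \<psi>i psi_nonneg in auto)
  have nn: "0 \<le> integral {s..s + 1} ?c" "0 \<le> integral {s..s + 1} (\<lambda>t. \<psi> (u t))"
    by (intro integral_nonneg ci i\<psi>; simp add: psi_nonneg)+
  have osc: "\<bar>\<kappa> b - \<kappa> a\<bar> \<le> 2 * \<delta>" if "s \<le> a" "a \<le> b" "b \<le> s + 1" for a b
  proof -
    \<comment> \<open>The slope from \<open>abs_le_psi\<close>;
      \<open>\<epsilon> \<le> \<psi> \<delta>\<close> makes
      \<open>c * \<epsilon> \<le> \<delta>\<close>, and the two terms together give
      \<open>2 * \<delta>\<close>.\<close>
    define c where "c = \<delta> / \<psi> \<delta>"
    have c: "0 \<le> c" "c * \<epsilon> \<le> \<delta>" using \<delta> \<epsilon>(1) psi_pos[of \<delta>] by (auto simp: c_def field_simps)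
    have m: "((\<lambda>t. \<delta> + c * \<psi> (u t)) has_integral (b - a) * \<delta> + c * integral {a..b} (\<lambda>t. \<psi> (u t))) {a..b}"
      using has_integral_const_real[of \<delta> a b] that \<psi>i[of a b]
      by (intro has_integral_add has_integral_mult_right integrable_integral) auto
    have pw: "u t \<le> \<delta> + c * \<psi> (u t)" "- u t \<le> \<delta> + c * \<psi> (u t)" for t
      using abs_le_psi[OF \<delta>(1), of "u t"] by (auto simp: c_def)
    have "\<kappa> b - \<kappa> a \<le> (b - a) * \<delta> + c * integral {a..b} (\<lambda>t. \<psi> (u t))"
      by (rule has_integral_le[OF i\<kappa>[OF that] m]) (rule pw)
    moreover have "- (\<kappa> b - \<kappa> a) \<le> (b - a) * \<delta> + c * integral {a..b} (\<lambda>t. \<psi> (u t))"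
      by (rule has_integral_le[OF has_integral_neg[OF i\<kappa>[OF that]] m]) (rule pw)
    moreover have "(b - a) * \<delta> \<le> \<delta>" using that \<delta> by (simp add: mult_left_le_one_le)
    moreover have "c * integral {a..b} (\<lambda>t. \<psi> (u t)) \<le> c * \<epsilon>"
      using I2[of a b] that small nn c by (intro mult_left_mono) auto
    ultimately show ?thesis using c by linarith
  qed
  have pt: "\<exists>r\<in>{a..b}. 1 - cos (\<theta> r - \<alpha>) < 4 * \<epsilon>" if "s \<le> a" "b \<le> s + 1" "b - a = 1 / 4" for a b
  proof -
    have "4 * \<epsilon> * (b - a) = \<epsilon>" unfolding that(3) by simp
    then have "integral {a..b} ?c < 4 * \<epsilon> * (b - a)" using I1[OF that(1,2)] small nn by linarith
    moreover have "a \<le> b" using that(3) by simp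
    moreover note cab = ci[OF that(1,2)]
    ultimately obtain r where "r \<in> {a..b}" "1 - cos (\<theta> r - \<alpha>) < 4 * \<epsilon>"
      using exists_point_below[OF integrable_integral[OF cab] _ _ negligible_empty] by metis
    then show ?thesis by blast
  qed
  \<comment> \<open>One time in the first quarter and one in the last: averaging over a quarter
    costs a factor 4, and \<open>b - a \<ge> 1 / 2\<close> keeps the integral of the cosine above
    \<open>1 / 2 - \<epsilon> \<ge> 1 / 4\<close>.\<close>
  obtain a where a: "a \<in> {s..s + 1 / 4}" "1 - cos (\<theta> a - \<alpha>) < 4 * \<epsilon>" using pt[of s "s + 1 / 4"] by auto
  obtain b where b: "b \<in> {s + 3 / 4..s + 1}" "1 - cos (\<theta> b - \<alpha>) < 4 * \<epsilon>" using pt[of "s + 3 / 4" "s + 1"] by auto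
  have ab: "s \<le> a" "a \<le> b" "b \<le> s + 1" "1 / 2 \<le> b - a" "b - a \<le> 1" using a b by auto
  have sn: "\<bar>sin (\<theta> r - \<alpha>)\<bar> \<le> \<delta>" if "1 - cos (\<theta> r - \<alpha>) < 4 * \<epsilon>" for r
  proof -
    \<comment> \<open>The condition \<open>8 * \<epsilon> \<le> \<delta>\<^sup>2\<close> is made for
      this: the square is at most \<open>2 * (4 * \<epsilon>)\<close>.\<close>
    have "(sin (\<theta> r - \<alpha>))\<^sup>2 \<le> \<delta>\<^sup>2" using sin_squared_le[of "\<theta> r - \<alpha>"] that \<epsilon> by linarith
    then show ?thesis using \<delta> abs_le_square_iff[of "sin (\<theta> r - \<alpha>)" \<delta>] by simp
  qed
  have "((\<lambda>t. \<kappa> t * cos (\<theta> t - \<alpha>)) has_integral sin (\<theta> b - \<alpha>) - sin (\<theta> a - \<alpha>)) {a..b}"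
  proof (rule fundamental_theorem_of_calculus)
    fix r assume r: "r \<in> {a..b}"
    have "(\<theta> has_real_derivative \<kappa> r) (at r within {a..b})"
      unfolding has_real_derivative_iff_has_vector_derivative
      by (rule has_vector_derivative_within_subset[OF d\<theta>]) (use r ab in auto)
    then have "((\<lambda>t. sin (\<theta> t - \<alpha>)) has_real_derivative \<kappa> r * cos (\<theta> r - \<alpha>)) (at r within {a..b})"
      by (auto intro!: derivative_eq_intros)
    then show "((\<lambda>t. sin (\<theta> t - \<alpha>)) has_vector_derivative \<kappa> r * cos (\<theta> r - \<alpha>)) (at r within {a..b})"
      by (simp add: has_real_derivative_iff_has_vector_derivative)
  qed (use ab in auto)
  moreover have cosi: "((\<lambda>t. \<kappa> s * cos (\<theta> t - \<alpha>)) has_integral \<kappa> s * integral {a..b} (\<lambda>t. cos (\<theta> t - \<alpha>))) {a..b}"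
    by (intro has_integral_mult_right integrable_integral integrable_continuous_real sub) (use ab in auto)
  ultimately have df: "((\<lambda>t. \<kappa> t * cos (\<theta> t - \<alpha>) - \<kappa> s * cos (\<theta> t - \<alpha>)) has_integral
     sin (\<theta> b - \<alpha>) - sin (\<theta> a - \<alpha>) - \<kappa> s * integral {a..b} (\<lambda>t. cos (\<theta> t - \<alpha>))) {a..b}"
    by (rule has_integral_diff)
  have "norm (sin (\<theta> b - \<alpha>) - sin (\<theta> a - \<alpha>) - \<kappa> s * integral {a..b} (\<lambda>t. cos (\<theta> t - \<alpha>))) \<le> 2 * \<delta> * measure lborel {a..b}"
  proof (rule has_integral_bound_real[OF _ finite.emptyI df])
    fix r assume r: "r \<in> {a..b} - {}"
    have "\<bar>\<kappa> r - \<kappa> s\<bar> * \<bar>cos (\<theta> r - \<alpha>)\<bar> \<le> 2 * \<delta> * 1"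
      using osc[of s r] r ab by (intro mult_mono) auto
    then show "norm (\<kappa> r * cos (\<theta> r - \<alpha>) - \<kappa> s * cos (\<theta> r - \<alpha>)) \<le> 2 * \<delta>"
      by (simp add: abs_mult[symmetric] left_diff_distrib)
  qed (use \<delta> in simp)
  also have "\<dots> \<le> 2 * \<delta>" using ab \<delta> by (simp add: mult_left_le)
  finally have "\<bar>sin (\<theta> b - \<alpha>) - sin (\<theta> a - \<alpha>) - \<kappa> s * integral {a..b} (\<lambda>t. cos (\<theta> t - \<alpha>))\<bar> \<le> 2 * \<delta>" by simp
  \<comment> \<open>Replacing \<open>\<kappa>\<close> by \<open>\<kappa> s\<close> costs
    \<open>2 * \<delta>\<close>, and the two sines cost \<open>\<delta>\<close> each; dividing by
    \<open>1 / 4\<close> gives 16, and one more oscillation of \<open>\<kappa>\<close> gives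
    18.\<close>
  then have prod: "\<bar>\<kappa> s * integral {a..b} (\<lambda>t. cos (\<theta> t - \<alpha>))\<bar> \<le> 4 * \<delta>"
    using sn[OF a(2)] sn[OF b(2)] by linarith
  have one: "(\<lambda>t. 1::real) integrable_on {a..b}" by (intro integrable_continuous_real continuous_on_const)
  have "integral {a..b} (\<lambda>t. cos (\<theta> t - \<alpha>)) = (b - a) - integral {a..b} ?c"
    using integral_diff[OF one integrable_continuous_real[OF sub[of a b]]] ab by simp
  then have "1 / 4 \<le> integral {a..b} (\<lambda>t. cos (\<theta> t - \<alpha>))"
    using I1[of a b] small nn \<epsilon> ab by linarith
  then have "\<bar>\<kappa> s\<bar> * (1 / 4) \<le> \<bar>\<kappa> s * integral {a..b} (\<lambda>t. cos (\<theta> t - \<alpha>))\<bar>"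
    unfolding abs_mult by (intro mult_left_mono) auto
  then have ks: "\<bar>\<kappa> s\<bar> \<le> 16 * \<delta>" using prod by linarith
  have kb: "\<bar>\<kappa> t\<bar> \<le> 18 * \<delta>" if "t \<in> {s..s + 1}" for t using osc[of s t] ks that by simp
  then show "\<bar>\<kappa> t\<bar> \<le> 18 * \<delta>" using t by blast
  have var: "\<bar>\<theta> r - \<theta> q\<bar> \<le> 18 * \<delta>" if "s \<le> q" "q \<le> r" "r \<le> s + 1" for q r
  proof -
    have "norm (\<theta> r - \<theta> q) \<le> 18 * \<delta> * measure lborel {q..r}"
      by (rule has_integral_bound_real[OF _ finite.emptyI i\<theta>[OF that]]) (use \<delta> kb that in auto)
    also have "\<dots> \<le> 18 * \<delta>" using that \<delta> by (simp add: mult_left_le)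
    finally show ?thesis by simp
  qed
  \<comment> \<open>At \<open>a\<close> the cosine is within
    \<open>4 * \<epsilon> \<le> \<delta>\<close> of 1; a drift of \<open>18 * \<delta>\<close> from
    there makes 19.\<close>
  have "\<bar>\<theta> t - \<theta> a\<bar> \<le> 18 * \<delta>" using var[of t a] var[of a t] t ab by (cases "t \<le> a") auto
  moreover have "\<bar>cos (\<theta> t - \<alpha>) - cos (\<theta> a - \<alpha>)\<bar> \<le> \<bar>\<theta> t - \<theta> a\<bar>"
    using field_differentiable_bound[of UNIV cos "\<lambda>x. - sin x" 1 "\<theta> t - \<alpha>" "\<theta> a - \<alpha>"]
    by (auto intro!: derivative_eq_intros)
  moreover have "4 * \<epsilon> \<le> \<delta>"
  proof -
    have "\<delta>\<^sup>2 \<le> \<delta>" using \<delta> by (simp add: power2_eq_square mult_left_le)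
    then show ?thesis using \<epsilon>(2) \<delta> by linarith
  qed
  ultimately show "1 - 19 * \<delta> \<le> cos (\<theta> t - \<alpha>)" using a(2) by linarith
qed

end

text \<open>
  Up to errors of order \<open>\<eta>\<close>, \<open>p\<^sub>3\<close> is affine with slope \<open>A\<close> and \<open>p\<^sub>4\<close> is quadratic over the
  window, so three times at which \<open>p\<^sub>4\<close> is small bound \<open>A\<close> and \<open>p\<^sub>3\<close>. The error terms also
  involve \<open>A\<close> and \<open>B\<close>, and the vanishing Hamiltonian at \<open>r\<close> bounds \<open>B\<close>.
\<close>
lemma adjoint_window:
  fixes \<beta> f q3 q4 :: "real \<Rightarrow> real"
  assumes i3: "\<And>a b. \<lbrakk>s \<le> a; a \<le> b; b \<le> s + 1\<rbrakk> \<Longrightarrow>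
        ((\<lambda>t. A * cos (\<beta> t) + B * sin (\<beta> t)) has_integral q3 b - q3 a) {a..b}"
    and i4: "\<And>a b. \<lbrakk>s \<le> a; a \<le> b; b \<le> s + 1\<rbrakk> \<Longrightarrow> ((\<lambda>t. - q3 t + f t) has_integral q4 b - q4 a) {a..b}"
    and cs: "\<And>t. t \<in> {s..s + 1} \<Longrightarrow> \<bar>1 - cos (\<beta> t)\<bar> \<le> \<eta> \<and> \<bar>sin (\<beta> t)\<bar> \<le> \<eta> \<and> \<bar>f t\<bar> \<le> \<eta>"
    and r: "r \<in> {s..s + 1 / 8}" "r1 \<in> {s + 3 / 8..s + 5 / 8}" "r2 \<in> {s + 7 / 8..s + 1}"
    and q4: "\<bar>q4 r\<bar> \<le> \<eta>" "\<bar>q4 r1\<bar> \<le> \<eta>" "\<bar>q4 r2\<bar> \<le> \<eta>"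
    and H: "\<bar>B * cos (\<beta> r) - A * sin (\<beta> r) + q3 r * k - 1\<bar> \<le> 3 * \<eta>" and k: "\<bar>k\<bar> \<le> \<eta>"
    and \<eta>: "0 < \<eta>" "\<eta> \<le> 1 / 2000"
    and t: "t \<in> {s..s + 1}"
  shows "\<bar>q3 t\<bar> \<le> 1600 * \<eta>" and "\<bar>q4 t\<bar> \<le> 1600 * \<eta>"
proof -
  \<comment> \<open>Common scale for all errors. The summand 1 lets errors of order
    \<open>\<eta>\<close> alone be absorbed into \<open>\<eta> * N\<close>.\<close>
  define N where "N = \<bar>A\<bar> + \<bar>B\<bar> + 1"
  have N1: "1 \<le> N" and ABN: "\<bar>A\<bar> + \<bar>B\<bar> \<le> N" by (auto simp: N_def)
  have \<eta>N: "\<eta> \<le> \<eta> * N" using N1 \<eta> by simp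
  have e3: "\<bar>q3 b - q3 a - A * (b - a)\<bar> \<le> \<eta> * N" if "s \<le> a" "a \<le> b" "b \<le> s + 1" for a b
  proof -
    have i: "((\<lambda>t. A * cos (\<beta> t) + B * sin (\<beta> t) - A) has_integral q3 b - q3 a - A * (b - a)) {a..b}"
      using has_integral_diff[OF i3[OF that] has_integral_const_real[of A a b]] that by (simp add: mult.commute)
    have "norm (q3 b - q3 a - A * (b - a)) \<le> \<eta> * N * measure lborel {a..b}"
    proof (rule has_integral_bound_real[OF _ finite.emptyI i])
      fix x assume "x \<in> {a..b} - {}"
      then have x: "\<bar>1 - cos (\<beta> x)\<bar> \<le> \<eta>" "\<bar>sin (\<beta> x)\<bar> \<le> \<eta>" using cs[of x] that by auto
      have "\<bar>A * cos (\<beta> x) + B * sin (\<beta> x) - A\<bar> = \<bar>B * sin (\<beta> x) - A * (1 - cos (\<beta> x))\<bar>" by (simp add: algebra_simps)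
      also have "\<dots> \<le> \<bar>B\<bar> * \<bar>sin (\<beta> x)\<bar> + \<bar>A\<bar> * \<bar>1 - cos (\<beta> x)\<bar>" unfolding abs_mult[symmetric] by (rule abs_triangle_ineq4)
      also have "\<dots> \<le> \<bar>B\<bar> * \<eta> + \<bar>A\<bar> * \<eta>" using x by (intro add_mono mult_left_mono) auto
      also have "\<dots> = \<eta> * (\<bar>A\<bar> + \<bar>B\<bar>)" by (simp add: algebra_simps)
      also have "\<dots> \<le> \<eta> * N" using ABN \<eta> by (intro mult_left_mono) auto
      finally show "norm (A * cos (\<beta> x) + B * sin (\<beta> x) - A) \<le> \<eta> * N" by simp
    qed (use N1 \<eta> in simp)
    also have "\<dots> \<le> \<eta> * N" using that N1 \<eta> by (simp add: mult_left_le)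
    finally show ?thesis by simp
  qed
  have e3': "\<bar>q3 b - q3 a - A * (b - a)\<bar> \<le> \<eta> * N" if "a \<in> {s..s + 1}" "b \<in> {s..s + 1}" for a b
  proof (cases "a \<le> b")
    case False
    have "\<bar>q3 b - q3 a - A * (b - a)\<bar> = \<bar>q3 a - q3 b - A * (a - b)\<bar>" by (simp add: algebra_simps abs_minus_commute)
    then show ?thesis using e3[of b a] that False by simp
  qed (use e3[of a b] that in auto)
  have rs: "r \<in> {s..s + 1}" "r1 \<in> {s..s + 1}" "r2 \<in> {s..s + 1}" using r by auto
  have e4: "\<bar>q4 b - q4 a + q3 r * (b - a) + A * ((b - r)\<^sup>2 - (a - r)\<^sup>2) / 2\<bar> \<le> 2 * (\<eta> * N)"
    if "s \<le> a" "a \<le> b" "b \<le> s + 1" for a b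
  proof -
    \<comment> \<open>Adding the affine approximation of \<open>q3\<close> to \<open>i4\<close>
      leaves an error of at most \<open>\<eta> * N\<close> from \<open>q3\<close> and
      \<open>\<eta>\<close> from \<open>f\<close>.\<close>
    have "((\<lambda>t. q3 r + A * (t - r)) has_integral (q3 r * b + A * (b - r)\<^sup>2 / 2) - (q3 r * a + A * (a - r)\<^sup>2 / 2)) {a..b}"
      by (rule fundamental_theorem_of_calculus)
        (use that in \<open>auto simp flip: has_real_derivative_iff_has_vector_derivative intro!: derivative_eq_intros\<close>)
    from has_integral_add[OF i4[OF that] this]
    have i: "((\<lambda>t. - q3 t + f t + (q3 r + A * (t - r))) has_integral
       q4 b - q4 a + q3 r * (b - a) + A * ((b - r)\<^sup>2 - (a - r)\<^sup>2) / 2) {a..b}"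
      by (simp add: algebra_simps diff_divide_distrib)
    have "norm (q4 b - q4 a + q3 r * (b - a) + A * ((b - r)\<^sup>2 - (a - r)\<^sup>2) / 2) \<le> 2 * (\<eta> * N) * measure lborel {a..b}"
    proof (rule has_integral_bound_real[OF _ finite.emptyI i])
      fix x assume "x \<in> {a..b} - {}"
      then have x: "x \<in> {s..s + 1}" using that by auto
      show "norm (- q3 x + f x + (q3 r + A * (x - r))) \<le> 2 * (\<eta> * N)"
        using e3'[OF rs(1) x] cs[OF x] \<eta>N unfolding real_norm_def by linarith
    qed (use N1 \<eta> in simp)
    also have "\<dots> \<le> 2 * (\<eta> * N)" using that N1 \<eta> by (simp add: mult_left_le)
    finally show ?thesis by simp
  qed
  have x1: "\<bar>q3 r * (r1 - r) + A / 2 * (r1 - r)\<^sup>2\<bar> \<le> 4 * (\<eta> * N)"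
    using e4[of r r1] q4 \<eta>N r by simp
  have x2: "\<bar>q3 r * (r2 - r) + A / 2 * (r2 - r)\<^sup>2\<bar> \<le> 4 * (\<eta> * N)"
    using e4[of r r2] q4 \<eta>N r by simp
  define x y where "x = r1 - r" and "y = r2 - r"
  have xy: "1 / 4 \<le> x" "x \<le> 5 / 8" "3 / 4 \<le> y" "y \<le> 1" "1 / 4 \<le> y - x" using r by (auto simp: x_def y_def)
  \<comment> \<open>Eliminating \<open>q3 r\<close> from the quadratics at \<open>x\<close> and
    \<open>y\<close> leaves \<open>A / 2 * (x * y * (y - x))\<close>, and the gaps between the three
    times give \<open>x * y * (y - x) \<ge> 3 / 64\<close>. The constant is
    \<open>8 * 2 * 64 / 3\<close> rounded up.\<close>
  have A1: "\<bar>A\<bar> \<le> 342 * (\<eta> * N)"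
  proof -
    have "\<bar>A\<bar> / 2 * (x * y * (y - x)) = \<bar>(q3 r * y + A / 2 * y\<^sup>2) * x - (q3 r * x + A / 2 * x\<^sup>2) * y\<bar>"
    proof -
      have eq: "(q3 r * y + A / 2 * y\<^sup>2) * x - (q3 r * x + A / 2 * x\<^sup>2) * y = A / 2 * (x * y * (y - x))"
        by (simp add: power2_eq_square algebra_simps)
      have "\<bar>x * y * (y - x)\<bar> = x * y * (y - x)" using xy by (intro abs_of_nonneg mult_nonneg_nonneg) auto
      then have "\<bar>A / 2 * (x * y * (y - x))\<bar> = \<bar>A\<bar> / 2 * (x * y * (y - x))" by (metis abs_mult abs_divide abs_numeral)
      then show ?thesis unfolding eq by (rule sym)
    qed
    also have "\<dots> \<le> \<bar>q3 r * y + A / 2 * y\<^sup>2\<bar> * x + \<bar>q3 r * x + A / 2 * x\<^sup>2\<bar> * y"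
      using abs_triangle_ineq4[of "(q3 r * y + A / 2 * y\<^sup>2) * x" "(q3 r * x + A / 2 * x\<^sup>2) * y"] xy by (simp add: abs_mult)
    also have "\<dots> \<le> 4 * (\<eta> * N) * 1 + 4 * (\<eta> * N) * 1"
      using x1 x2 xy unfolding x_def[symmetric] y_def[symmetric] by (intro add_mono mult_mono) auto
    also have "\<dots> = 8 * (\<eta> * N)" by simp
    finally have 1: "\<bar>A\<bar> / 2 * (x * y * (y - x)) \<le> 8 * (\<eta> * N)" .
    have "1 / 4 * (3 / 4) * (1 / 4) \<le> x * y * (y - x)" using xy by (intro mult_mono) auto
    then have "\<bar>A\<bar> / 2 * (3 / 64) \<le> \<bar>A\<bar> / 2 * (x * y * (y - x))" by (intro mult_left_mono) auto
    then show ?thesis using 1 N1 \<eta> by simp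
  qed
  \<comment> \<open>Dividing the quadratic at \<open>x\<close> by \<open>x \<ge> 1 / 4\<close> gives
    16, and removing \<open>A / 2 * x\<close> adds \<open>342 / 2 = 171\<close>.\<close>
  have Q1: "\<bar>q3 r\<bar> \<le> 187 * (\<eta> * N)"
  proof -
    have "\<bar>q3 r + A / 2 * x\<bar> * x = \<bar>q3 r * x + A / 2 * x\<^sup>2\<bar>"
    proof -
      have eq: "q3 r * x + A / 2 * x\<^sup>2 = (q3 r + A / 2 * x) * x" by (simp add: power2_eq_square algebra_simps)
      show ?thesis unfolding eq abs_mult using xy by simp
    qed
    then have "\<bar>q3 r + A / 2 * x\<bar> * (1 / 4) \<le> 4 * (\<eta> * N)"
      using x1 xy mult_left_mono[of "1 / 4" x "\<bar>q3 r + A / 2 * x\<bar>"] unfolding x_def[symmetric] by linarith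
    moreover have "\<bar>A / 2 * x\<bar> \<le> \<bar>A\<bar> / 2"
      using xy mult_left_le[of x "\<bar>A\<bar> / 2"] by (simp add: abs_mult)
    moreover have "\<bar>q3 r\<bar> \<le> \<bar>q3 r + A / 2 * x\<bar> + \<bar>A / 2 * x\<bar>"
      using abs_triangle_ineq4[of "q3 r + A / 2 * x" "A / 2 * x"] by simp
    ultimately show ?thesis using A1 by argo
  qed
  \<comment> \<open>The Hamiltonian bounds \<open>B\<close> by about 1 up to errors proportional to
    \<open>N\<close>. As \<open>\<eta> \<le> 1 / 2000\<close>, these and
    \<open>\<bar>A\<bar> \<le> 342 * (\<eta> * N)\<close> are a small fraction of \<open>N\<close>
    and can be absorbed.\<close>
  have N3: "N \<le> 3"
  proof -
    have \<eta>N': "\<eta> * N \<le> N / 2000" using \<eta> N1 by (simp add: field_simps)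
    have "\<bar>A * sin (\<beta> r)\<bar> \<le> \<bar>A\<bar> * (1 / 2000)" "\<bar>q3 r * k\<bar> \<le> \<bar>q3 r\<bar> * (1 / 2000)"
      unfolding abs_mult using cs[OF rs(1)] k \<eta> by (intro mult_left_mono; simp)+
    moreover have "\<bar>B\<bar> * (1 - 1 / 2000) \<le> \<bar>B * cos (\<beta> r)\<bar>"
      unfolding abs_mult using cs[OF rs(1)] \<eta> by (intro mult_left_mono) auto
    ultimately show ?thesis
      using H A1 Q1 \<eta>N' \<eta> unfolding N_def by (simp add: field_simps) linarith
  qed
  have \<eta>3: "\<eta> * N \<le> 3 * \<eta>" using N3 \<eta> by simp
  have tr: "\<bar>t - r\<bar> \<le> 1" using t rs by auto
  have "\<bar>A * (t - r)\<bar> \<le> \<bar>A\<bar>" using tr by (simp add: abs_mult mult_left_le)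
  \<comment> \<open>With \<open>N \<le> 3\<close> the sum of the three bounds is
    \<open>(187 + 342 + 1) * 3 = 1590\<close> times \<open>\<eta>\<close>.\<close>
  then show q3t: "\<bar>q3 t\<bar> \<le> 1600 * \<eta>"
    using e3'[OF rs(1) t] A1 Q1 \<eta>3 \<eta> by linarith
  have "\<bar>q3 r * (t - r)\<bar> \<le> \<bar>q3 r\<bar>" "\<bar>A * (t - r)\<^sup>2\<bar> \<le> \<bar>A\<bar>"
    using tr by (simp_all add: abs_mult mult_left_le power2_le_iff_abs_le abs_square_le_1)
  moreover have "\<bar>q4 t - q4 r + q3 r * (t - r) + A * (t - r)\<^sup>2 / 2\<bar> \<le> 2 * (\<eta> * N)"
  proof (cases "r \<le> t")
    case True
    then show ?thesis using e4[of r t] t r by simp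
  next
    case False
    have "q4 t - q4 r + q3 r * (t - r) + A * (t - r)\<^sup>2 / 2 = - (q4 r - q4 t + q3 r * (r - t) + A * ((r - r)\<^sup>2 - (t - r)\<^sup>2) / 2)"
      by (simp add: algebra_simps)
    then show ?thesis using e4[of t r] t r False by simp
  qed
  ultimately show "\<bar>q4 t\<bar> \<le> 1600 * \<eta>"
    using A1 Q1 \<eta>3 \<eta> q4(1) by linarith
qed

section \<open>Excess of optimal trajectories\<close>

context standing_cost
begin

lemma cost_eq_integral:
  assumes "((\<lambda>t. running_cost \<phi> \<psi> (X t) (u t)) has_integral c) {0..T}"
  shows "cost \<phi> \<psi> T u X = ennreal c"
proof -
  let ?f = "\<lambda>t. running_cost \<phi> \<psi> (X t) (u t)"
  have nn: "?f t \<ge> 0" for t using phi_nonneg psi_nonneg by (auto simp: running_cost_def split: prod.splits)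
  have i: "integrable (lebesgue_on {0..T}) ?f"
    by (rule nonneg_integrable_lebesgue_on) (use assms nn in auto)
  show ?thesis
    unfolding cost_def
    using nn_integral_eq_integral[OF i] nn lebesgue_integral_eq_integral[OF i] integral_unique[OF assms] by simp
qed

lemma integrable_running_cost:
  assumes adm: "admissible p T u X" and fin: "cost \<phi> \<psi> T u X < \<infinity>"
  shows "(\<lambda>t. running_cost \<phi> \<psi> (X t) (u t)) integrable_on {0..T}"
proof -
  let ?f = "\<lambda>t. running_cost \<phi> \<psi> (X t) (u t)"
  have nn: "?f t \<ge> 0" for t using phi_nonneg psi_nonneg by (auto simp: running_cost_def split: prod.splits)
  have "continuous_on {0..T} X" "u integrable_on {0..T}"
    using adm by (auto simp: admissible_def intro: abs_continuous_on_imp_continuous_on)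
  then have c: "continuous_on {0..T} (\<lambda>t. 1 + \<phi> (snd (snd (snd (X t)))))"
    and u: "u \<in> borel_measurable (lebesgue_on {0..T})"
    by (auto intro!: continuous_intros continuous_on_compose2[OF C2_DERIV(2)[OF phi_C2]]
        integrable_on_borel_measurable_lebesgue_on)
  have "(\<lambda>t. \<psi> (u t)) \<in> borel_measurable (lebesgue_on {0..T})"
    by (rule measurable_compose[OF u borel_measurable_continuous_onI[OF C2_DERIV(2)[OF psi_C2]]])
  then have "(\<lambda>t. 1 + \<phi> (snd (snd (snd (X t)))) + \<psi> (u t)) \<in> borel_measurable (lebesgue_on {0..T})"
    using continuous_imp_measurable_on_sets_lebesgue[OF c] by simp
  moreover have "(\<lambda>t. 1 + \<phi> (snd (snd (snd (X t)))) + \<psi> (u t)) = ?f"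
    by (auto simp: running_cost_def split: prod.splits)
  ultimately have "integrable (lebesgue_on {0..T}) ?f"
    using fin nn by (intro integrableI_nonneg) (auto simp: cost_def)
  then show ?thesis by (rule integrable_on_lebesgue_on) simp
qed

text \<open>Bounds the cost of the detour in \<open>reach_far\<close> beyond the distance to the
  target. There \<open>reach_connect\<close> is used twice with \<open>\<delta> = 10\<close> and
  \<open>g = 1 / 2\<close>, so \<open>h = 6 * (20 + 1 / 2) = 123\<close> and
  \<open>492 = 4 * 123\<close>; the stretch of length \<open>3 / sin (1 / 2)\<close> behind the
  origin counts twice.\<close>

definition excess_bound :: real where
  "excess_bound = 6 / sin (1 / 2) + 492 + 4 * \<phi> 123 + 4 * \<psi> 123"

text \<open>
  Going through a point behind the origin makes both displacements long enough for
  \<open>reach_connect\<close>, whatever the distance \<open>R\<close> to the target.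
\<close>
lemma reach_far:
  assumes "R \<ge> 0" and \<alpha>: "\<alpha> \<in> {0..<2 * pi}" and \<theta>: "\<bar>\<theta> - \<alpha>\<bar> \<le> pi"
  shows "reach \<phi> \<psi> p (0, 0, pi / 2, 0) (R * cos \<alpha>, R * sin \<alpha>, \<theta>, 0) (R + excess_bound)"
proof -
  \<comment> \<open>\<open>M * sin (1 / 2) = 3\<close> exceeds the 2 that
    \<open>reach_connect\<close> demands when \<open>E = 0\<close>.\<close>
  define M where "M = 3 / sin (1 / 2 :: real)"
  have s: "sin (1 / 2 :: real) > 0" using pi_gt3 by (intro sin_gt_zero) auto
  have M: "M > 0" "M * sin (1 / 2) = 3" using s by (auto simp: M_def)
  have sc: "cos \<alpha> * cos \<alpha> + sin \<alpha> * sin \<alpha> = 1" by simp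
  have turn: "cos (\<alpha> - pi) = - cos \<alpha>" "sin (\<alpha> - pi) = - sin \<alpha>" by (simp_all add: cos_diff sin_diff)
  have "reach \<phi> \<psi> p (0, 0, pi / 2, 0) (- M * cos \<alpha>, - M * sin \<alpha>, \<alpha> - pi, 0) (M + \<bar>0\<bar> * (1 / 2) + 2 * 123 + 2 * \<phi> 123 + 2 * \<psi> 123)"
  \<comment> \<open>The first leg runs opposite to the target direction; 10 is a crude bound for all
    angles to be turned.\<close>
  proof (rule reach_connect[of _ "\<alpha> - pi" 10])
    show "\<bar>pi / 2 - (\<alpha> - pi)\<bar> \<le> 10" using \<alpha> pi_less_4 pi_gt3 by (auto simp: abs_le_iff)
    show "M = (- M * cos \<alpha> - 0) * cos (\<alpha> - pi) + (- M * sin \<alpha> - 0) * sin (\<alpha> - pi)"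
      using sc turn by algebra
    show "0 = (- M * sin \<alpha> - 0) * cos (\<alpha> - pi) - (- M * cos \<alpha> - 0) * sin (\<alpha> - pi)"
      using turn by algebra
  qed (use M pi_gt3 in auto)
  moreover have "reach \<phi> \<psi> p (- M * cos \<alpha>, - M * sin \<alpha>, \<alpha> - pi, 0) (R * cos \<alpha>, R * sin \<alpha>, \<theta>, 0)
      ((R + M) + \<bar>0\<bar> * (1 / 2) + 2 * 123 + 2 * \<phi> 123 + 2 * \<psi> 123)"
  proof (rule reach_connect[of _ \<alpha> 10])
    show "R + M = (R * cos \<alpha> - - M * cos \<alpha>) * cos \<alpha> + (R * sin \<alpha> - - M * sin \<alpha>) * sin \<alpha>"
      using sc by algebra
    show "0 = (R * sin \<alpha> - - M * sin \<alpha>) * cos \<alpha> - (R * cos \<alpha> - - M * cos \<alpha>) * sin \<alpha>"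
      by (simp add: algebra_simps)
    have "0 \<le> R * sin (1 / 2)" using assms s by simp
    then show "\<bar>0\<bar> + 2 < (R + M) * sin (1 / 2)" using M by (simp add: distrib_right)
  qed (use \<theta> pi_gt3 pi_less_4 in auto)
  ultimately show ?thesis
    by (rule reach_mono[OF reach_trans]) (simp add: excess_bound_def M_def)
qed

end

section \<open>Cost and excess along a fixed optimal trajectory\<close>

locale optimal = standing_cost \<phi> \<psi> p for \<phi> \<psi> p +
  fixes T :: real and u :: "real \<Rightarrow> real" and X :: "real \<Rightarrow> state" and x\<^sub>1 y\<^sub>1 \<theta>\<^sub>1 \<alpha> :: real
  assumes optimal: "optimal_trajectory \<phi> \<psi> p T u X (x\<^sub>1, y\<^sub>1, \<theta>\<^sub>1, 0)"
    and direction: "(x\<^sub>1, y\<^sub>1) = norm (x\<^sub>1, y\<^sub>1) *\<^sub>R (cos \<alpha>, sin \<alpha>)"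
    and alpha: "\<alpha> \<in> {0..<2 * pi}"
begin

definition "x t = fst (X t)"
definition "y t = fst (snd (X t))"
definition "\<theta> t = fst (snd (snd (X t)))"
definition "\<kappa> t = snd (snd (snd (X t)))"

lemma X_eq: "X t = (x t, y t, \<theta> t, \<kappa> t)" by (simp add: x_def y_def \<theta>_def \<kappa>_def)

abbreviation "excess t \<equiv> (1 - cos (\<theta> t - \<alpha>)) + (\<phi> (\<kappa> t) + \<psi> (u t))"

lemma adm: "admissible p T u X"
  using optimal trajectory_imp_admissible by (auto simp: optimal_trajectory_def)

lemma T_pos: "T > 0" using adm by (simp add: admissible_def)

lemma continuous_\<theta>\<kappa>: "continuous_on {0..T} \<theta>" "continuous_on {0..T} \<kappa>"
proof -
  have "continuous_on {0..T} X" using adm by (auto simp: admissible_def intro: abs_continuous_on_imp_continuous_on)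
  then show "continuous_on {0..T} \<theta>" "continuous_on {0..T} \<kappa>"
    unfolding \<theta>_def \<kappa>_def by (auto intro!: continuous_intros)
qed

lemma has_integrals:
  assumes "0 \<le> a" "a \<le> b" "b \<le> T"
  shows "((\<lambda>t. cos (\<theta> t)) has_integral x b - x a) {a..b}"
    and "((\<lambda>t. sin (\<theta> t)) has_integral y b - y a) {a..b}"
    and "(\<kappa> has_integral \<theta> b - \<theta> a) {a..b}"
    and "(u has_integral \<kappa> b - \<kappa> a) {a..b}"
proof -
  have "((\<lambda>t. dynamics (X t) (u t)) has_integral X b - X a) {a..b}"
    by (rule trajectory_has_integral) (use adm assms in \<open>auto simp: admissible_def\<close>)
  then have i: "((\<lambda>t. (cos (\<theta> t), sin (\<theta> t), \<kappa> t, u t)) has_integral (x b - x a, y b - y a, \<theta> b - \<theta> a, \<kappa> b - \<kappa> a)) {a..b}"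
    by (simp add: X_eq dynamics_def)
  show "((\<lambda>t. cos (\<theta> t)) has_integral x b - x a) {a..b}"
    using has_integral_linear[OF i bounded_linear_fst] by (simp add: o_def)
  note i = has_integral_linear[OF i bounded_linear_snd, unfolded o_def snd_conv]
  show "((\<lambda>t. sin (\<theta> t)) has_integral y b - y a) {a..b}"
    using has_integral_linear[OF i bounded_linear_fst] by (simp add: o_def)
  note i = has_integral_linear[OF i bounded_linear_snd, unfolded o_def snd_conv]
  show "(\<kappa> has_integral \<theta> b - \<theta> a) {a..b}"
    using has_integral_linear[OF i bounded_linear_fst] by (simp add: o_def)
  show "(u has_integral \<kappa> b - \<kappa> a) {a..b}"
    using has_integral_linear[OF i bounded_linear_snd] by (simp add: o_def)
qed

lemma has_integral_cos:
  assumes "0 \<le> a" "a \<le> b" "b \<le> T"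
  shows "((\<lambda>t. cos (\<theta> t - \<alpha>)) has_integral (x b - x a) * cos \<alpha> + (y b - y a) * sin \<alpha>) {a..b}"
proof -
  have "((\<lambda>t. cos (\<theta> t) * cos \<alpha> + sin (\<theta> t) * sin \<alpha>) has_integral (x b - x a) * cos \<alpha> + (y b - y a) * sin \<alpha>) {a..b}"
    using has_integrals(1,2)[OF assms] by (intro has_integral_add has_integral_mult_left)
  then show ?thesis by (simp add: cos_diff)
qed

lemma has_integral_sin:
  assumes "0 \<le> a" "a \<le> b" "b \<le> T"
  shows "((\<lambda>t. sin (\<theta> t - \<alpha>)) has_integral (y b - y a) * cos \<alpha> - (x b - x a) * sin \<alpha>) {a..b}"
proof -
  have "((\<lambda>t. sin (\<theta> t) * cos \<alpha> - cos (\<theta> t) * sin \<alpha>) has_integral (y b - y a) * cos \<alpha> - (x b - x a) * sin \<alpha>) {a..b}"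
    using has_integrals(1,2)[OF assms] by (intro has_integral_diff has_integral_mult_left)
  then show ?thesis by (simp add: sin_diff)
qed

lemma target: "x\<^sub>1 = norm (x\<^sub>1, y\<^sub>1) * cos \<alpha>" "y\<^sub>1 = norm (x\<^sub>1, y\<^sub>1) * sin \<alpha>"
  using arg_cong[OF direction, of fst] arg_cong[OF direction, of snd] by simp_all

lemma ends: "x 0 = 0" "y 0 = 0" "x T = x\<^sub>1" "y T = y\<^sub>1"
  using optimal by (auto simp: optimal_trajectory_def X_eq same_state_def X_init_def)

text \<open>Integrability is a conclusion: the cost of an optimal trajectory is known to be finite
  only through comparison with a competitor of finite cost.\<close>

lemma integral_le_reach:
  assumes r: "reach \<phi> \<psi> p A B c" and A: "same_state A X_init" and B: "same_state B (x\<^sub>1, y\<^sub>1, \<theta>\<^sub>1, 0)"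
  shows "(\<lambda>t. running_cost \<phi> \<psi> (X t) (u t)) integrable_on {0..T}"
    and "integral {0..T} (\<lambda>t. running_cost \<phi> \<psi> (X t) (u t)) \<le> c"
proof -
  obtain T' u' X' c' where 1: "admissible p T' u' X'" "X' 0 = A" "X' T' = B" "c' \<le> c"
    "((\<lambda>t. running_cost \<phi> \<psi> (X' t) (u' t)) has_integral c') {0..T'}"
    using r by (rule reachE)
  have "0 \<le> c'"
    by (rule has_integral_nonneg[OF 1(5)]) (use phi_nonneg psi_nonneg in \<open>auto simp: running_cost_def split: prod.splits\<close>)
  have "cost \<phi> \<psi> T u X \<le> cost \<phi> \<psi> T' u' X'"
    using optimal 1 A B admissible_imp_trajectory[OF 1(1)] by (auto simp: optimal_trajectory_def)
  also have "\<dots> = ennreal c'" by (rule cost_eq_integral[OF 1(5)])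
  finally have le: "cost \<phi> \<psi> T u X \<le> ennreal c'" .
  then have "cost \<phi> \<psi> T u X < \<infinity>" using ennreal_less_top[of c'] by (auto simp: less_top order_le_less_trans)
  then show i: "(\<lambda>t. running_cost \<phi> \<psi> (X t) (u t)) integrable_on {0..T}"
    by (rule integrable_running_cost[OF adm])
  have "ennreal (integral {0..T} (\<lambda>t. running_cost \<phi> \<psi> (X t) (u t))) \<le> ennreal c'"
    using le cost_eq_integral[OF integrable_integral[OF i]] by simp
  then show "integral {0..T} (\<lambda>t. running_cost \<phi> \<psi> (X t) (u t)) \<le> c" using \<open>0 \<le> c'\<close> 1(4) by simp
qed

text \<open>\<open>reach_far\<close> needs a final angle within \<open>pi\<close> of
  \<open>\<alpha>\<close>, so \<open>\<theta>\<^sub>1\<close> is replaced by an equivalent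
  lift.\<close>

lemma reach_target: "\<exists>\<theta>'. reach \<phi> \<psi> p X_init (x\<^sub>1, y\<^sub>1, \<theta>', 0) (norm (x\<^sub>1, y\<^sub>1) + excess_bound) \<and> [\<theta>' = \<theta>\<^sub>1] (rmod 2 * pi)"
proof -
  obtain k where k: "\<theta>\<^sub>1 - \<alpha> = angle_diff \<theta>\<^sub>1 \<alpha> + 2 * pi * of_int k" using angle_diff_shift by blast
  have "\<bar>angle_diff \<theta>\<^sub>1 \<alpha>\<bar> \<le> pi" by (rule abs_angle_diff_le) auto
  then have "reach \<phi> \<psi> p (0, 0, pi / 2, 0)
    (norm (x\<^sub>1, y\<^sub>1) * cos \<alpha>, norm (x\<^sub>1, y\<^sub>1) * sin \<alpha>, \<alpha> + angle_diff \<theta>\<^sub>1 \<alpha>, 0) (norm (x\<^sub>1, y\<^sub>1) + excess_bound)"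
    by (intro reach_far alpha) auto
  then have "reach \<phi> \<psi> p X_init (x\<^sub>1, y\<^sub>1, \<alpha> + angle_diff \<theta>\<^sub>1 \<alpha>, 0) (norm (x\<^sub>1, y\<^sub>1) + excess_bound)"
    unfolding X_init_def target[symmetric] .
  moreover have "[\<alpha> + angle_diff \<theta>\<^sub>1 \<alpha> = \<theta>\<^sub>1] (rmod 2 * pi)"
    unfolding rcong_altdef by (rule exI[of _ k]) (use k in \<open>simp add: algebra_simps\<close>)
  ultimately show ?thesis by blast
qed

lemma integrable_cost: "(\<lambda>t. running_cost \<phi> \<psi> (X t) (u t)) integrable_on {0..T}"
  and total_cost: "integral {0..T} (\<lambda>t. running_cost \<phi> \<psi> (X t) (u t)) \<le> norm (x\<^sub>1, y\<^sub>1) + excess_bound"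
proof -
  obtain \<theta>' where r: "reach \<phi> \<psi> p X_init (x\<^sub>1, y\<^sub>1, \<theta>', 0) (norm (x\<^sub>1, y\<^sub>1) + excess_bound)" "[\<theta>' = \<theta>\<^sub>1] (rmod 2 * pi)"
    using reach_target by blast
  have "same_state X_init X_init" "same_state (x\<^sub>1, y\<^sub>1, \<theta>', 0) (x\<^sub>1, y\<^sub>1, \<theta>\<^sub>1, 0)"
    using r(2) by (auto simp: same_state_def X_init_def)
  from integral_le_reach[OF r(1) this]
  show "(\<lambda>t. running_cost \<phi> \<psi> (X t) (u t)) integrable_on {0..T}"
    "integral {0..T} (\<lambda>t. running_cost \<phi> \<psi> (X t) (u t)) \<le> norm (x\<^sub>1, y\<^sub>1) + excess_bound" by auto
qed

lemma cost_segment: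
  "0 \<le> a \<Longrightarrow> b \<le> T \<Longrightarrow> (\<lambda>t. running_cost \<phi> \<psi> (X t) (u t)) integrable_on {a..b}"
  by (rule integrable_on_subinterval[OF integrable_cost]) auto

lemma has_integral_excess:
  assumes "0 \<le> a" "a \<le> b" "b \<le> T"
  shows "(excess has_integral integral {a..b} (\<lambda>t. running_cost \<phi> \<psi> (X t) (u t))
    - ((x b - x a) * cos \<alpha> + (y b - y a) * sin \<alpha>)) {a..b}"
proof -
  have "((\<lambda>t. running_cost \<phi> \<psi> (X t) (u t) - cos (\<theta> t - \<alpha>)) has_integral integral {a..b} (\<lambda>t. running_cost \<phi> \<psi> (X t) (u t))
    - ((x b - x a) * cos \<alpha> + (y b - y a) * sin \<alpha>)) {a..b}"
    using assms by (intro has_integral_diff integrable_integral cost_segment has_integral_cos)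
  then show ?thesis by (simp add: X_eq running_cost_def algebra_simps)
qed

lemma excess_integrable: "0 \<le> a \<Longrightarrow> b \<le> T \<Longrightarrow> excess integrable_on {a..b}"
  using has_integral_excess[of a b] by (cases "a \<le> b") (simp_all add: has_integral_integrable)

lemma excess_nonneg: "0 \<le> excess t"
  using phi_nonneg psi_nonneg by simp

lemma total_excess: "integral {0..T} excess \<le> excess_bound"
proof -
  have "x\<^sub>1 * cos \<alpha> + y\<^sub>1 * sin \<alpha> = norm (x\<^sub>1, y\<^sub>1)"
  proof -
    have "cos \<alpha> * cos \<alpha> + sin \<alpha> * sin \<alpha> = 1" by simp
    then show ?thesis using target by algebra
  qed
  then show ?thesis
    using integral_unique[OF has_integral_excess[of 0 T]] T_pos ends total_cost by simp
qed

lemma integral_excess_mono: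
  assumes "0 \<le> a" "a \<le> c" "d \<le> b" "b \<le> T"
  shows "integral {c..d} excess \<le> integral {a..b} excess"
proof (cases "c \<le> d")
  case True
  show ?thesis
    by (rule integral_subset_le) (use True assms excess_nonneg in \<open>auto intro!: excess_integrable\<close>)
next
  case False
  have "0 \<le> integral {a..b} excess"
    using assms excess_nonneg by (intro integral_nonneg excess_integrable)
  then show ?thesis using False by simp
qed

text \<open>Bellman's principle. A competitor on the middle part may end with another lift of the
  angle; the last part is then translated by the same full turns. The strict inequalities give all
  three parts positive duration, as \<open>reach\<close> demands.\<close>

lemma middle_optimal:
  assumes ab: "0 < a" "a < b" "b < T" and r: "reach \<phi> \<psi> p (X a) (X b + (0, 0, 2 * pi * of_int k, 0)) c"
  shows "integral {a..b} (\<lambda>t. running_cost \<phi> \<psi> (X t) (u t)) \<le> c"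
proof -
  let ?I = "\<lambda>a b. integral {a..b} (\<lambda>t. running_cost \<phi> \<psi> (X t) (u t))"
  have "reach \<phi> \<psi> p (X 0) (X a) (?I 0 a)"
    by (rule reach_segment[OF adm]) (use ab cost_segment in auto)
  moreover have "reach \<phi> \<psi> p (X b) (X T) (?I b T)"
    by (rule reach_segment[OF adm]) (use ab cost_segment in auto)
  then have "reach \<phi> \<psi> p (X b + (0, 0, 2 * pi * of_int k, 0)) (X T + (0, 0, 2 * pi * of_int k, 0)) (?I b T)"
    by (rule reach_translate)
  ultimately have all: "reach \<phi> \<psi> p (X 0) (X T + (0, 0, 2 * pi * of_int k, 0)) (?I 0 a + (c + ?I b T))"
    by (meson r reach_trans)
  have "same_state (X T + (0, 0, 2 * pi * of_int k, 0)) (x\<^sub>1, y\<^sub>1, \<theta>\<^sub>1, 0)"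
  proof -
    have "[\<theta> T = \<theta>\<^sub>1] (rmod 2 * pi)" "\<kappa> T = 0" "x T = x\<^sub>1" "y T = y\<^sub>1"
      using optimal by (auto simp: optimal_trajectory_def X_eq same_state_def)
    moreover have "[\<theta> T + 2 * pi * of_int k = \<theta> T] (rmod 2 * pi)"
      unfolding rcong_altdef by (rule exI[of _ "- k"]) simp
    ultimately show ?thesis by (auto simp: X_eq same_state_def intro: rcong_trans)
  qed
  then have "?I 0 T \<le> ?I 0 a + (c + ?I b T)"
    using integral_le_reach(2)[OF all] optimal by (auto simp: optimal_trajectory_def)
  moreover have "?I 0 a + ?I a T = ?I 0 T"
    using ab by (intro Henstock_Kurzweil_Integration.integral_combine cost_segment) auto
  moreover have "?I a b + ?I b T = ?I a T"
    using ab by (intro Henstock_Kurzweil_Integration.integral_combine cost_segment) auto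
  ultimately show ?thesis by linarith
qed

text \<open>The whole displacement has no component across \<open>\<alpha>\<close>, so that of the
  middle part cancels those of the two ends and is at most \<open>a + (T - b)\<close>. Along
  \<open>\<alpha>\<close> the loss \<open>b - a - D\<close> is part of the excess, hence at most
  \<open>excess_bound\<close>. A long middle part thus meets the condition of
  \<open>reach_connect\<close> for any fixed \<open>g\<close>.\<close>

lemma middle_excess:
  assumes ab: "0 < a" "a < b" "b < T"
    and near: "cos \<delta> \<le> cos (\<theta> a - \<alpha>)" "cos \<delta> \<le> cos (\<theta> b - \<alpha>)" "\<bar>\<kappa> a\<bar> \<le> \<delta>" "\<bar>\<kappa> b\<bar> \<le> \<delta>"
    and \<delta>: "0 < \<delta>" "\<delta> \<le> pi" and g: "0 < g" "g \<le> pi / 4"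
    and large: "(b - a - excess_bound) * sin g > a + (T - b) + 2" and h: "h = 6 * (2 * \<delta> + g)"
  shows "integral {a..b} excess \<le> (a + (T - b)) * g + 2 * h + 2 * \<phi> h + 2 * \<psi> h"
proof -
  obtain k where k: "\<theta> a - \<alpha> = angle_diff (\<theta> a) \<alpha> + 2 * pi * of_int k" using angle_diff_shift by blast
  obtain m where m: "\<theta> b - \<alpha> = angle_diff (\<theta> b) \<alpha> + 2 * pi * of_int m" using angle_diff_shift by blast
  \<comment> \<open>The lift of the target direction near \<open>\<theta> a\<close>; the angle at
    \<open>b\<close> is moved by \<open>k - m\<close> full turns to lie near the same lift.\<close>
  define \<alpha>' where "\<alpha>' = \<alpha> + 2 * pi * of_int k"
  have per: "cos \<alpha>' = cos \<alpha>" "sin \<alpha>' = sin \<alpha>"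
    using dynamics_translate[of "(0, 0, \<alpha>, 0)" 0 0 k 0] by (auto simp: dynamics_def \<alpha>'_def)
  define D where "D = (x b - x a) * cos \<alpha> + (y b - y a) * sin \<alpha>"
  define E where "E = (y b - y a) * cos \<alpha> - (x b - x a) * sin \<alpha>"
  have E: "\<bar>E\<bar> \<le> a + (T - b)"
  proof -
    have "\<bar>(y d - y c) * cos \<alpha> - (x d - x c) * sin \<alpha>\<bar> \<le> d - c" if "0 \<le> c" "c \<le> d" "d \<le> T" for c d
      using has_integral_bound_real[OF _ finite.emptyI has_integral_sin[OF that], of 1] that by auto
    from this[of 0 a] this[of b T] ab
    have "\<bar>y a * cos \<alpha> - x a * sin \<alpha>\<bar> \<le> a" "\<bar>(y\<^sub>1 - y b) * cos \<alpha> - (x\<^sub>1 - x b) * sin \<alpha>\<bar> \<le> T - b"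
      by (auto simp: ends)
    moreover have "E = - (y a * cos \<alpha> - x a * sin \<alpha>) - ((y\<^sub>1 - y b) * cos \<alpha> - (x\<^sub>1 - x b) * sin \<alpha>)"
    proof -
      have "y\<^sub>1 * cos \<alpha> = x\<^sub>1 * sin \<alpha>" using target by algebra
      then show ?thesis by (simp add: E_def algebra_simps)
    qed
    ultimately show ?thesis by linarith
  qed
  have D: "b - a - excess_bound \<le> D"
  proof -
    have "((\<lambda>t. 1 - cos (\<theta> t - \<alpha>)) has_integral (b - a) - D) {a..b}"
      using has_integral_diff[OF has_integral_const_real[of 1 a b] has_integral_cos[of a b]] ab by (simp add: D_def)
    moreover have "(excess has_integral integral {a..b} excess) {a..b}"
      using ab by (intro integrable_integral excess_integrable) auto
    ultimately have "(b - a) - D \<le> integral {a..b} excess"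
      by (rule has_integral_le) (use phi_nonneg psi_nonneg in simp)
    also have "\<dots> \<le> excess_bound" using integral_excess_mono[of 0 a b T] ab total_excess by simp
    finally show ?thesis by simp
  qed
  have sg: "0 < sin g" using g pi_gt_zero by (intro sin_gt_zero) linarith+
  have "reach \<phi> \<psi> p (x a, y a, \<theta> a, \<kappa> a) (x b, y b, \<theta> b + 2 * pi * of_int (k - m), \<kappa> b)
      (D + \<bar>E\<bar> * g + 2 * h + 2 * \<phi> h + 2 * \<psi> h)"
  proof (rule reach_connect[OF _ _ near(3,4) g _ _ _ h])
    show "\<bar>\<theta> a - \<alpha>'\<bar> \<le> \<delta>" using abs_angle_diff_le[of \<delta> "\<theta> a" \<alpha>] near \<delta> k by (simp add: \<alpha>'_def)
    have "\<theta> b + 2 * pi * of_int (k - m) - \<alpha>' = angle_diff (\<theta> b) \<alpha>"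
      using m by (simp add: \<alpha>'_def algebra_simps)
    then show "\<bar>\<theta> b + 2 * pi * of_int (k - m) - \<alpha>'\<bar> \<le> \<delta>" using abs_angle_diff_le[of \<delta> "\<theta> b" \<alpha>] near \<delta> by simp
    show "D = (x b - x a) * cos \<alpha>' + (y b - y a) * sin \<alpha>'" "E = (y b - y a) * cos \<alpha>' - (x b - x a) * sin \<alpha>'"
      by (simp_all add: D_def E_def per)
    show "\<bar>E\<bar> + 2 < D * sin g"
      using large E mult_right_mono[OF D, of "sin g"] sg by linarith
  qed
  then have "reach \<phi> \<psi> p (X a) (X b + (0, 0, 2 * pi * of_int (k - m), 0)) (D + \<bar>E\<bar> * g + 2 * h + 2 * \<phi> h + 2 * \<psi> h)"
    by (simp add: X_eq)
  from middle_optimal[OF ab this]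
  have "integral {a..b} excess \<le> \<bar>E\<bar> * g + 2 * h + 2 * \<phi> h + 2 * \<psi> h"
    using integral_unique[OF has_integral_excess[of a b]] ab by (simp add: D_def)
  also have "\<bar>E\<bar> * g \<le> (a + (T - b)) * g" using E g by (intro mult_right_mono) auto
  finally show ?thesis by simp
qed

lemma window_small:
  assumes s: "0 \<le> s" "s + 1 \<le> T" and small: "integral {s..s + 1} excess < \<epsilon>"
    and \<delta>: "0 < \<delta>" "\<delta> \<le> 1" and \<epsilon>: "\<epsilon> \<le> \<psi> \<delta>" "8 * \<epsilon> \<le> \<delta>\<^sup>2" "\<epsilon> \<le> 1 / 4"
    and t: "t \<in> {s..s + 1}"
  shows "\<bar>\<kappa> t\<bar> \<le> 18 * \<delta>" and "1 - 19 * \<delta> \<le> cos (\<theta> t - \<alpha>)"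
    and "(\<lambda>t. \<psi> (u t)) integrable_on {s..s + 1}" and "integral {s..s + 1} (\<lambda>t. \<psi> (u t)) < \<epsilon>"
proof -
  have c: "continuous_on {s..s + 1} \<theta>" "continuous_on {s..s + 1} \<kappa>"
    using s by (auto intro: continuous_on_subset[OF continuous_\<theta>\<kappa>(1)] continuous_on_subset[OF continuous_\<theta>\<kappa>(2)])
  have ci: "(\<lambda>t. 1 - cos (\<theta> t - \<alpha>)) integrable_on {s..s + 1}"
    by (intro integrable_continuous_real continuous_intros c)
  have \<phi>i: "(\<lambda>t. \<phi> (\<kappa> t)) integrable_on {s..s + 1}"
    by (intro integrable_continuous_real continuous_on_compose2[OF C2_DERIV(2)[OF phi_C2] c(2)]) auto
  have ei: "excess integrable_on {s..s + 1}" by (rule excess_integrable[OF s])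
  \<comment> \<open>The excess minus its two continuous terms.\<close>
  show \<psi>i: "(\<lambda>t. \<psi> (u t)) integrable_on {s..s + 1}"
    using integrable_diff[OF integrable_diff[OF ei ci] \<phi>i] by simp
  have "integral {s..s + 1} excess = integral {s..s + 1} (\<lambda>t. 1 - cos (\<theta> t - \<alpha>)) +
      (integral {s..s + 1} (\<lambda>t. \<phi> (\<kappa> t)) + integral {s..s + 1} (\<lambda>t. \<psi> (u t)))"
    using integral_add[OF ci integrable_add[OF \<phi>i \<psi>i]] integral_add[OF \<phi>i \<psi>i] by simp
  moreover have "0 \<le> integral {s..s + 1} (\<lambda>t. \<phi> (\<kappa> t))" by (intro integral_nonneg \<phi>i phi_nonneg)
  ultimately have sm: "integral {s..s + 1} (\<lambda>t. 1 - cos (\<theta> t - \<alpha>)) + integral {s..s + 1} (\<lambda>t. \<psi> (u t)) < \<epsilon>"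
    using small by linarith
  moreover have "0 \<le> integral {s..s + 1} (\<lambda>t. 1 - cos (\<theta> t - \<alpha>))" by (intro integral_nonneg ci) simp
  ultimately show "integral {s..s + 1} (\<lambda>t. \<psi> (u t)) < \<epsilon>" by linarith
  have i: "(\<kappa> has_integral \<theta> b - \<theta> a) {a..b}" "(u has_integral \<kappa> b - \<kappa> a) {a..b}" if "s \<le> a" "a \<le> b" "b \<le> s + 1" for a b
    using has_integrals(3,4)[of a b] that s by auto
  show "\<bar>\<kappa> t\<bar> \<le> 18 * \<delta>" "1 - 19 * \<delta> \<le> cos (\<theta> t - \<alpha>)"
    using window_bounds[OF c(2) i \<psi>i sm \<delta> \<epsilon> t] by auto
qed

end

section \<open>Adjoint vectors and the turnpike property\<close>

context optimal
begin

text \<open>Reduces to \<open>adjoint_window\<close> by rotating the constant pair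
  \<open>(p\<^sub>1, p\<^sub>2)\<close> into the frame of the target. The conditions on
  \<open>\<delta>\<close>, \<open>\<delta>'\<close> and \<open>\<epsilon>\<close> turn small excess
  into the bounds by \<open>\<eta>\<close> required there.\<close>

lemma adjoint_small:
  assumes P: "adjoint_vector \<phi> \<psi> T u X P"
    and s: "0 \<le> s" "s + 1 \<le> T" and small: "integral {s..s + 1} excess < \<epsilon>"
    and \<delta>: "0 < \<delta>" "\<delta> \<le> 1" and \<epsilon>: "\<epsilon> \<le> \<psi> \<delta>" "8 * \<epsilon> \<le> \<delta>\<^sup>2" "\<epsilon> \<le> 1 / 4"
    and \<eta>: "0 < \<eta>" "\<eta> \<le> 1 / 2000" "19 * \<delta> \<le> \<eta>" "38 * \<delta> \<le> \<eta>\<^sup>2"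
    and \<phi>\<eta>: "\<And>k. \<bar>k\<bar> \<le> 18 * \<delta> \<Longrightarrow> \<bar>\<phi> k\<bar> \<le> \<eta> \<and> \<bar>deriv \<phi> k\<bar> \<le> \<eta>"
    and \<delta>': "0 < \<delta>'" "\<delta>' \<le> 1" "8 * \<epsilon> \<le> \<psi> \<delta>'"
    and \<psi>\<eta>: "\<And>v. \<bar>v\<bar> \<le> \<delta>' \<Longrightarrow> \<bar>\<psi> v\<bar> \<le> \<eta> \<and> \<bar>deriv \<psi> v\<bar> \<le> \<eta>"
    and t: "t \<in> {s..s + 1}"
  shows "\<bar>fst (snd (snd (P t)))\<bar> \<le> 1600 * \<eta>" and "\<bar>snd (snd (snd (P t)))\<bar> \<le> 1600 * \<eta>"
proof -
  define q1 where "q1 t = fst (P t)" for t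
  define q2 where "q2 t = fst (snd (P t))" for t
  define q3 where "q3 t = fst (snd (snd (P t)))" for t
  define q4 where "q4 t = snd (snd (snd (P t)))" for t
  have P_eq: "P t = (q1 t, q2 t, q3 t, q4 t)" for t by (simp add: q1_def q2_def q3_def q4_def)
  note w = window_small[OF s small \<delta> \<epsilon>]
  have acP: "abs_continuous_on {0..T} P"
    and neg: "negligible {t \<in> {0..T}. \<not> (P has_vector_derivative adjoint_field \<phi> (X t) (P t)) (at t)}"
    and negu: "negligible {t \<in> {0..T}. u t \<noteq> inv (deriv \<psi>) (q4 t)}"
    and negH: "negligible {t \<in> {0..T}. q1 t * cos (\<theta> t) + q2 t * sin (\<theta> t) + q3 t * \<kappa> t + q4 t * u t
        - (1 + \<phi> (\<kappa> t) + \<psi> (u t)) \<noteq> 0}"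
    using P by (simp_all add: adjoint_vector_def AE_lebesgue_on_iff_negligible P_eq X_eq)
  have iP: "((\<lambda>t. (0, 0, q1 t * sin (\<theta> t) - q2 t * cos (\<theta> t), - q3 t + deriv \<phi> (\<kappa> t)))
      has_integral (q1 b - q1 a, q2 b - q2 a, q3 b - q3 a, q4 b - q4 a)) {a..b}"
    if "0 \<le> a" "a \<le> b" "b \<le> T" for a b
  proof -
    have "((\<lambda>t. adjoint_field \<phi> (X t) (P t)) has_integral P b - P a) {a..b}"
      by (rule abs_continuous_fundamental_theorem[OF that(2) _ neg])
        (use that in \<open>auto intro: abs_continuous_on_subset[OF acP]\<close>)
    then show ?thesis by (simp add: P_eq X_eq adjoint_field_def)
  qed
  define c1 c2 where "c1 = q1 0" and "c2 = q2 0"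
  have const: "q1 b = c1 \<and> q2 b = c2" if "b \<in> {0..T}" for b
  proof -
    have b: "0 \<le> (0::real)" "0 \<le> b" "b \<le> T" using that by auto
    have "((\<lambda>t. 0::real) has_integral q1 b - q1 0) {0..b}"
      using has_integral_linear[OF iP[OF b] bounded_linear_fst] by (simp add: o_def)
    moreover note i = has_integral_linear[OF iP[OF b] bounded_linear_snd, unfolded o_def snd_conv]
    have "((\<lambda>t. 0::real) has_integral q2 b - q2 0) {0..b}"
      using has_integral_linear[OF i bounded_linear_fst] by (simp add: o_def)
    ultimately show ?thesis by (simp add: c1_def c2_def has_integral_0_eq)
  qed
  \<comment> \<open>Components of the constant pair across and along the target direction; on the
    turnpike itself they would be 0 and 1.\<close>
  define A where "A = c1 * sin \<alpha> - c2 * cos \<alpha>"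
  define B where "B = c1 * cos \<alpha> + c2 * sin \<alpha>"
  define \<beta> where "\<beta> t = \<theta> t - \<alpha>" for t
  have rot: "c1 * sin (\<theta> t) - c2 * cos (\<theta> t) = A * cos (\<beta> t) + B * sin (\<beta> t)"
    "c1 * cos (\<theta> t) + c2 * sin (\<theta> t) = B * cos (\<beta> t) - A * sin (\<beta> t)" for t
  proof -
    have sc: "cos \<alpha> * cos \<alpha> + sin \<alpha> * sin \<alpha> = 1" by simp
    show "c1 * sin (\<theta> t) - c2 * cos (\<theta> t) = A * cos (\<beta> t) + B * sin (\<beta> t)"
      "c1 * cos (\<theta> t) + c2 * sin (\<theta> t) = B * cos (\<beta> t) - A * sin (\<beta> t)"
      unfolding A_def B_def \<beta>_def sin_diff cos_diff using sc by algebra+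
  qed
  have i3: "((\<lambda>t. A * cos (\<beta> t) + B * sin (\<beta> t)) has_integral q3 b - q3 a) {a..b}"
    and i4: "((\<lambda>t. - q3 t + deriv \<phi> (\<kappa> t)) has_integral q4 b - q4 a) {a..b}"
    if "s \<le> a" "a \<le> b" "b \<le> s + 1" for a b
  proof -
    have ab: "0 \<le> a" "a \<le> b" "b \<le> T" using that s by auto
    note i = has_integral_linear[OF iP[OF ab] bounded_linear_snd, unfolded o_def snd_conv]
    note i = has_integral_linear[OF i bounded_linear_snd, unfolded o_def snd_conv]
    have "((\<lambda>t. q1 t * sin (\<theta> t) - q2 t * cos (\<theta> t)) has_integral q3 b - q3 a) {a..b}"
      using has_integral_linear[OF i bounded_linear_fst] by (simp add: o_def)
    then show "((\<lambda>t. A * cos (\<beta> t) + B * sin (\<beta> t)) has_integral q3 b - q3 a) {a..b}"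
      by (rule has_integral_eq[rotated]) (use ab const rot in auto)
    show "((\<lambda>t. - q3 t + deriv \<phi> (\<kappa> t)) has_integral q4 b - q4 a) {a..b}"
      using has_integral_linear[OF i bounded_linear_snd] by (simp add: o_def)
  qed
  have cs: "\<bar>1 - cos (\<beta> t)\<bar> \<le> \<eta> \<and> \<bar>sin (\<beta> t)\<bar> \<le> \<eta> \<and> \<bar>deriv \<phi> (\<kappa> t)\<bar> \<le> \<eta>" if "t \<in> {s..s + 1}" for t
  proof -
    have b: "1 - 19 * \<delta> \<le> cos (\<beta> t)" using w(2)[OF that] by (simp add: \<beta>_def)
    \<comment> \<open>\<open>2 * (19 * \<delta>)\<close> bounds the square, hence the condition on
      \<open>38 * \<delta>\<close>.\<close>
    have "(sin (\<beta> t))\<^sup>2 \<le> \<eta>\<^sup>2" using sin_squared_le[of "\<beta> t"] b \<eta>(4) by linarith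
    then have "\<bar>sin (\<beta> t)\<bar> \<le> \<eta>" using \<eta>(1) abs_le_square_iff[of "sin (\<beta> t)" \<eta>] by simp
    moreover have "\<bar>1 - cos (\<beta> t)\<bar> \<le> \<eta>" using b \<eta>(3) cos_le_one[of "\<beta> t"] by linarith
    ultimately show ?thesis using \<phi>\<eta>[OF w(1)[OF that]] by simp
  qed
  let ?good = "\<lambda>r. \<bar>u r\<bar> \<le> \<delta>' \<and> q4 r = deriv \<psi> (u r) \<and>
    q1 r * cos (\<theta> r) + q2 r * sin (\<theta> r) + q3 r * \<kappa> r + q4 r * u r - (1 + \<phi> (\<kappa> r) + \<psi> (u r)) = 0"
  \<comment> \<open>Over a length of at least \<open>1 / 8\<close> the average of
    \<open>\<psi> (u t)\<close> is below \<open>8 * \<epsilon> \<le> \<psi> \<delta>'\<close>, and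
    monotonicity of \<open>\<psi>\<close> turns a value below that into
    \<open>\<bar>u r\<bar> \<le> \<delta>'\<close>. The time avoids the null sets where the control
    law or the Hamiltonian identity fails.\<close>
  have pt: "\<exists>r\<in>{a..b}. ?good r" if ab: "s \<le> a" "b \<le> s + 1" "b - a \<ge> 1 / 8" for a b
  proof -
    have \<psi>i: "(\<lambda>t. \<psi> (u t)) integrable_on {a..b}"
      by (rule integrable_on_subinterval[OF w(3)[OF t]]) (use ab in auto)
    have "integral {a..b} (\<lambda>t. \<psi> (u t)) \<le> integral {s..s + 1} (\<lambda>t. \<psi> (u t))"
      by (rule integral_subset_le) (use ab \<psi>i w(3)[OF t] psi_nonneg in auto)
    also have "\<dots> < \<epsilon>" by (rule w(4)[OF t])
    finally have lt: "integral {a..b} (\<lambda>t. \<psi> (u t)) < \<epsilon>" .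
    moreover have "0 \<le> integral {a..b} (\<lambda>t. \<psi> (u t))" by (intro integral_nonneg \<psi>i psi_nonneg)
    ultimately have "0 < \<epsilon>" by linarith
    then have "8 * \<epsilon> * (1 / 8) \<le> 8 * \<epsilon> * (b - a)" using ab by (intro mult_left_mono) auto
    then have lt': "integral {a..b} (\<lambda>t. \<psi> (u t)) < 8 * \<epsilon> * (b - a)" using lt by simp
    have "a \<le> b" using ab by linarith
    obtain r where r: "r \<in> {a..b}" "\<psi> (u r) < 8 * \<epsilon>"
      "r \<notin> {t \<in> {0..T}. u t \<noteq> inv (deriv \<psi>) (q4 t)} \<union> {t \<in> {0..T}. q1 t * cos (\<theta> t) + q2 t * sin (\<theta> t) + q3 t * \<kappa> t + q4 t * u t
        - (1 + \<phi> (\<kappa> t) + \<psi> (u t)) \<noteq> 0}"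
      by (rule exists_point_below[OF integrable_integral[OF \<psi>i] \<open>a \<le> b\<close> lt' negligible_Un[OF negu negH]])
    have rT: "r \<in> {0..T}" using r ab s by auto
    then have "u r = inv (deriv \<psi>) (q4 r)" using r(3) by blast
    \<comment> \<open>Surjectivity of \<open>\<psi>'\<close> makes \<open>inv\<close> a right
      inverse.\<close>
    then have "q4 r = deriv \<psi> (u r)" using surj_f_inv_f[OF surj_deriv_psi] by simp
    moreover have "\<bar>u r\<bar> \<le> \<delta>'"
    proof (rule ccontr)
      assume "\<not> ?thesis"
      then have "\<psi> \<delta>' \<le> \<psi> \<bar>u r\<bar>" using psi_le[of \<delta>' "\<bar>u r\<bar>"] \<delta>' by simp
      then show False using r(2) \<delta>'(3) psi_even[of "u r"] by (simp add: abs_if split: if_splits)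
    qed
    ultimately show ?thesis using r rT by blast
  qed
  obtain r where r: "r \<in> {s..s + 1 / 8}" "?good r" using pt[of s "s + 1 / 8"] by auto
  obtain r1 where r1: "r1 \<in> {s + 3 / 8..s + 5 / 8}" "?good r1" using pt[of "s + 3 / 8" "s + 5 / 8"] by auto
  obtain r2 where r2: "r2 \<in> {s + 7 / 8..s + 1}" "?good r2" using pt[of "s + 7 / 8" "s + 1"] by auto
  have q4: "\<bar>q4 r\<bar> \<le> \<eta>" "\<bar>q4 r1\<bar> \<le> \<eta>" "\<bar>q4 r2\<bar> \<le> \<eta>" using r r1 r2 \<psi>\<eta> by auto
  have rw: "r \<in> {s..s + 1}" using r by auto
  have k: "\<bar>\<kappa> r\<bar> \<le> \<eta>" using w(1)[OF rw] \<eta> \<delta> by linarith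
  have H: "\<bar>B * cos (\<beta> r) - A * sin (\<beta> r) + q3 r * \<kappa> r - 1\<bar> \<le> 3 * \<eta>"
  proof -
    have "c1 * cos (\<theta> r) + c2 * sin (\<theta> r) + q3 r * \<kappa> r + q4 r * u r - (1 + \<phi> (\<kappa> r) + \<psi> (u r)) = 0"
      using r const[of r] s by auto
    then have "B * cos (\<beta> r) - A * sin (\<beta> r) + q3 r * \<kappa> r - 1 = \<phi> (\<kappa> r) + \<psi> (u r) - q4 r * u r"
      using rot(2)[of r] by linarith
    moreover have "\<bar>q4 r * u r\<bar> \<le> \<eta> * 1"
      unfolding abs_mult using q4(1) r(2) \<delta>' \<eta> by (intro mult_mono) auto
    moreover have "\<bar>\<phi> (\<kappa> r)\<bar> \<le> \<eta>" "\<bar>\<psi> (u r)\<bar> \<le> \<eta>" using \<phi>\<eta>[OF w(1)[OF rw]] \<psi>\<eta> r(2) by auto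
    ultimately show ?thesis by linarith
  qed
  from adjoint_window[OF i3 i4 cs r(1) r1(1) r2(1) q4 H k \<eta>(1,2) t]
  show "\<bar>fst (snd (snd (P t)))\<bar> \<le> 1600 * \<eta>" "\<bar>snd (snd (snd (P t)))\<bar> \<le> 1600 * \<eta>"
    by (auto simp: q3_def q4_def)
qed

end

section \<open>Choice of the constants and conclusion\<close>

lemma continuous_small_near_0:
  fixes f :: "real \<Rightarrow> real"
  assumes "continuous_on UNIV f" "f 0 = 0" "\<eta> > 0"
  obtains d where "d > 0" "\<And>v. \<bar>v\<bar> \<le> d \<Longrightarrow> \<bar>f v\<bar> \<le> \<eta>"
proof -
  obtain e where e: "e > 0" "\<And>v. dist v 0 < e \<Longrightarrow> dist (f v) (f 0) < \<eta>"
    using assms(1,3) unfolding continuous_on_iff by (metis UNIV_I)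
  show thesis
  proof (rule that[of "e / 2"])
    show "\<bar>f v\<bar> \<le> \<eta>" if "\<bar>v\<bar> \<le> e / 2" for v
      using e(2)[of v] that e(1) assms(2) by (simp add: dist_real_def)
  qed (use e in simp)
qed

lemma one_minus_cos_pos: "0 < x \<Longrightarrow> x \<le> pi \<Longrightarrow> 0 < 1 - cos x"
  using cos_monotone_0_pi[of 0 x] by simp

lemma (in standing_cost) turnpike:
  assumes "\<nu> > 0"
  shows "\<exists>\<tau>>0. \<exists>\<sigma>>2 * \<tau>.
    \<forall>T u X x\<^sub>1 y\<^sub>1 \<theta>\<^sub>1 P \<alpha>.
      optimal_trajectory \<phi> \<psi> p T u X (x\<^sub>1, y\<^sub>1, \<theta>\<^sub>1, 0) \<longrightarrow> T > \<sigma> \<longrightarrow>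
      adjoint_vector \<phi> \<psi> T u X P \<longrightarrow>
      \<alpha> \<in> {0..<2 * pi} \<longrightarrow> (x\<^sub>1, y\<^sub>1) = norm (x\<^sub>1, y\<^sub>1) *\<^sub>R (cos \<alpha>, sin \<alpha>) \<longrightarrow>
      (\<forall>t\<in>{\<tau>..T - \<tau>}. norm (Z_deviation \<alpha> (X t) (P t)) < \<nu>)"
proof -
  \<comment> \<open>\<open>1 / 2000\<close> is the threshold of \<open>adjoint_window\<close>; the
    four components of the deviation add up to at most \<open>3202 * \<eta>\<close>.\<close>
  define \<eta> where "\<eta> = min (1 / 2000) (\<nu> / 8000)"
  have \<eta>: "0 < \<eta>" "\<eta> \<le> 1 / 2000" "8000 * \<eta> \<le> \<nu>" "\<eta> \<le> pi" using assms pi_gt3 by (auto simp: \<eta>_def)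
  obtain d1 where d1: "d1 > 0" "\<And>k. \<bar>k\<bar> \<le> d1 \<Longrightarrow> \<bar>\<phi> k\<bar> \<le> \<eta>"
    using continuous_small_near_0[OF C2_DERIV(2)[OF phi_C2] phi_0 \<eta>(1)] by blast
  obtain d2 where d2: "d2 > 0" "\<And>k. \<bar>k\<bar> \<le> d2 \<Longrightarrow> \<bar>deriv \<phi> k\<bar> \<le> \<eta>"
    using continuous_small_near_0[OF C2_DERIV(3)[OF phi_C2] deriv_even_0[OF phi_C2 phi_even] \<eta>(1)] by blast
  obtain d3 where d3: "d3 > 0" "\<And>k. \<bar>k\<bar> \<le> d3 \<Longrightarrow> \<bar>\<psi> k\<bar> \<le> \<eta>"
    using continuous_small_near_0[OF C2_DERIV(2)[OF psi_C2] psi_0 \<eta>(1)] by blast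
  obtain d4 where d4: "d4 > 0" "\<And>k. \<bar>k\<bar> \<le> d4 \<Longrightarrow> \<bar>deriv \<psi> k\<bar> \<le> \<eta>"
    using continuous_small_near_0[OF C2_DERIV(3)[OF psi_C2] deriv_even_0[OF psi_C2 psi_even] \<eta>(1)] by blast
  define \<delta>' where "\<delta>' = Min {1, d3, d4}"
  have \<delta>': "0 < \<delta>'" "\<delta>' \<le> 1" "\<delta>' \<le> d3" "\<delta>' \<le> d4" using d3 d4 by (auto simp: \<delta>'_def)
  \<comment> \<open>\<open>18 * \<delta>\<close> and \<open>19 * \<delta>\<close> are the window
    bounds on the curvature and on one minus the cosine; \<open>\<epsilon>\<close> below is an
    excess over a unit window that guarantees them.\<close>
  define \<delta> where "\<delta> = Min {1, d1 / 18, d2 / 18, \<eta> / 19, \<eta>\<^sup>2 / 38, (1 - cos \<eta>) / 19}"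
  have "0 < \<delta>" unfolding \<delta>_def using d1 d2 \<eta> one_minus_cos_pos[of \<eta>] by (subst Min_gr_iff) auto
  moreover have "\<delta> \<le> 1" "\<delta> \<le> d1 / 18" "\<delta> \<le> d2 / 18" "\<delta> \<le> \<eta> / 19" "\<delta> \<le> \<eta>\<^sup>2 / 38" "\<delta> \<le> (1 - cos \<eta>) / 19"
    unfolding \<delta>_def by (rule Min_le; simp)+
  ultimately have \<delta>: "0 < \<delta>" "\<delta> \<le> 1" "18 * \<delta> \<le> d1" "18 * \<delta> \<le> d2" "19 * \<delta> \<le> \<eta>" "38 * \<delta> \<le> \<eta>\<^sup>2" "19 * \<delta> \<le> 1 - cos \<eta>"
    by auto
  define \<epsilon> where "\<epsilon> = Min {\<psi> \<delta>, \<delta>\<^sup>2 / 8, 1 / 4, \<psi> \<delta>' / 8}"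
  have "0 < \<epsilon>" unfolding \<epsilon>_def using \<delta> \<delta>' psi_pos[of \<delta>] psi_pos[of \<delta>'] by (subst Min_gr_iff) auto
  moreover have "\<epsilon> \<le> \<psi> \<delta>" "\<epsilon> \<le> \<delta>\<^sup>2 / 8" "\<epsilon> \<le> 1 / 4" "\<epsilon> \<le> \<psi> \<delta>' / 8"
    unfolding \<epsilon>_def by (rule Min_le; simp)+
  ultimately have \<epsilon>: "0 < \<epsilon>" "\<epsilon> \<le> \<psi> \<delta>" "8 * \<epsilon> \<le> \<delta>\<^sup>2" "\<epsilon> \<le> 1 / 4" "8 * \<epsilon> \<le> \<psi> \<delta>'" by auto
  have \<epsilon>16: "\<epsilon> / 16 > 0" using \<epsilon> by simp
  obtain e1 where e1: "e1 > 0" "\<And>k. \<bar>k\<bar> \<le> e1 \<Longrightarrow> \<bar>\<phi> k\<bar> \<le> \<epsilon> / 16"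
    using continuous_small_near_0[OF C2_DERIV(2)[OF phi_C2] phi_0 \<epsilon>16] by blast
  obtain e2 where e2: "e2 > 0" "\<And>k. \<bar>k\<bar> \<le> e2 \<Longrightarrow> \<bar>\<psi> k\<bar> \<le> \<epsilon> / 16"
    using continuous_small_near_0[OF C2_DERIV(2)[OF psi_C2] psi_0 \<epsilon>16] by blast
  \<comment> \<open>Makes the turns of the competitor cost at most
    \<open>6 * \<epsilon> / 16\<close>; with \<open>\<epsilon> / 2\<close> for the tilted heading
    the total stays below \<open>\<epsilon>\<close>.\<close>
  define h\<^sub>0 where "h\<^sub>0 = Min {\<epsilon> / 16, e1, e2, 1}"
  have "0 < h\<^sub>0" unfolding h\<^sub>0_def using \<epsilon> e1 e2 by (subst Min_gr_iff) auto
  moreover have "h\<^sub>0 \<le> \<epsilon> / 16" "h\<^sub>0 \<le> e1" "h\<^sub>0 \<le> e2" "h\<^sub>0 \<le> 1"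
    unfolding h\<^sub>0_def by (rule Min_le; simp)+
  ultimately have h0: "0 < h\<^sub>0" "h\<^sub>0 \<le> \<epsilon> / 16" "h\<^sub>0 \<le> e1" "h\<^sub>0 \<le> e2" "h\<^sub>0 \<le> 1" by auto
  \<comment> \<open>Tolerance at the two end times: \<open>h = 12 * \<rho> + 6 * g\<close> stays
    within \<open>h\<^sub>0\<close>, as \<open>12 * g \<le> h\<^sub>0\<close>.\<close>
  define \<rho> where "\<rho> = h\<^sub>0 / 24"
  have \<rho>: "0 < \<rho>" "\<rho> \<le> pi" using h0 pi_gt3 by (auto simp: \<rho>_def)
  \<comment> \<open>The scheme of \<open>\<delta>\<close> and \<open>\<epsilon>\<close> again, with
    tolerance \<open>\<rho>\<close>; at the end times only angle and curvature have to be
    small.\<close>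
  define \<delta>\<^sub>2 where "\<delta>\<^sub>2 = Min {1, \<rho> / 18, (1 - cos \<rho>) / 19}"
  have "0 < \<delta>\<^sub>2" unfolding \<delta>\<^sub>2_def using \<rho> one_minus_cos_pos[of \<rho>] by (subst Min_gr_iff) auto
  moreover have "\<delta>\<^sub>2 \<le> 1" "\<delta>\<^sub>2 \<le> \<rho> / 18" "\<delta>\<^sub>2 \<le> (1 - cos \<rho>) / 19"
    unfolding \<delta>\<^sub>2_def by (rule Min_le; simp)+
  ultimately have \<delta>2: "0 < \<delta>\<^sub>2" "\<delta>\<^sub>2 \<le> 1" "18 * \<delta>\<^sub>2 \<le> \<rho>" "19 * \<delta>\<^sub>2 \<le> 1 - cos \<rho>" by auto
  define \<epsilon>\<^sub>2 where "\<epsilon>\<^sub>2 = Min {\<psi> \<delta>\<^sub>2, \<delta>\<^sub>2\<^sup>2 / 8, 1 / 4}"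
  have "0 < \<epsilon>\<^sub>2" unfolding \<epsilon>\<^sub>2_def using \<delta>2 psi_pos[of \<delta>\<^sub>2] by (subst Min_gr_iff) auto
  moreover have "\<epsilon>\<^sub>2 \<le> \<psi> \<delta>\<^sub>2" "\<epsilon>\<^sub>2 \<le> \<delta>\<^sub>2\<^sup>2 / 8" "\<epsilon>\<^sub>2 \<le> 1 / 4"
    unfolding \<epsilon>\<^sub>2_def by (rule Min_le; simp)+
  ultimately have \<epsilon>2: "0 < \<epsilon>\<^sub>2" "\<epsilon>\<^sub>2 \<le> \<psi> \<delta>\<^sub>2" "8 * \<epsilon>\<^sub>2 \<le> \<delta>\<^sub>2\<^sup>2" "\<epsilon>\<^sub>2 \<le> 1 / 4" by auto
  have K0: "0 < excess_bound"
  proof -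
    have "sin (1 / 2 :: real) > 0" using pi_gt3 by (intro sin_gt_zero) auto
    then show ?thesis using phi_nonneg[of 123] psi_nonneg[of 123] by (simp add: excess_bound_def add_pos_nonneg)
  qed
  \<comment> \<open>The excess cannot reach \<open>\<epsilon>\<^sub>2\<close> on each of
    \<open>n\<close> unit windows, so length \<open>n\<close> at either end contains a good
    one.\<close>
  obtain n where n: "excess_bound < real n * \<epsilon>\<^sub>2" using reals_Archimedean3[OF \<epsilon>2(1)] by blast
  have "n > 0" using n K0 by (cases n) auto
  define \<tau> where "\<tau> = real n"
  have \<tau>: "\<tau> \<ge> 1" using \<open>n > 0\<close> by (simp add: \<tau>_def)
  \<comment> \<open>The displacement across the target direction is at most
    \<open>2 * \<tau>\<close>, so \<open>g\<close> can be chosen only after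
    \<open>\<tau>\<close>.\<close>
  define g where "g = Min {h\<^sub>0 / 12, pi / 4, \<epsilon> / (4 * \<tau>)}"
  have "0 < g" unfolding g_def using h0 \<epsilon> \<tau> by (subst Min_gr_iff) auto
  moreover have "g \<le> h\<^sub>0 / 12" "g \<le> pi / 4" "g \<le> \<epsilon> / (4 * \<tau>)"
    unfolding g_def by (rule Min_le; simp)+
  ultimately have g: "0 < g" "12 * g \<le> h\<^sub>0" "g \<le> pi / 4" "2 * \<tau> * g \<le> \<epsilon> / 2"
    using \<tau> by (auto simp: field_simps)
  have sg: "0 < sin g" using g pi_gt3 by (intro sin_gt_zero) auto
  \<comment> \<open>As \<open>b - a \<ge> T - 2 * \<tau>\<close> and
    \<open>a + (T - b) \<le> 2 * \<tau>\<close>, this yields the condition \<open>large\<close> of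
    \<open>middle_excess\<close>; the summand 1 leaves room for a unit window between
    \<open>a\<close> and \<open>b\<close>.\<close>
  define \<sigma> where "\<sigma> = 2 * \<tau> + 1 + excess_bound + (2 * \<tau> + 2) / sin g"
  have \<sigma>: "\<sigma> > 2 * \<tau> + 1" using K0 sg \<tau> by (simp add: \<sigma>_def add_pos_pos)
  show ?thesis
  proof (rule exI[of _ \<tau>], intro exI[of _ \<sigma>] conjI allI impI ballI)
    show "0 < \<tau>" "2 * \<tau> < \<sigma>" using \<tau> \<sigma> by auto
    fix T u X x\<^sub>1 y\<^sub>1 \<theta>\<^sub>1 P \<alpha> t
    assume opt: "optimal_trajectory \<phi> \<psi> p T u X (x\<^sub>1, y\<^sub>1, \<theta>\<^sub>1, 0)" and T: "T > \<sigma>"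
      and P: "adjoint_vector \<phi> \<psi> T u X P"
      and dir: "\<alpha> \<in> {0..<2 * pi}" "(x\<^sub>1, y\<^sub>1) = norm (x\<^sub>1, y\<^sub>1) *\<^sub>R (cos \<alpha>, sin \<alpha>)"
      and t: "t \<in> {\<tau>..T - \<tau>}"
    interpret optimal \<phi> \<psi> p T u X x\<^sub>1 y\<^sub>1 \<theta>\<^sub>1 \<alpha>
      by unfold_locales (use opt dir in auto)
    have T\<tau>: "2 * \<tau> + 1 < T" using T \<sigma> by simp
    have near: "\<exists>j<n. integral {c + real j..c + real j + 1} excess < \<epsilon>\<^sub>2" if c: "0 \<le> c" "c + \<tau> \<le> T" for c
    proof -
      have "excess integrable_on {c..c + real n}" using c by (intro excess_integrable) (auto simp: \<tau>_def)
      moreover have "integral {c..c + real n} excess < real n * \<epsilon>\<^sub>2"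
        using integral_excess_mono[of 0 c "c + real n" T] c total_excess n by (simp add: \<tau>_def)
      ultimately obtain j where "j < n" "integral {c + real j..c + real j + 1} excess < \<epsilon>\<^sub>2"
        by (rule exists_unit_interval_below)
      then show ?thesis by blast
    qed
    have good: "\<bar>\<kappa> r\<bar> \<le> \<rho> \<and> cos \<rho> \<le> cos (\<theta> r - \<alpha>)"
      if "0 \<le> s" "s + 1 \<le> T" "integral {s..s + 1} excess < \<epsilon>\<^sub>2" "r \<in> {s..s + 1}" for s r
      using window_small(1,2)[OF that(1-3) \<delta>2(1,2) \<epsilon>2(2-4) that(4)] \<delta>2 by linarith
    obtain i where i: "i < n" "integral {0 + real i..0 + real i + 1} excess < \<epsilon>\<^sub>2" using near[of 0] T\<tau> \<tau> by auto
    obtain j where j: "j < n" "integral {(T - \<tau>) + real j..(T - \<tau>) + real j + 1} excess < \<epsilon>\<^sub>2" using near[of "T - \<tau>"] T\<tau> \<tau> by auto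
    \<comment> \<open>Right end of the good window near 0 and left end of the one near
      \<open>T\<close>: thus \<open>0 < a\<close> and \<open>b < T\<close> even if a window touches
      an end of \<open>{0..T}\<close>.\<close>
    define a where "a = 0 + real i + 1"
    define b where "b = (T - \<tau>) + real j"
    have in1: "real i + 1 \<le> \<tau>" "real j + 1 \<le> \<tau>" using i j by (auto simp: \<tau>_def)
    have ab: "0 < a" "a \<le> \<tau>" "T - \<tau> \<le> b" "b < T" "a + 1 \<le> b" using in1 T\<tau> by (auto simp: a_def b_def)
    have na: "\<bar>\<kappa> a\<bar> \<le> \<rho> \<and> cos \<rho> \<le> cos (\<theta> a - \<alpha>)"
      by (rule good[OF _ _ i(2)]) (use in1 T\<tau> \<tau> in \<open>auto simp: a_def\<close>)
    have nb: "\<bar>\<kappa> b\<bar> \<le> \<rho> \<and> cos \<rho> \<le> cos (\<theta> b - \<alpha>)"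
      by (rule good[OF _ _ j(2)]) (use in1 T\<tau> \<tau> in \<open>auto simp: b_def\<close>)
    define h where "h = 6 * (2 * \<rho> + g)"
    have h: "0 < h" "h \<le> h\<^sub>0" using \<rho> g by (auto simp: h_def \<rho>_def)
    have large: "(b - a - excess_bound) * sin g > a + (T - b) + 2"
    proof -
      have "1 + (2 * \<tau> + 2) / sin g \<le> b - a - excess_bound" using T ab by (simp add: \<sigma>_def)
      from mult_right_mono[OF this, of "sin g"] sg
      have "(1 + (2 * \<tau> + 2) / sin g) * sin g \<le> (b - a - excess_bound) * sin g" by simp
      moreover have "(2 * \<tau> + 2) / sin g * sin g = 2 * \<tau> + 2" using sg by simp
      then have "(1 + (2 * \<tau> + 2) / sin g) * sin g = sin g + (2 * \<tau> + 2)" by (simp only: distrib_right mult_1_left)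
      ultimately show ?thesis using ab sg by linarith
    qed
    have "integral {a..b} excess \<le> (a + (T - b)) * g + 2 * h + 2 * \<phi> h + 2 * \<psi> h"
      by (rule middle_excess[OF _ _ _ _ _ _ _ \<rho> g(1,3) large h_def]) (use ab na nb in auto)
    also have "\<dots> < \<epsilon>"
    proof -
      have "(a + (T - b)) * g \<le> 2 * \<tau> * g" using ab g by (intro mult_right_mono) auto
      moreover have "\<phi> h \<le> \<epsilon> / 16" "\<psi> h \<le> \<epsilon> / 16" using e1(2)[of h] e2(2)[of h] h h0 by auto
      ultimately show ?thesis using g(4) h h0 \<epsilon>(1) by linarith
    qed
    finally have mid: "integral {a..b} excess < \<epsilon>" .
    \<comment> \<open>A unit window inside \<open>{a..b}\<close> that contains \<open>t\<close>,
      also when \<open>t > b - 1\<close>.\<close>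
    define s where "s = min t (b - 1)"
    have s: "a \<le> s" "s + 1 \<le> b" "t \<in> {s..s + 1}" using t ab by (auto simp: s_def)
    have s0: "0 \<le> s" "s + 1 \<le> T" using s ab by auto
    have sm: "integral {s..s + 1} excess < \<epsilon>"
      using integral_excess_mono[of a s "s + 1" b] s ab mid by simp
    have \<kappa>t: "\<bar>\<kappa> t\<bar> \<le> \<eta>" and \<theta>t: "\<bar>angle_diff (\<theta> t) \<alpha>\<bar> \<le> \<eta>"
    proof -
      note w = window_small(1,2)[OF s0 sm \<delta>(1,2) \<epsilon>(2-4) s(3)]
      show "\<bar>\<kappa> t\<bar> \<le> \<eta>" using w \<delta> by linarith
      show "\<bar>angle_diff (\<theta> t) \<alpha>\<bar> \<le> \<eta>" by (rule abs_angle_diff_le) (use w \<delta> \<eta> in auto)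
    qed
    have p34: "\<bar>fst (snd (snd (P t)))\<bar> \<le> 1600 * \<eta>" "\<bar>snd (snd (snd (P t)))\<bar> \<le> 1600 * \<eta>"
      by (rule adjoint_small[OF P s0 sm \<delta>(1,2) \<epsilon>(2-4) \<eta>(1,2) \<delta>(5,6) _ \<delta>'(1,2) \<epsilon>(5) _ s(3)];
          use d1 d2 d3 d4 \<delta> \<delta>' in auto)+
    have norm4: "norm (v, w, y, z) \<le> \<bar>v\<bar> + (\<bar>w\<bar> + (\<bar>y\<bar> + \<bar>z\<bar>))" for v w y z :: real
      using norm_Pair_le[of v "(w, y, z)"] norm_Pair_le[of w "(y, z)"] norm_Pair_le[of y z] by simp
    have "Z_deviation \<alpha> (X t) (P t) = (angle_diff (\<theta> t) \<alpha>, \<kappa> t, fst (snd (snd (P t))), snd (snd (snd (P t))))"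
      by (simp add: X_eq Z_deviation_def split: prod.splits)
    then have "norm (Z_deviation \<alpha> (X t) (P t)) \<le> \<bar>angle_diff (\<theta> t) \<alpha>\<bar> +
        (\<bar>\<kappa> t\<bar> + (\<bar>fst (snd (snd (P t)))\<bar> + \<bar>snd (snd (snd (P t)))\<bar>))"
      using norm4 by metis
    also have "\<dots> \<le> \<eta> + (\<eta> + (1600 * \<eta> + 1600 * \<eta>))"
      by (intro add_mono \<kappa>t \<theta>t p34)
    also have "\<dots> < \<nu>" using \<eta> by simp
    finally show "norm (Z_deviation \<alpha> (X t) (P t)) < \<nu>" .
  qed
qed

theorem theorem3p7:
  fixes \<phi> \<psi> :: "real \<Rightarrow> real" and p :: real
  assumes "\<And>r. \<phi> r \<ge> 0" and "\<And>r. \<psi> r \<ge> 0"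
    and "\<And>r. \<phi> (- r) = \<phi> r" and "\<And>r. \<psi> (- r) = \<psi> r"
    and "C2 \<phi>" and "C2 \<psi>"
    and "mono_on {0..} \<phi>" and "mono_on {0..} \<psi>"
    and "\<phi> 0 = 0" and "\<psi> 0 = 0"
    and "strictly_convex \<psi>" and "deriv (deriv \<psi>) 0 > 0"
    and "p > 1"
    and "\<exists>C>0. \<exists>R>0. \<forall>r. \<bar>r\<bar> \<ge> R \<longrightarrow> \<psi> r \<ge> C * \<bar>r\<bar> powr p"
  shows "\<forall>\<nu>>0. \<exists>\<tau>>0. \<exists>\<sigma>>2 * \<tau>.
    \<forall>T u X x\<^sub>1 y\<^sub>1 \<theta>\<^sub>1 P \<alpha>.
      optimal_trajectory \<phi> \<psi> p T u X (x\<^sub>1, y\<^sub>1, \<theta>\<^sub>1, 0) \<longrightarrow> T > \<sigma> \<longrightarrow>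
      adjoint_vector \<phi> \<psi> T u X P \<longrightarrow>
      \<alpha> \<in> {0..<2 * pi} \<longrightarrow> (x\<^sub>1, y\<^sub>1) = norm (x\<^sub>1, y\<^sub>1) *\<^sub>R (cos \<alpha>, sin \<alpha>) \<longrightarrow>
      (\<forall>t\<in>{\<tau>..T - \<tau>}. norm (Z_deviation \<alpha> (X t) (P t)) < \<nu>)"
proof -
  interpret standing_cost \<phi> \<psi> p by unfold_locales (use assms in auto)
  show ?thesis using turnpike by blast
qed

end
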